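(* 1. For $1\le m\le n$, $\ \#\mathcal E(\mathbf A_n,\varpi_m)=m\binom{n}{m}=n\binom{n-1}{m-1}$. 2. $\#\mathcal E(\mathbf D_n,\varpi_n)=n2^{n-3}$.
   Context: For a simple Lie algebra $\mathfrak g$ (over an algebraically closed field of characteristic zero) with a fixed Cartan subalgebra and a fixed set of simple roots, and a dominant weight $\lambda$, $\mathcal P(\mathfrak g,\lambda)$ is the set of weights of the simple $\mathfrak g$-module with highest weight $\lambda$, with the root order: $\mu$ covers $\gamma$ if and only if $\mu-\gamma$ is a simple root. $\mathcal E(\mathfrak g,\lambda)$ is the set of edges of its Hasse diagram, i.e. of pairs $(\mu,\gamma)$ of weights in $\mathcal P(\mathfrak g,\lambda)$ such that $\mu$ covers $\gamma$. $\mathbf A_n=\mathfrak{sl}_{n+1}$, and $\varpi_m$ is the highest weight of the $m$-th exterior power of the tautological representation. $\mathbf D_n=\mathfrak{so}_{2n}$ (one may take $n\ge4$), with simple roots $\varepsilon_1-\varepsilon_2,\dots,\varepsilon_{n-1}-\varepsilon_n,\varepsilon_{n-1}+\varepsilon_n$ and $\varpi_n=\frac12(\varepsilon_1+\dots+\varepsilon_n)$ (a half-spinor representation, of dimension $2^{n-1}$). *)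

theory Defs
  imports
    "Jordan_Normal_Form.Matrix"
    "HOL-Library.Function_Algebras"
    "HOL-Library.FuncSet"
    "HOL-Computational_Algebra.Polynomial"
begin

section \<open>Matrix Lie algebras with a fixed Cartan subalgebra and fixed simple roots\<close>

text \<open>
  Linear functionals on the Cartan subalgebra are represented by functions that are
  \<^const>\<open>extensional\<close> on it (they have the value \<^const>\<open>undefined\<close> outside), so that
  equality of functionals on the Cartan subalgebra is equality in HOL and sets of
  functionals have the right cardinality.
\<close>

record 'k based_lie_algebra =
  lie :: "'k mat set"
  cartan :: "'k mat set"
  simple_roots :: "('k mat \<Rightarrow> 'k) set"

definition lie_bracket :: "'k::comm_ring_1 mat \<Rightarrow> 'k mat \<Rightarrow> 'k mat" where
  "lie_bracket X Y = X * Y - Y * X"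

definition root_space :: "'k::field based_lie_algebra \<Rightarrow> ('k mat \<Rightarrow> 'k) \<Rightarrow> 'k mat set" where
  "root_space L \<alpha> = {X \<in> lie L. \<forall>H\<in>cartan L. lie_bracket H X = \<alpha> H \<cdot>\<^sub>m X}"

definition roots :: "'k::field based_lie_algebra \<Rightarrow> ('k mat \<Rightarrow> 'k) set" where
  "roots L = {\<alpha> \<in> extensional (cartan L).
     (\<exists>H\<in>cartan L. \<alpha> H \<noteq> 0) \<and> (\<exists>X\<in>root_space L \<alpha>. X \<noteq> 0\<^sub>m (dim_row X) (dim_col X))}"

definition positive_roots :: "'k::field based_lie_algebra \<Rightarrow> ('k mat \<Rightarrow> 'k) set" where
  "positive_roots L = {\<alpha> \<in> roots L.
     \<exists>c :: ('k mat \<Rightarrow> 'k) \<Rightarrow> nat.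
       \<forall>H\<in>cartan L. \<alpha> H = (\<Sum>\<beta>\<in>simple_roots L. of_nat (c \<beta>) * \<beta> H)}"


section \<open>Modules, weights and highest weights\<close>

text \<open>
  The underlying vector space of a module is a subspace of a space of functions
  \<open>'i \<Rightarrow> 'k\<close> with pointwise operations.
\<close>

abbreviation fun_scale :: "'k::field \<Rightarrow> ('i \<Rightarrow> 'k) \<Rightarrow> 'i \<Rightarrow> 'k" where
  "fun_scale c v \<equiv> (\<lambda>i. c * v i)"

definition lie_module ::
  "'k::field based_lie_algebra \<Rightarrow> ('i \<Rightarrow> 'k) set \<Rightarrow> ('k mat \<Rightarrow> ('i \<Rightarrow> 'k) \<Rightarrow> 'i \<Rightarrow> 'k) \<Rightarrow> bool"
where
  "lie_module L V \<rho> \<longleftrightarrow>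
     module.subspace fun_scale V \<and>
     (\<forall>X\<in>lie L. \<forall>v\<in>V. \<rho> X v \<in> V) \<and>
     (\<forall>X\<in>lie L. \<forall>v\<in>V. \<forall>w\<in>V. \<rho> X (v + w) = \<rho> X v + \<rho> X w) \<and>
     (\<forall>X\<in>lie L. \<forall>c. \<forall>v\<in>V. \<rho> X (fun_scale c v) = fun_scale c (\<rho> X v)) \<and>
     (\<forall>X\<in>lie L. \<forall>Y\<in>lie L. \<forall>v\<in>V. \<rho> (X + Y) v = \<rho> X v + \<rho> Y v) \<and>
     (\<forall>c. \<forall>X\<in>lie L. \<forall>v\<in>V. \<rho> (c \<cdot>\<^sub>m X) v = fun_scale c (\<rho> X v)) \<and>
     (\<forall>X\<in>lie L. \<forall>Y\<in>lie L. \<forall>v\<in>V. \<rho> (lie_bracket X Y) v = \<rho> X (\<rho> Y v) - \<rho> Y (\<rho> X v))"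

definition simple_lie_module ::
  "'k::field based_lie_algebra \<Rightarrow> ('i \<Rightarrow> 'k) set \<Rightarrow> ('k mat \<Rightarrow> ('i \<Rightarrow> 'k) \<Rightarrow> 'i \<Rightarrow> 'k) \<Rightarrow> bool"
where
  "simple_lie_module L V \<rho> \<longleftrightarrow>
     lie_module L V \<rho> \<and> V \<noteq> {0} \<and>
     (\<forall>W\<subseteq>V. module.subspace fun_scale W \<and> (\<forall>X\<in>lie L. \<forall>w\<in>W. \<rho> X w \<in> W)
        \<longrightarrow> W = {0} \<or> W = V)"

definition weight_space ::
  "'k::field based_lie_algebra \<Rightarrow> ('i \<Rightarrow> 'k) set \<Rightarrow> ('k mat \<Rightarrow> ('i \<Rightarrow> 'k) \<Rightarrow> 'i \<Rightarrow> 'k)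
     \<Rightarrow> ('k mat \<Rightarrow> 'k) \<Rightarrow> ('i \<Rightarrow> 'k) set"
where
  "weight_space L V \<rho> \<mu> = {v \<in> V. \<forall>H\<in>cartan L. \<rho> H v = fun_scale (\<mu> H) v}"

definition is_weight ::
  "'k::field based_lie_algebra \<Rightarrow> ('i \<Rightarrow> 'k) set \<Rightarrow> ('k mat \<Rightarrow> ('i \<Rightarrow> 'k) \<Rightarrow> 'i \<Rightarrow> 'k)
     \<Rightarrow> ('k mat \<Rightarrow> 'k) \<Rightarrow> bool"
where
  "is_weight L V \<rho> \<mu> \<longleftrightarrow>
     \<mu> \<in> extensional (cartan L) \<and> (\<exists>v\<in>weight_space L V \<rho> \<mu>. v \<noteq> 0)"

definition is_highest_weight ::
  "'k::field based_lie_algebra \<Rightarrow> ('i \<Rightarrow> 'k) set \<Rightarrow> ('k mat \<Rightarrow> ('i \<Rightarrow> 'k) \<Rightarrow> 'i \<Rightarrow> 'k)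
     \<Rightarrow> ('k mat \<Rightarrow> 'k) \<Rightarrow> bool"
where
  "is_highest_weight L V \<rho> \<Lambda> \<longleftrightarrow>
     \<Lambda> \<in> extensional (cartan L) \<and>
     (\<exists>v\<in>weight_space L V \<rho> \<Lambda>. v \<noteq> 0 \<and>
        (\<forall>\<alpha>\<in>positive_roots L. \<forall>X\<in>root_space L \<alpha>. \<rho> X v = 0))"


section \<open>The weight poset and its Hasse diagram\<close>

text \<open>
  A simple module over a finite-dimensional Lie algebra has countable dimension, hence it is
  isomorphic to one on a subspace of \<open>nat \<Rightarrow> 'k\<close>.  Therefore the modules quantified over below
  include a copy of the simple module with highest weight \<open>\<Lambda>\<close>; since that module is unique
  up to isomorphism, the set below is the set of its weights.
\<close>

definition weight_poset ::
  "'k::field based_lie_algebra \<Rightarrow> ('k mat \<Rightarrow> 'k) \<Rightarrow> ('k mat \<Rightarrow> 'k) set"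
where
  "weight_poset L \<Lambda> = {\<mu>. \<exists>(V :: (nat \<Rightarrow> 'k) set) \<rho>.
     simple_lie_module L V \<rho> \<and> is_highest_weight L V \<rho> \<Lambda> \<and> is_weight L V \<rho> \<mu>}"

definition root_covers ::
  "'k::field based_lie_algebra \<Rightarrow> ('k mat \<Rightarrow> 'k) \<Rightarrow> ('k mat \<Rightarrow> 'k) \<Rightarrow> bool"
where
  "root_covers L \<mu> \<gamma> \<longleftrightarrow> (\<lambda>H\<in>cartan L. \<mu> H - \<gamma> H) \<in> simple_roots L"

definition hasse_edges ::
  "'k::field based_lie_algebra \<Rightarrow> ('k mat \<Rightarrow> 'k) \<Rightarrow> (('k mat \<Rightarrow> 'k) \<times> ('k mat \<Rightarrow> 'k)) set"
where
  "hasse_edges L \<Lambda> =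
     {(\<mu>, \<gamma>). \<mu> \<in> weight_poset L \<Lambda> \<and> \<gamma> \<in> weight_poset L \<Lambda> \<and> root_covers L \<mu> \<gamma>}"


section \<open>Type A\<close>

text \<open>Matrix indices start at 0: \<open>H $$ (i, i)\<close> is the value at \<open>H\<close> of the functional that is
  usually written \<open>\<epsilon>\<close> with index \<open>i + 1\<close>.\<close>

definition sl :: "nat \<Rightarrow> 'k::field mat set" where
  "sl N = {X \<in> carrier_mat N N. (\<Sum>i<N. X $$ (i, i)) = 0}"

definition type_A :: "nat \<Rightarrow> 'k::field based_lie_algebra" where
  "type_A n =
     (let h = {H \<in> sl (n + 1). diagonal_mat H} in
      \<lparr> lie = sl (n + 1),
        cartan = h,
        simple_roots = {(\<lambda>H\<in>h. H $$ (i, i) - H $$ (i + 1, i + 1)) | i. i < n} \<rparr>)"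

text \<open>
  The \<open>m\<close>-th exterior power of the space of column vectors of length \<open>N\<close>, realised (as usual in
  characteristic 0) as the space of alternating tensors: the function \<open>f\<close> stands for the tensor
  with coefficient \<open>f xs\<close> at the tensor product of the standard basis vectors with indices
  \<open>xs ! 0, \<dots>, xs ! (m - 1)\<close>.  A matrix \<open>X\<close> acts by
  the Leibniz rule, applying \<open>X\<close> to one tensor factor at a time.
\<close>

definition tensor_indices :: "nat \<Rightarrow> nat \<Rightarrow> nat list set" where
  "tensor_indices N m = {xs. length xs = m \<and> set xs \<subseteq> {..<N}}"

definition exterior_power :: "nat \<Rightarrow> nat \<Rightarrow> (nat list \<Rightarrow> 'k::field) set" where
  "exterior_power N m = {f.
     (\<forall>xs. xs \<notin> tensor_indices N m \<longrightarrow> f xs = 0) \<and>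
     (\<forall>xs\<in>tensor_indices N m. \<forall>a<m. \<forall>b<m. a \<noteq> b \<longrightarrow>
        (xs ! a = xs ! b \<longrightarrow> f xs = 0) \<and>
        f (xs[a := xs ! b, b := xs ! a]) = - f xs)}"

definition tensor_action ::
  "nat \<Rightarrow> nat \<Rightarrow> 'k::field mat \<Rightarrow> (nat list \<Rightarrow> 'k) \<Rightarrow> nat list \<Rightarrow> 'k"
where
  "tensor_action N m X f xs =
     (if xs \<in> tensor_indices N m
      then \<Sum>a<m. \<Sum>k<N. X $$ (xs ! a, k) * f (xs[a := k])
      else 0)"

definition fund_weight_A :: "nat \<Rightarrow> nat \<Rightarrow> 'k::field mat \<Rightarrow> 'k" where
  "fund_weight_A n m =
     (THE \<Lambda>. is_highest_weight (type_A n) (exterior_power (n + 1) m) (tensor_action (n + 1) m) \<Lambda>)"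


section \<open>Type D\<close>

text \<open>
  The orthogonal Lie algebra of the split form with Gram matrix \<open>J = (0 1; 1 0)\<close> in
  \<open>n \<times> n\<close> blocks.  Over an algebraically closed field of characteristic different from 2 every
  nondegenerate symmetric form on a space of dimension \<open>2n\<close> is equivalent to this one.  The
  diagonal matrices in it are \<open>diag (t\<^sub>1, \<dots>, t\<^sub>n, - t\<^sub>1, \<dots>, - t\<^sub>n)\<close>, so that again
  \<open>H $$ (i, i)\<close>, for \<open>i < n\<close>, is the value of \<open>\<epsilon>\<close> with index \<open>i + 1\<close>.
\<close>

definition split_form :: "nat \<Rightarrow> 'k::field mat" where
  "split_form n = four_block_mat (0\<^sub>m n n) (1\<^sub>m n) (1\<^sub>m n) (0\<^sub>m n n)"

definition so_even :: "nat \<Rightarrow> 'k::field mat set" where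
  "so_even n = {X \<in> carrier_mat (2 * n) (2 * n).
     transpose_mat X * split_form n + split_form n * X = 0\<^sub>m (2 * n) (2 * n)}"

definition type_D :: "nat \<Rightarrow> 'k::field based_lie_algebra" where
  "type_D n =
     (let h = {H \<in> so_even n. diagonal_mat H} in
      \<lparr> lie = so_even n,
        cartan = h,
        simple_roots =
          {(\<lambda>H\<in>h. H $$ (i, i) - H $$ (i + 1, i + 1)) | i. i < n - 1}
          \<union> {(\<lambda>H\<in>h. H $$ (n - 2, n - 2) + H $$ (n - 1, n - 1))} \<rparr>)"

definition half_spin_weight :: "nat \<Rightarrow> 'k::field mat \<Rightarrow> 'k" where
  "half_spin_weight n = (\<lambda>H\<in>cartan (type_D n). (1 / 2) * (\<Sum>i<n. H $$ (i, i)))"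

end

theory Submission
  imports Defs "HOL-Library.Nat_Bijection" "Jordan_Normal_Form.Determinant"
begin

text \<open>
  Both representations are minuscule and can be realised on a Fock space with a basis indexed
  by finite sets of natural numbers, each basis vector spanning a weight space of its own.  An
  edge of the Hasse diagram is then a pair of sets, where subtracting
  \<open>\<epsilon>\<^sub>i - \<epsilon>\<^sub>j\<close> replaces the element \<open>i\<close> by \<open>j\<close>, and subtracting
  \<open>\<epsilon>\<^sub>i + \<epsilon>\<^sub>j\<close> removes \<open>i\<close> and \<open>j\<close>.  In type A the states are the
  \<open>m\<close>-element subsets of an \<open>(n + 1)\<close>-element set; for each of the \<open>n\<close> simple roots the edges
  correspond to the \<open>(m - 1)\<close>-element subsets of the other \<open>n - 1\<close> indices.  In type D the states
  are the subsets of an \<open>n\<close>-element set whose complement has even size; each of the \<open>n\<close> simple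
  roots fixes two indices and the parity of the remaining part, which leaves
  \<open>2\<^sup>n\<^sup>-\<^sup>3\<close> edges.

  The set \<^const>\<open>weight_poset\<close> ranges over all simple modules with the given highest weight,
  so the weights have to be shown not to depend on the module
  (\<open>is_weight_transfer\<close>).  Given two such modules with highest weight vectors \<open>v\<close> and
  \<open>v'\<close>, consider the submodule of the product generated by \<open>(v, v')\<close>.  It is spanned by what
  arises from \<open>(v, v')\<close> by lowering operators, so its top weight space is the line through
  \<open>(v, v')\<close> and contains neither \<open>(v, 0)\<close> nor \<open>(0, v')\<close>.  By simplicity it is therefore the
  graph of an isomorphism.

  One construction serves both types.  The quadratic elements of the Clifford algebra of
  \<open>2 n\<close> generators act on the Fock space and satisfy the commutation relations of
  \<open>so (2 n)\<close> (\<open>spin_commutator\<close>).  Restricted to states of one parity this is the half-spinor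
  module; restricted to \<open>sl (n + 1)\<close>, embedded as the block diagonal matrices
  \<open>(X, - X\<^sup>T)\<close> in \<open>so (2 n + 2)\<close>, and to states of size \<open>m\<close>, it is the \<open>m\<close>-th exterior power.
  Simplicity and the list of weights follow from the weights being pairwise different and the
  states being connected by simple root vectors (locale \<open>weight_basis\<close>).

  The exterior power on alternating tensors enters only through the value of
  \<^const>\<open>fund_weight_A\<close>: an alternating tensor killed by the raising operators can be nonzero only
  on the rearrangements of \<open>0, \<dots>, m - 1\<close>, and a determinant provides such a tensor
  (\<open>fund_weight_A_eq\<close>).
\<close>


section \<open>Simple modules with the same highest weight have the same weights\<close>

lemma module_fun_scale: "Modules.module (fun_scale :: 'k::field \<Rightarrow> ('i \<Rightarrow> 'k) \<Rightarrow> _)"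
  by unfold_locales (auto simp: fun_eq_iff algebra_simps)

lemma subspace_fun_scale_iff:
  "module.subspace (fun_scale :: 'k::field \<Rightarrow> ('i \<Rightarrow> 'k) \<Rightarrow> _) V \<longleftrightarrow>
     0 \<in> V \<and> (\<forall>x\<in>V. \<forall>y\<in>V. x + y \<in> V) \<and> (\<forall>c. \<forall>x\<in>V. fun_scale c x \<in> V)"
  by (simp add: Modules.module.subspace_def[OF module_fun_scale])

lemma simple_lie_moduleD:
  assumes simple: "simple_lie_module L V \<rho>"
    and K: "K \<subseteq> V" "0 \<in> K" "\<And>x y. x \<in> K \<Longrightarrow> y \<in> K \<Longrightarrow> x + y \<in> K"
      "\<And>c x. x \<in> K \<Longrightarrow> fun_scale c x \<in> K" "\<And>X x. X \<in> lie L \<Longrightarrow> x \<in> K \<Longrightarrow> \<rho> X x \<in> K"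
  shows "K = {0} \<or> K = V"
proof -
  have "module.subspace fun_scale K" unfolding subspace_fun_scale_iff using K by simp
  with simple K show ?thesis unfolding simple_lie_module_def by simp
qed

text \<open>
  The additive closure of the lowering eigenvectors of \<open>H0\<close>, the Cartan subalgebra and the
  positive root spaces.  That it is the whole Lie algebra expresses the triangular decomposition.
\<close>

inductive_set triangular_span :: "'k::field based_lie_algebra \<Rightarrow> 'k mat \<Rightarrow> 'k mat set"
  for L :: "'k::field based_lie_algebra" and H0 :: "'k mat"
where
  lower: "F \<in> lie L \<Longrightarrow> 1 \<le> d \<Longrightarrow> lie_bracket H0 F = (- of_nat d) \<cdot>\<^sub>m F
            \<Longrightarrow> F \<in> triangular_span L H0"
| diagonal: "H \<in> cartan L \<Longrightarrow> H \<in> triangular_span L H0"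
| raise: "\<alpha> \<in> positive_roots L \<Longrightarrow> E \<in> root_space L \<alpha> \<Longrightarrow> E \<in> triangular_span L H0"
| add: "X \<in> triangular_span L H0 \<Longrightarrow> Y \<in> triangular_span L H0 \<Longrightarrow> X \<in> lie L \<Longrightarrow> Y \<in> lie L
            \<Longrightarrow> X + Y \<in> triangular_span L H0"

text \<open>
  The element \<open>H0\<close> on which every simple root takes the value \<open>1\<close> grades the Lie algebra and
  its modules by integers.
\<close>

locale graded_lie_algebra =
  fixes L :: "'k::field_char_0 based_lie_algebra" and H0 :: "'k mat"
  assumes H0: "H0 \<in> cartan L"
    and cartan_lie: "cartan L \<subseteq> lie L"
    and bracket_closed: "X \<in> lie L \<Longrightarrow> Y \<in> lie L \<Longrightarrow> lie_bracket X Y \<in> lie L"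
    and finite_simple: "finite (simple_roots L)"
    and simple_H0: "\<beta> \<in> simple_roots L \<Longrightarrow> \<beta> H0 = 1"
    and lie_triangular: "lie L \<subseteq> triangular_span L H0"
begin

text \<open>
  The value at \<open>H0\<close> is the sum of the coefficients with respect to the simple roots; it is not
  zero because roots are nonzero functionals.
\<close>

lemma positive_root_H0:
  assumes "\<alpha> \<in> positive_roots L"
  obtains k :: nat where "0 < k" "\<alpha> H0 = of_nat k"
proof -
  from assms obtain c H where c: "\<forall>H\<in>cartan L. \<alpha> H = (\<Sum>\<beta>\<in>simple_roots L. of_nat (c \<beta>) * \<beta> H)"
    and H: "H \<in> cartan L" "\<alpha> H \<noteq> 0"
    unfolding positive_roots_def roots_def by blast
  have "\<alpha> H0 = of_nat (\<Sum>\<beta>\<in>simple_roots L. c \<beta>)"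
    using c H0 by (simp add: simple_H0)
  moreover have "(\<Sum>\<beta>\<in>simple_roots L. c \<beta>) \<noteq> 0"
  proof
    assume "(\<Sum>\<beta>\<in>simple_roots L. c \<beta>) = 0"
    then have "\<forall>\<beta>\<in>simple_roots L. c \<beta> = 0" using finite_simple by simp
    then have "\<alpha> H = 0" using c H by simp
    with H show False by simp
  qed
  ultimately show ?thesis using that by blast
qed

end

locale weight_module = graded_lie_algebra L H0
  for L :: "'k::field_char_0 based_lie_algebra" and H0 :: "'k mat" +
  fixes V :: "('i \<Rightarrow> 'k) set" and \<rho> :: "'k mat \<Rightarrow> ('i \<Rightarrow> 'k) \<Rightarrow> 'i \<Rightarrow> 'k"
  assumes lie_module: "lie_module L V \<rho>"
begin

lemma zero_in: "0 \<in> V"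
  and add_in: "x \<in> V \<Longrightarrow> y \<in> V \<Longrightarrow> x + y \<in> V"
  and scale_in: "x \<in> V \<Longrightarrow> fun_scale c x \<in> V"
  and act_in: "X \<in> lie L \<Longrightarrow> x \<in> V \<Longrightarrow> \<rho> X x \<in> V"
  and act_add: "X \<in> lie L \<Longrightarrow> x \<in> V \<Longrightarrow> y \<in> V \<Longrightarrow> \<rho> X (x + y) = \<rho> X x + \<rho> X y"
  and act_scale: "X \<in> lie L \<Longrightarrow> x \<in> V \<Longrightarrow> \<rho> X (fun_scale c x) = fun_scale c (\<rho> X x)"
  and add_act: "X \<in> lie L \<Longrightarrow> Y \<in> lie L \<Longrightarrow> x \<in> V \<Longrightarrow> \<rho> (X + Y) x = \<rho> X x + \<rho> Y x"
  and scale_act: "X \<in> lie L \<Longrightarrow> x \<in> V \<Longrightarrow> \<rho> (c \<cdot>\<^sub>m X) x = fun_scale c (\<rho> X x)"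
  and bracket_act: "X \<in> lie L \<Longrightarrow> Y \<in> lie L \<Longrightarrow> x \<in> V \<Longrightarrow>
        \<rho> (lie_bracket X Y) x = \<rho> X (\<rho> Y x) - \<rho> Y (\<rho> X x)"
  using lie_module unfolding lie_module_def subspace_fun_scale_iff by simp_all

lemma diff_in: "x \<in> V \<Longrightarrow> y \<in> V \<Longrightarrow> x - y \<in> V"
proof -
  assume "x \<in> V" "y \<in> V"
  then have "x + fun_scale (-1) y \<in> V" by (intro add_in scale_in)
  also have "x + fun_scale (-1) y = x - y" by (simp add: fun_eq_iff)
  finally show ?thesis .
qed

lemma act_zero: "X \<in> lie L \<Longrightarrow> \<rho> X 0 = 0"
  using act_add[OF _ zero_in zero_in, of X] by simp

lemma bracket_act': "X \<in> lie L \<Longrightarrow> Y \<in> lie L \<Longrightarrow> x \<in> V \<Longrightarrow>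
    \<rho> X (\<rho> Y x) = \<rho> Y (\<rho> X x) + \<rho> (lie_bracket X Y) x"
  by (simp add: bracket_act)

lemma H0_lie: "H0 \<in> lie L" using H0 cartan_lie by blast

lemma act_eigenvector:
  assumes "X \<in> lie L" "lie_bracket H0 X = d \<cdot>\<^sub>m X" "x \<in> V" "\<rho> H0 x = fun_scale a x"
  shows "\<rho> H0 (\<rho> X x) = fun_scale (a + d) (\<rho> X x)"
proof -
  have "\<rho> H0 (\<rho> X x) = \<rho> X (\<rho> H0 x) + \<rho> (d \<cdot>\<^sub>m X) x"
    using bracket_act'[OF H0_lie assms(1,3)] assms(2) by simp
  also have "\<dots> = fun_scale a (\<rho> X x) + fun_scale d (\<rho> X x)"
    using assms by (simp add: act_scale scale_act)
  finally show ?thesis by (simp add: fun_eq_iff algebra_simps)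
qed

text \<open>
  The operator \<open>(H0 - l + 1) \<cdots> (H0 - l + N)\<close>: it kills the eigenspaces of \<open>H0\<close> with
  eigenvalues \<open>l - 1, \<dots>, l - N\<close> and is invertible on the eigenspace with eigenvalue \<open>l\<close>.
\<close>

primrec cut :: "'k \<Rightarrow> nat \<Rightarrow> ('i \<Rightarrow> 'k) \<Rightarrow> 'i \<Rightarrow> 'k" where
  "cut l 0 x = x"
| "cut l (Suc N) x = \<rho> H0 (cut l N x) - fun_scale (l - of_nat (Suc N)) (cut l N x)"

lemma cut_in: "x \<in> V \<Longrightarrow> cut l N x \<in> V"
proof (induction N)
  case (Suc N)
  then show ?case unfolding cut.simps by (intro diff_in scale_in act_in H0_lie)
qed simp

lemma cut_linear:
  assumes "x \<in> V" "y \<in> V"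
  shows "cut l N (x + fun_scale c y) = cut l N x + fun_scale c (cut l N y)"
proof (induction N)
  case (Suc N)
  have "\<rho> H0 (cut l N x + fun_scale c (cut l N y)) = \<rho> H0 (cut l N x) + fun_scale c (\<rho> H0 (cut l N y))"
    using assms by (simp add: act_add act_scale cut_in scale_in H0_lie)
  then show ?case unfolding cut.simps Suc.IH
    by (simp only: fun_eq_iff plus_fun_apply fun_diff_def) (simp add: algebra_simps)
qed simp

lemma cut_zero: "cut l N 0 = 0"
proof (induction N)
  case (Suc N)
  have "cut l (Suc N) 0 = 0 - fun_scale (l - of_nat (Suc N)) 0"
    unfolding cut.simps Suc.IH act_zero[OF H0_lie] ..
  also have "\<dots> = 0" by (simp add: fun_eq_iff)
  finally show "cut l (Suc N) 0 = 0" .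
qed simp

lemma cut_eigenvector:
  assumes "x \<in> V" "\<rho> H0 x = fun_scale a x"
  shows "cut l N x = fun_scale (\<Prod>i<N. a - l + of_nat (Suc i)) x"
proof (induction N)
  case (Suc N)
  have "cut l (Suc N) x = fun_scale (\<Prod>i<N. a - l + of_nat (Suc i)) (fun_scale a x)
      - fun_scale (l - of_nat (Suc N)) (fun_scale (\<Prod>i<N. a - l + of_nat (Suc i)) x)"
    unfolding cut.simps Suc.IH act_scale[OF H0_lie assms(1)] assms(2) by simp
  also have "\<dots> = fun_scale (\<Prod>i<Suc N. a - l + of_nat (Suc i)) x"
    by (simp add: fun_eq_iff algebra_simps)
  finally show ?case .
qed simp

end

locale highest_weight_pair =
  weight_module L H0 V \<rho> + W: weight_module L H0 V' \<rho>'
  for L :: "'k::field_char_0 based_lie_algebra" and H0 :: "'k mat"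
    and V :: "('i \<Rightarrow> 'k) set" and \<rho>
    and V' :: "('j \<Rightarrow> 'k) set" and \<rho>' +
  fixes v :: "'i \<Rightarrow> 'k" and v' :: "'j \<Rightarrow> 'k" and \<Lambda> :: "'k mat \<Rightarrow> 'k"
  assumes v: "v \<in> weight_space L V \<rho> \<Lambda>" "v \<noteq> 0"
    and v': "v' \<in> weight_space L V' \<rho>' \<Lambda>" "v' \<noteq> 0"
    and raise_v: "\<And>\<alpha> X. \<alpha> \<in> positive_roots L \<Longrightarrow> X \<in> root_space L \<alpha> \<Longrightarrow> \<rho> X v = 0"
    and raise_v': "\<And>\<alpha> X. \<alpha> \<in> positive_roots L \<Longrightarrow> X \<in> root_space L \<alpha> \<Longrightarrow> \<rho>' X v' = 0"
begin

lemma v_in: "v \<in> V" and v'_in: "v' \<in> V'"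
  and v_weight: "H \<in> cartan L \<Longrightarrow> \<rho> H v = fun_scale (\<Lambda> H) v"
  and v'_weight: "H \<in> cartan L \<Longrightarrow> \<rho>' H v' = fun_scale (\<Lambda> H) v'"
  using v v' by (auto simp: weight_space_def)

text \<open>
  The result of a word in lowering operators of total degree \<open>j\<close>, applied to both highest weight vectors
  simultaneously.
\<close>

inductive lowered :: "nat \<Rightarrow> ('i \<Rightarrow> 'k) \<Rightarrow> ('j \<Rightarrow> 'k) \<Rightarrow> bool" where
  start: "lowered 0 v v'"
| lower: "lowered j x y \<Longrightarrow> F \<in> lie L \<Longrightarrow> 1 \<le> d \<Longrightarrow> lie_bracket H0 F = (- of_nat d) \<cdot>\<^sub>m F
            \<Longrightarrow> lowered (j + d) (\<rho> F x) (\<rho>' F y)"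

text \<open>
  The submodule of the product of the two modules that is generated by the pair of highest weight
  vectors, written as a relation.  By definition it is only the span of the words in lowering
  operators; it is closed under the whole Lie algebra by \<open>act_linked\<close>.
\<close>

inductive linked :: "('i \<Rightarrow> 'k) \<Rightarrow> ('j \<Rightarrow> 'k) \<Rightarrow> bool" where
  zero: "linked 0 0"
| step: "linked x y \<Longrightarrow> lowered j x' y' \<Longrightarrow> linked (x + fun_scale c x') (y + fun_scale c y')"

lemma lowered_in: "lowered j x y \<Longrightarrow> x \<in> V \<and> y \<in> V'"
  by (induction rule: lowered.induct) (auto intro: v_in v'_in act_in W.act_in)

lemma lowered_0: "lowered j x y \<Longrightarrow> j = 0 \<Longrightarrow> x = v \<and> y = v'"
  by (induction rule: lowered.induct) auto

lemma lowered_eigenvector: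
  "lowered j x y \<Longrightarrow> \<rho> H0 x = fun_scale (\<Lambda> H0 - of_nat j) x \<and> \<rho>' H0 y = fun_scale (\<Lambda> H0 - of_nat j) y"
proof (induction rule: lowered.induct)
  case start
  then show ?case by (simp add: v_weight v'_weight H0)
next
  case (lower j x y F d)
  with lowered_in[OF lower.hyps(1)] act_eigenvector[of F "- of_nat d" x] W.act_eigenvector[of F "- of_nat d" y]
  show ?case by (simp add: diff_diff_eq)
qed

lemma linked_in: "linked x y \<Longrightarrow> x \<in> V \<and> y \<in> V'"
proof (induction rule: linked.induct)
  case zero
  show "0 \<in> V \<and> 0 \<in> V'" by (intro conjI zero_in W.zero_in)
next
  case (step x y j x' y' c)
  then show "x + fun_scale c x' \<in> V \<and> y + fun_scale c y' \<in> V'"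
    using lowered_in by (intro conjI add_in W.add_in scale_in W.scale_in) auto
qed

lemma linked_add: "linked x' y' \<Longrightarrow> linked x y \<Longrightarrow> linked (x + x') (y + y')"
proof (induction rule: linked.induct)
  case (step a b j a' b' c)
  have "linked (x + a) (y + b)" by (rule step.IH) (rule step.prems)
  from linked.step[OF this step.hyps(2)]
  show "linked (x + (a + fun_scale c a')) (y + (b + fun_scale c b'))" by (simp only: add.assoc)
qed simp

lemma linked_scale: "linked x y \<Longrightarrow> linked (fun_scale c x) (fun_scale c y)"
proof (induction rule: linked.induct)
  case zero
  have "fun_scale c 0 = (0 :: 'i \<Rightarrow> 'k)" "fun_scale c 0 = (0 :: 'j \<Rightarrow> 'k)" by (simp_all add: fun_eq_iff)
  then show "linked (fun_scale c 0) (fun_scale c 0)" using linked.zero by simp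
next
  case (step x y j x' y' d)
  have "fun_scale c (x + fun_scale d x') = fun_scale c x + fun_scale (c * d) x'"
    "fun_scale c (y + fun_scale d y') = fun_scale c y + fun_scale (c * d) y'"
    by (simp_all add: fun_eq_iff algebra_simps)
  with linked.step[OF step.IH step.hyps(2)]
  show "linked (fun_scale c (x + fun_scale d x')) (fun_scale c (y + fun_scale d y'))" by simp
qed

lemma lowered_linked: "lowered j x y \<Longrightarrow> linked x y"
  using linked.step[OF linked.zero, of j x y 1] by simp

lemma lower_linked:
  assumes "F \<in> lie L" "1 \<le> d" "lie_bracket H0 F = (- of_nat d) \<cdot>\<^sub>m F"
  shows "linked x y \<Longrightarrow> linked (\<rho> F x) (\<rho>' F y)"
proof (induction rule: linked.induct)
  case zero
  show "linked (\<rho> F 0) (\<rho>' F 0)" using assms by (simp add: act_zero W.act_zero linked.zero)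
next
  case (step x y j x' y' c)
  have "linked (\<rho> F x + fun_scale c (\<rho> F x')) (\<rho>' F y + fun_scale c (\<rho>' F y'))"
    by (rule linked.step[OF step.IH lowered.lower[OF step.hyps(2) assms]])
  then show "linked (\<rho> F (x + fun_scale c x')) (\<rho>' F (y + fun_scale c y'))"
    using step linked_in lowered_in assms
    by (simp add: act_add W.act_add act_scale W.act_scale scale_in W.scale_in)
qed

text \<open>
  By the triangular decomposition there are three kinds of \<open>X\<close>: a
  lowering operator gives a word of length one, a Cartan element scales by the same factor on both
  sides, a raising operator kills both vectors.
\<close>

lemma act_v_linked:
  assumes "X \<in> lie L"
  shows "linked (\<rho> X v) (\<rho>' X v')"
proof -
  have "X \<in> triangular_span L H0" using assms lie_triangular by blast
  then have "linked (\<rho> X v) (\<rho>' X v')"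
  proof (induction rule: triangular_span.induct)
    case (lower F d)
    then show ?case using lower_linked lowered_linked[OF lowered.start] by blast
  next
    case (diagonal H)
    then show ?case using linked_scale[OF lowered_linked[OF lowered.start]]
      by (simp add: v_weight v'_weight)
  next
    case (raise \<alpha> E)
    then have "\<rho> E v = 0" "\<rho>' E v' = 0" by (auto intro: raise_v raise_v')
    then show "linked (\<rho> E v) (\<rho>' E v')" using linked.zero by metis
  next
    case (add X Y)
    then show "linked (\<rho> (X + Y) v) (\<rho>' (X + Y) v')"
      using linked_add by (metis add_act W.add_act v_in v'_in)
  qed
  then show ?thesis .
qed

text \<open>
  Induction on the word: \<open>X F w = F X w + [X, F] w\<close>, where the induction hypothesis applies to
  both \<open>X\<close> and \<open>[X, F]\<close>.
\<close>

lemma act_lowered_linked: "lowered j x y \<Longrightarrow> X \<in> lie L \<Longrightarrow> linked (\<rho> X x) (\<rho>' X y)"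
proof (induction arbitrary: X rule: lowered.induct)
  case start
  then show ?case by (rule act_v_linked)
next
  case (lower j x y F d)
  have in_V: "x \<in> V" "y \<in> V'" using lowered_in[OF lower.hyps(1)] by auto
  note bracket_act'[OF lower.prems lower.hyps(2) in_V(1)] W.bracket_act'[OF lower.prems lower.hyps(2) in_V(2)]
  moreover have "linked (\<rho> F (\<rho> X x)) (\<rho>' F (\<rho>' X y))"
    by (intro lower_linked[OF lower.hyps(2-4)] lower.IH lower.prems)
  moreover have "linked (\<rho> (lie_bracket X F) x) (\<rho>' (lie_bracket X F) y)"
    by (intro lower.IH bracket_closed lower.prems lower.hyps(2))
  ultimately show "linked (\<rho> X (\<rho> F x)) (\<rho>' X (\<rho>' F y))" using linked_add by metis
qed

lemma act_linked: "linked x y \<Longrightarrow> X \<in> lie L \<Longrightarrow> linked (\<rho> X x) (\<rho>' X y)"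
proof (induction rule: linked.induct)
  case zero
  then show "linked (\<rho> X 0) (\<rho>' X 0)" by (simp add: act_zero W.act_zero linked.zero)
next
  case (step x y j x' y' c)
  have "linked (\<rho> X x + fun_scale c (\<rho> X x')) (\<rho>' X y + fun_scale c (\<rho>' X y'))"
    by (rule linked_add[OF linked_scale[OF act_lowered_linked[OF step.hyps(2) step.prems]] step.IH[OF step.prems]])
  then show "linked (\<rho> X (x + fun_scale c x')) (\<rho>' X (y + fun_scale c y'))"
    using step linked_in lowered_in
    by (simp add: act_add W.act_add act_scale W.act_scale scale_in W.scale_in)
qed

lemma cut_lowered:
  assumes "lowered j x y" "0 < j" "j \<le> N"
  shows "cut (\<Lambda> H0) N x = 0 \<and> W.cut (\<Lambda> H0) N y = 0"
proof -
  have 0: "(\<Prod>i<N. \<Lambda> H0 - of_nat j - \<Lambda> H0 + of_nat (Suc i)) = 0"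
    using assms by (intro prod_zero bexI[of _ "j - 1"]) (auto simp: of_nat_diff)
  have x: "x \<in> V" "\<rho> H0 x = fun_scale (\<Lambda> H0 - of_nat j) x"
    and y: "y \<in> V'" "\<rho>' H0 y = fun_scale (\<Lambda> H0 - of_nat j) y"
    using lowered_in[OF assms(1)] lowered_eigenvector[OF assms(1)] by auto
  show ?thesis
    unfolding cut_eigenvector[OF x] W.cut_eigenvector[OF y] 0 by (simp add: fun_eq_iff)
qed

lemma cut_v: "cut (\<Lambda> H0) N v = fun_scale (fact N) v" "W.cut (\<Lambda> H0) N v' = fun_scale (fact N) v'"
proof -
  have "(\<Prod>i<N. \<Lambda> H0 - \<Lambda> H0 + of_nat (Suc i)) = (fact N :: 'k)"
    by (simp add: fact_prod_Suc atLeast0LessThan)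
  then show "cut (\<Lambda> H0) N v = fun_scale (fact N) v" "W.cut (\<Lambda> H0) N v' = fun_scale (fact N) v'"
    using cut_eigenvector[OF v_in v_weight[OF H0]] W.cut_eigenvector[OF v'_in v'_weight[OF H0]]
    by simp_all
qed

text \<open>
  In a linked pair the components of top degree are multiples of \<open>v\<close> and \<open>v'\<close> by the same scalar
  \<open>c\<close>, since only the empty word has degree \<open>0\<close>.  The operator \<open>cut\<close> isolates them, because a sum
  of words has bounded degree.
\<close>

lemma cut_linked:
  "linked x y \<Longrightarrow> \<exists>c N0. \<forall>N\<ge>N0. cut (\<Lambda> H0) N x = fun_scale (c * fact N) v \<and>
      W.cut (\<Lambda> H0) N y = fun_scale (c * fact N) v'"
proof (induction rule: linked.induct)
  case zero
  have "\<forall>N\<ge>0. cut (\<Lambda> H0) N 0 = fun_scale (0 * fact N) v \<and> W.cut (\<Lambda> H0) N 0 = fun_scale (0 * fact N) v'"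
    by (simp only: cut_zero W.cut_zero) (simp add: fun_eq_iff)
  then show ?case by blast
next
  case (step x y j x' y' b)
  then obtain c N0 where IH: "\<And>N. N \<ge> N0 \<Longrightarrow> cut (\<Lambda> H0) N x = fun_scale (c * fact N) v \<and>
      W.cut (\<Lambda> H0) N y = fun_scale (c * fact N) v'" by blast
  have in_V: "x \<in> V" "y \<in> V'" "x' \<in> V" "y' \<in> V'" using step linked_in lowered_in by auto
  show ?case
  proof (cases "j = 0")
    case True
    then have eq: "x' = v" "y' = v'" using lowered_0 step by auto
    have "\<forall>N\<ge>N0. cut (\<Lambda> H0) N (x + fun_scale b x') = fun_scale ((c + b) * fact N) v \<and>
      W.cut (\<Lambda> H0) N (y + fun_scale b y') = fun_scale ((c + b) * fact N) v'"
      using in_V IH by (auto simp: eq cut_linear W.cut_linear cut_v) (auto simp: fun_eq_iff algebra_simps)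
    then show ?thesis by blast
  next
    case False
    have "\<forall>N\<ge>max N0 j. cut (\<Lambda> H0) N (x + fun_scale b x') = fun_scale (c * fact N) v \<and>
      W.cut (\<Lambda> H0) N (y + fun_scale b y') = fun_scale (c * fact N) v'"
      using in_V IH cut_lowered[OF step.hyps(2)] False
      by (auto simp: cut_linear W.cut_linear fun_eq_iff)
    then show ?thesis by blast
  qed
qed

lemma not_linked_v_0: "\<not> linked v 0"
proof
  assume "linked v 0"
  then obtain c N where "fun_scale (fact N) v = fun_scale (c * fact N) v"
    "0 = fun_scale (c * fact N) v'"
    using cut_linked[of v 0] by (auto simp: cut_v W.cut_zero)
  then have *: "\<And>i. fact N * v i = c * fact N * v i" "\<And>i. 0 = c * fact N * v' i"
    by (auto simp: fun_eq_iff)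
  obtain j where "v' j \<noteq> 0" using v' by (auto simp: fun_eq_iff)
  with *(2)[of j] have "c = 0" by simp
  with *(1) have "v = 0" by (auto simp: fun_eq_iff)
  with v show False by simp
qed

lemma not_linked_0_v': "\<not> linked 0 v'"
proof
  assume "linked 0 v'"
  then obtain c N where "fun_scale (fact N) v' = fun_scale (c * fact N) v'"
    "0 = fun_scale (c * fact N) v"
    using cut_linked[of 0 v'] by (auto simp: cut_v cut_zero)
  then have *: "\<And>i. fact N * v' i = c * fact N * v' i" "\<And>i. 0 = c * fact N * v i"
    by (auto simp: fun_eq_iff)
  obtain j where "v j \<noteq> 0" using v by (auto simp: fun_eq_iff)
  with *(2)[of j] have "c = 0" by simp
  with *(1) have "v' = 0" by (auto simp: fun_eq_iff)
  with v' show False by simp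
qed

text \<open>
  The kernel \<open>{x. linked x 0}\<close> is a submodule that misses \<open>v\<close>, hence zero, and symmetrically for
  \<open>{y. linked 0 y}\<close>; the domain is a submodule that contains \<open>v\<close>, hence everything.  So the
  relation is an isomorphism, and it takes a weight vector to a weight vector of the same weight.
\<close>

lemma weight_transfer:
  assumes simple: "simple_lie_module L V \<rho>" "simple_lie_module L V' \<rho>'"
    and weight: "is_weight L V \<rho> \<mu>"
  shows "is_weight L V' \<rho>' \<mu>"
proof -
  note sub = simple_lie_moduleD[OF simple(1)] and sub' = simple_lie_moduleD[OF simple(2)]
  have z: "fun_scale c (0 :: 'i \<Rightarrow> 'k) = 0" "fun_scale c (0 :: 'j \<Rightarrow> 'k) = 0" for c
    by (simp_all add: fun_eq_iff)
  have "{x. linked x 0} = {0} \<or> {x. linked x 0} = V"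
  proof (rule sub)
    show "\<And>x y. x \<in> {x. linked x 0} \<Longrightarrow> y \<in> {x. linked x 0} \<Longrightarrow> x + y \<in> {x. linked x 0}"
      using linked_add[where y = 0 and y' = 0] by simp
    show "\<And>c x. x \<in> {x. linked x 0} \<Longrightarrow> fun_scale c x \<in> {x. linked x 0}"
      using linked_scale[where y = 0] z by simp
    show "\<And>X x. X \<in> lie L \<Longrightarrow> x \<in> {x. linked x 0} \<Longrightarrow> \<rho> X x \<in> {x. linked x 0}"
      using act_linked[where y = 0] W.act_zero by simp
  qed (auto simp: linked.zero dest: linked_in)
  then have ker: "linked x 0 \<Longrightarrow> x = 0" for x using not_linked_v_0 v_in by blast
  have "{y. linked 0 y} = {0} \<or> {y. linked 0 y} = V'"
  proof (rule sub')
    show "\<And>x y. x \<in> {x. linked 0 x} \<Longrightarrow> y \<in> {x. linked 0 x} \<Longrightarrow> x + y \<in> {x. linked 0 x}"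
      using linked_add[where x = 0 and x' = 0] by simp
    show "\<And>c x. x \<in> {x. linked 0 x} \<Longrightarrow> fun_scale c x \<in> {x. linked 0 x}"
      using linked_scale[where x = 0] z by simp
    show "\<And>X x. X \<in> lie L \<Longrightarrow> x \<in> {x. linked 0 x} \<Longrightarrow> \<rho>' X x \<in> {x. linked 0 x}"
      using act_linked[where x = 0] act_zero by simp
  qed (auto simp: linked.zero dest: linked_in)
  then have ker': "linked 0 y \<Longrightarrow> y = 0" for y using not_linked_0_v' v'_in by blast
  have "{x. \<exists>y. linked x y} = {0} \<or> {x. \<exists>y. linked x y} = V"
  proof (rule sub)
    show "\<And>x y. x \<in> {x. \<exists>y. linked x y} \<Longrightarrow> y \<in> {x. \<exists>y. linked x y} \<Longrightarrow> x + y \<in> {x. \<exists>y. linked x y}"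
      using linked_add by fast
    show "\<And>c x. x \<in> {x. \<exists>y. linked x y} \<Longrightarrow> fun_scale c x \<in> {x. \<exists>y. linked x y}"
      using linked_scale by fast
    show "\<And>X x. X \<in> lie L \<Longrightarrow> x \<in> {x. \<exists>y. linked x y} \<Longrightarrow> \<rho> X x \<in> {x. \<exists>y. linked x y}"
      using act_linked by fast
    show "0 \<in> {x. \<exists>y. linked x y}" using linked.zero by fast
  qed (auto dest: linked_in)
  then have dom: "{x. \<exists>y. linked x y} = V"
    using lowered_linked[OF lowered.start] v(2) by blast
  from weight obtain x where x: "x \<in> V" "x \<noteq> 0" "\<mu> \<in> extensional (cartan L)"
    "\<And>H. H \<in> cartan L \<Longrightarrow> \<rho> H x = fun_scale (\<mu> H) x"
    by (auto simp: is_weight_def weight_space_def)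
  with dom obtain y where y: "linked x y" by blast
  have "y \<noteq> 0" using y ker x by auto
  moreover have "\<rho>' H y = fun_scale (\<mu> H) y" if H: "H \<in> cartan L" for H
  proof -
    have "linked (fun_scale (- \<mu> H) x + \<rho> H x) (fun_scale (- \<mu> H) y + \<rho>' H y)"
      using y H cartan_lie by (intro linked_add linked_scale act_linked) auto
    moreover have "fun_scale (- \<mu> H) x + \<rho> H x = 0" using x(4)[OF H] by (simp add: fun_eq_iff)
    ultimately have "fun_scale (- \<mu> H) y + \<rho>' H y = 0" using ker' by simp
    then show ?thesis by (simp add: fun_eq_iff add_eq_0_iff)
  qed
  ultimately show ?thesis using x(3) linked_in[OF y]
    by (auto simp: is_weight_def weight_space_def)
qed

end

context graded_lie_algebra
begin

lemma is_weight_transfer: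
  assumes "simple_lie_module L V \<rho>" "is_highest_weight L V \<rho> \<Lambda>"
    and "simple_lie_module L V' \<rho>'" "is_highest_weight L V' \<rho>' \<Lambda>"
    and "is_weight L V \<rho> \<mu>"
  shows "is_weight L V' \<rho>' \<mu>"
proof -
  obtain v v' where v: "v \<in> weight_space L V \<rho> \<Lambda>" "v \<noteq> 0"
      "\<forall>\<alpha>\<in>positive_roots L. \<forall>X\<in>root_space L \<alpha>. \<rho> X v = 0"
    and v': "v' \<in> weight_space L V' \<rho>' \<Lambda>" "v' \<noteq> 0"
      "\<forall>\<alpha>\<in>positive_roots L. \<forall>X\<in>root_space L \<alpha>. \<rho>' X v' = 0"
    using assms unfolding is_highest_weight_def by blast
  interpret highest_weight_pair L H0 V \<rho> V' \<rho>' v v' \<Lambda>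
    by unfold_locales (use assms v v' in \<open>auto simp: simple_lie_module_def\<close>)
  show ?thesis using weight_transfer assms by blast
qed

lemma weight_poset_eq_weights:
  fixes V :: "(nat \<Rightarrow> 'k) set"
  assumes "simple_lie_module L V \<rho>" "is_highest_weight L V \<rho> \<Lambda>"
  shows "weight_poset L \<Lambda> = {\<mu>. is_weight L V \<rho> \<mu>}"
  unfolding weight_poset_def using is_weight_transfer[OF _ _ assms] assms by blast

end

section \<open>Modules with one-dimensional weight spaces\<close>

definition supported_on :: "'i set \<Rightarrow> ('i \<Rightarrow> 'k::field) set" where
  "supported_on B = {f. \<forall>s. s \<notin> B \<longrightarrow> f s = 0}"

definition basis_vec :: "'i \<Rightarrow> 'i \<Rightarrow> 'k::field" where
  "basis_vec s = (\<lambda>t. if t = s then 1 else 0)"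

text \<open>
  A module with a basis of weight vectors of pairwise different weights.  The function \<open>ht\<close>
  measures how far a state is from the highest state \<open>s0\<close>: from any other state an element of
  degree \<open>1\<close> leads to a state closer to \<open>s0\<close>, and some element of the Lie algebra leads back.
\<close>

locale weight_basis = weight_module L H0 "supported_on B" \<rho>
  for L :: "'k::field_char_0 based_lie_algebra" and H0 and B :: "'i set" and \<rho> +
  fixes wt :: "'i \<Rightarrow> 'k mat \<Rightarrow> 'k" and s0 :: 'i and ht :: "'i \<Rightarrow> nat"
  assumes finite_B: "finite B" and s0: "s0 \<in> B"
    and cartan_act: "H \<in> cartan L \<Longrightarrow> f \<in> supported_on B \<Longrightarrow> s \<in> B \<Longrightarrow> \<rho> H f s = wt s H * f s"
    and wt_distinct: "s \<in> B \<Longrightarrow> t \<in> B \<Longrightarrow> s \<noteq> t \<Longrightarrow> \<exists>H\<in>cartan L. wt s H \<noteq> wt t H"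
    and raise: "s \<in> B \<Longrightarrow> s \<noteq> s0 \<Longrightarrow> \<exists>s'\<in>B. ht s' < ht s \<and>
      (\<exists>X\<in>lie L. lie_bracket H0 X = 1 \<cdot>\<^sub>m X \<and> (\<exists>c. c \<noteq> 0 \<and> \<rho> X (basis_vec s) = fun_scale c (basis_vec s'))) \<and>
      (\<exists>Y\<in>lie L. \<exists>c. c \<noteq> 0 \<and> \<rho> Y (basis_vec s') = fun_scale c (basis_vec s))"
begin

lemma basis_vec_in: "s \<in> B \<Longrightarrow> basis_vec s \<in> supported_on B"
  by (auto simp: basis_vec_def supported_on_def)

lemma basis_vec_nonzero: "basis_vec s \<noteq> (0 :: 'i \<Rightarrow> 'k)"
  by (auto simp: basis_vec_def fun_eq_iff)

lemma cartan_basis_vec: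
  assumes "H \<in> cartan L" "s \<in> B"
  shows "\<rho> H (basis_vec s) = fun_scale (wt s H) (basis_vec s)"
proof
  fix t
  have "\<rho> H (basis_vec s) \<in> supported_on B"
    using assms cartan_lie act_in basis_vec_in by blast
  then show "\<rho> H (basis_vec s) t = wt s H * basis_vec s t"
    using cartan_act[OF assms(1) basis_vec_in[OF assms(2)], of t] assms
    by (cases "t \<in> B") (auto simp: basis_vec_def supported_on_def)
qed

lemma supported_on_eqI:
  "f \<in> supported_on B \<Longrightarrow> g \<in> supported_on B \<Longrightarrow> (\<And>s. s \<in> B \<Longrightarrow> f s = g s) \<Longrightarrow> f = g"
  unfolding supported_on_def by (rule ext) (metis (mono_tags, lifting) mem_Collect_eq)

lemma weight_of_nonzero_coordinate:
  assumes "f \<in> weight_space L (supported_on B) \<rho> \<mu>" "f s \<noteq> 0" "H \<in> cartan L"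
  shows "s \<in> B \<and> \<mu> H = wt s H"
proof -
  have f: "f \<in> supported_on B" "\<rho> H f = fun_scale (\<mu> H) f"
    using assms by (auto simp: weight_space_def)
  then have "s \<in> B" using assms by (auto simp: supported_on_def)
  moreover have "wt s H * f s = \<mu> H * f s"
    using cartan_act[OF assms(3) f(1) \<open>s \<in> B\<close>] unfolding f(2) by (rule sym)
  ultimately show ?thesis using mult_right_cancel[OF assms(2)] by metis
qed

lemma is_weight_iff:
  "is_weight L (supported_on B) \<rho> \<mu> \<longleftrightarrow> (\<exists>s\<in>B. \<mu> = (\<lambda>H\<in>cartan L. wt s H))"
proof
  assume "is_weight L (supported_on B) \<rho> \<mu>"
  then obtain f where f: "\<mu> \<in> extensional (cartan L)" "f \<in> weight_space L (supported_on B) \<rho> \<mu>" "f \<noteq> 0"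
    by (auto simp: is_weight_def)
  then obtain s where s: "f s \<noteq> 0" by (auto simp: fun_eq_iff)
  have "s \<in> B" "\<mu> = (\<lambda>H\<in>cartan L. wt s H)"
    using weight_of_nonzero_coordinate[OF f(2) s] f(1) H0 by (auto simp: extensional_def fun_eq_iff)
  then show "\<exists>s\<in>B. \<mu> = (\<lambda>H\<in>cartan L. wt s H)" by blast
next
  assume "\<exists>s\<in>B. \<mu> = (\<lambda>H\<in>cartan L. wt s H)"
  then obtain s where s: "s \<in> B" "\<mu> = (\<lambda>H\<in>cartan L. wt s H)" by blast
  then have "basis_vec s \<in> weight_space L (supported_on B) \<rho> \<mu>"
    by (simp add: weight_space_def basis_vec_in cartan_basis_vec)
  then show "is_weight L (supported_on B) \<rho> \<mu>"
    using s basis_vec_nonzero by (auto simp: is_weight_def)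
qed

text \<open>
  Each step towards \<open>s0\<close> raises the eigenvalue of \<open>H0\<close> by \<open>1\<close>.
\<close>

lemma wt_H0_le:
  assumes "s \<in> B"
  shows "\<exists>j. wt s H0 + of_nat j = wt s0 H0"
  using assms
proof (induction "ht s" arbitrary: s rule: less_induct)
  case less
  show ?case
  proof (cases "s = s0")
    case True
    then show ?thesis by (intro exI[of _ 0]) simp
  next
    case False
    with raise less.prems obtain s' X c where s': "s' \<in> B" "ht s' < ht s" "X \<in> lie L"
      "lie_bracket H0 X = 1 \<cdot>\<^sub>m X" "c \<noteq> 0" "\<rho> X (basis_vec s) = fun_scale c (basis_vec s')"
      by metis
    have "\<rho> H0 (\<rho> X (basis_vec s)) = fun_scale (wt s H0 + 1) (\<rho> X (basis_vec s))"
      using s' less.prems by (intro act_eigenvector) (auto simp: basis_vec_in cartan_basis_vec H0)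
    moreover have "\<rho> H0 (\<rho> X (basis_vec s)) = fun_scale c (fun_scale (wt s' H0) (basis_vec s'))"
      unfolding s'(6) act_scale[OF H0_lie basis_vec_in[OF s'(1)]] cartan_basis_vec[OF H0 s'(1)] ..
    ultimately have "fun_scale c (fun_scale (wt s' H0) (basis_vec s')) s' = fun_scale (wt s H0 + 1) (fun_scale c (basis_vec s')) s'"
      using s'(6) by metis
    then have "wt s' H0 = wt s H0 + 1" using s'(5) by (simp add: basis_vec_def)
    moreover obtain j where "wt s' H0 + of_nat j = wt s0 H0" using less s' by blast
    ultimately show ?thesis by (intro exI[of _ "Suc j"]) (simp add: algebra_simps)
  qed
qed

text \<open>
  A positive root vector would carry the highest basis vector into an eigenspace of \<open>H0\<close> whose
  eigenvalue exceeds that of \<open>s0\<close> by a positive integer, and \<open>wt_H0_le\<close> excludes such an eigenvalue.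
\<close>

lemma is_highest_weight_s0:
  "is_highest_weight L (supported_on B) \<rho> (\<lambda>H\<in>cartan L. wt s0 H)"
proof -
  have "\<rho> X (basis_vec s0) = 0" if \<alpha>: "\<alpha> \<in> positive_roots L" and X: "X \<in> root_space L \<alpha>" for \<alpha> X
  proof (rule ccontr)
    assume "\<rho> X (basis_vec s0) \<noteq> 0"
    then obtain s where s: "\<rho> X (basis_vec s0) s \<noteq> 0" by (auto simp: fun_eq_iff)
    obtain k where k: "0 < k" "\<alpha> H0 = of_nat k" using positive_root_H0 \<alpha> by blast
    have X': "X \<in> lie L" "lie_bracket H0 X = of_nat k \<cdot>\<^sub>m X"
      using X k H0 by (auto simp: root_space_def)
    let ?f = "\<rho> X (basis_vec s0)"
    have f: "?f \<in> supported_on B" using X' s0 by (simp add: act_in basis_vec_in)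
    have "s \<in> B" using f s by (auto simp: supported_on_def)
    have "\<rho> H0 ?f = fun_scale (wt s0 H0 + of_nat k) ?f"
      using X' s0 by (intro act_eigenvector) (auto simp: basis_vec_in cartan_basis_vec H0)
    then have "wt s H0 = wt s0 H0 + of_nat k"
      using cartan_act[OF H0 f \<open>s \<in> B\<close>] s by simp
    with wt_H0_le[OF \<open>s \<in> B\<close>] obtain j where "wt s0 H0 + of_nat k + of_nat j = wt s0 H0" by auto
    then have "of_nat (k + j) = (0 :: 'k)" by (simp add: add.assoc)
    then show False using k by (simp only: of_nat_eq_0_iff)
  qed
  moreover have "basis_vec s0 \<in> weight_space L (supported_on B) \<rho> (\<lambda>H\<in>cartan L. wt s0 H)"
    by (simp add: weight_space_def basis_vec_in cartan_basis_vec s0)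
  ultimately show ?thesis using basis_vec_nonzero by (auto simp: is_highest_weight_def)
qed

text \<open>
  Take a vector with the fewest nonzero coordinates.  If it had two, a Cartan element that
  separates their weights would produce a nonzero vector with fewer of them.
\<close>

lemma submodule_contains_basis_vec:
  assumes add: "\<And>x y. x \<in> K \<Longrightarrow> y \<in> K \<Longrightarrow> x + y \<in> K"
    and scale: "\<And>c x. x \<in> K \<Longrightarrow> fun_scale c x \<in> K"
    and act: "\<And>X x. X \<in> lie L \<Longrightarrow> x \<in> K \<Longrightarrow> \<rho> X x \<in> K"
    and K: "K \<subseteq> supported_on B"
    and "f \<in> K" "f \<noteq> 0"
  shows "\<exists>s\<in>B. basis_vec s \<in> K"
  using assms(5,6)
proof (induction "card {s\<in>B. f s \<noteq> 0}" arbitrary: f rule: less_induct)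
  case less
  obtain s where s: "f s \<noteq> 0" using less.prems by (auto simp: fun_eq_iff)
  have f: "f \<in> supported_on B" using less.prems K by blast
  with s have "s \<in> B" by (auto simp: supported_on_def)
  show ?case
  proof (cases "\<exists>t\<in>B. t \<noteq> s \<and> f t \<noteq> 0")
    case False
    have "fun_scale (1 / f s) f = basis_vec s"
    proof (rule supported_on_eqI)
      show "fun_scale (1 / f s) f \<in> supported_on B" using f by (rule scale_in)
      show "basis_vec s \<in> supported_on B" using \<open>s \<in> B\<close> by (rule basis_vec_in)
    qed (use False s in \<open>auto simp: basis_vec_def\<close>)
    then show ?thesis using scale[OF less.prems(1), of "1 / f s"] \<open>s \<in> B\<close> by auto
  next
    case True
    then obtain t where t: "t \<in> B" "t \<noteq> s" "f t \<noteq> 0" by blast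
    then obtain H where H: "H \<in> cartan L" "wt s H \<noteq> wt t H" using wt_distinct \<open>s \<in> B\<close> by metis
    define g where "g = \<rho> H f + fun_scale (- wt t H) f"
    have g: "g u = (wt u H - wt t H) * f u" if "u \<in> B" for u
      using cartan_act[OF H(1) f that] by (simp add: g_def algebra_simps)
    have "g \<in> K" unfolding g_def using H cartan_lie less.prems by (intro add scale act) auto
    moreover have "g s \<noteq> 0" using g[OF \<open>s \<in> B\<close>] H s by simp
    then have "g \<noteq> 0" by auto
    moreover have "{u\<in>B. g u \<noteq> 0} \<subset> {u\<in>B. f u \<noteq> 0}"
    proof (rule psubsetI)
      show "{u\<in>B. g u \<noteq> 0} \<subseteq> {u\<in>B. f u \<noteq> 0}" using g by auto
      have "g t = 0" using g t by simp
      then show "{u\<in>B. g u \<noteq> 0} \<noteq> {u\<in>B. f u \<noteq> 0}" using t by blast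
    qed
    then have "card {u\<in>B. g u \<noteq> 0} < card {u\<in>B. f u \<noteq> 0}"
      using finite_B by (intro psubset_card_mono) auto
    ultimately show ?thesis using less.hyps by blast
  qed
qed

text \<open>
  A nonzero submodule contains some basis vector; moving up it contains that of \<open>s0\<close>, and moving
  down from there it contains all of them.
\<close>

lemma simple_module: "simple_lie_module L (supported_on B) \<rho>"
proof -
  have "K = {0} \<or> K = supported_on B"
    if K: "K \<subseteq> supported_on B" "module.subspace fun_scale K" "\<forall>X\<in>lie L. \<forall>x\<in>K. \<rho> X x \<in> K" for K
  proof (cases "K = {0}")
    case False
    have zero: "0 \<in> K" and add: "\<And>x y. x \<in> K \<Longrightarrow> y \<in> K \<Longrightarrow> x + y \<in> K"
      and scale: "\<And>c x. x \<in> K \<Longrightarrow> fun_scale c x \<in> K"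
      and act: "\<And>X x. X \<in> lie L \<Longrightarrow> x \<in> K \<Longrightarrow> \<rho> X x \<in> K"
      using K unfolding subspace_fun_scale_iff by simp_all
    have unscale: "x \<in> K" if "fun_scale c x \<in> K" "c \<noteq> 0" for c x
      using scale[OF that(1), of "1 / c"] that(2) by simp
    have up: "basis_vec s \<in> K \<Longrightarrow> basis_vec s0 \<in> K" if "s \<in> B" for s
      using that
    proof (induction "ht s" arbitrary: s rule: less_induct)
      case less
      show ?case
      proof (cases "s = s0")
        case False
        with raise less.prems obtain s' X c where s': "s' \<in> B" "ht s' < ht s" "X \<in> lie L"
          "c \<noteq> 0" "\<rho> X (basis_vec s) = fun_scale c (basis_vec s')"
          by metis
        then have "basis_vec s' \<in> K" using act[OF s'(3) less.prems(1)] unscale by simp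
        then show ?thesis using less s' by blast
      qed (use less in simp)
    qed
    have down: "basis_vec s0 \<in> K \<Longrightarrow> basis_vec s \<in> K" if "s \<in> B" for s
      using that
    proof (induction "ht s" arbitrary: s rule: less_induct)
      case less
      show ?case
      proof (cases "s = s0")
        case False
        with raise less.prems obtain s' X c where s': "s' \<in> B" "ht s' < ht s" "X \<in> lie L"
          "c \<noteq> 0" "\<rho> X (basis_vec s') = fun_scale c (basis_vec s)"
          by metis
        then have "basis_vec s' \<in> K" using less by blast
        then show ?thesis using act[OF s'(3)] s' unscale by metis
      qed (use less in simp)
    qed
    obtain f where "f \<in> K" "f \<noteq> 0" using False zero by blast
    then obtain s where "s \<in> B" "basis_vec s \<in> K"
      using submodule_contains_basis_vec[OF add scale act K(1)] by blast
    then have all: "basis_vec t \<in> K" if "t \<in> B" for t using up down that by blast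
    have "f \<in> K" if f: "f \<in> supported_on B" for f
    proof -
      have "(\<Sum>t\<in>A. fun_scale (f t) (basis_vec t)) \<in> K" if "finite A" "A \<subseteq> B" for A
        using that by (induction A rule: finite_induct) (auto intro: zero add scale all)
      then have *: "(\<Sum>t\<in>B. fun_scale (f t) (basis_vec t)) \<in> K" using finite_B by blast
      have ap: "(\<Sum>t\<in>A. fun_scale (f t) (basis_vec t)) u = (\<Sum>t\<in>A. f t * basis_vec t u)"
        if "finite A" for A u
        using that by (induction A rule: finite_induct) auto
      have "(\<Sum>t\<in>B. fun_scale (f t) (basis_vec t)) = f"
      proof (rule supported_on_eqI)
        fix u assume "u \<in> B"
        then show "(\<Sum>t\<in>B. fun_scale (f t) (basis_vec t)) u = f u"
          unfolding ap[OF finite_B] using finite_B by (simp add: basis_vec_def if_distrib sum.delta cong: if_cong)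
      qed (use * K f in auto)
      with * show ?thesis by simp
    qed
    with K show ?thesis by blast
  qed simp
  moreover have "supported_on B \<noteq> {0 :: 'i \<Rightarrow> 'k}"
    using basis_vec_in[OF s0] basis_vec_nonzero by blast
  ultimately show ?thesis using lie_module by (auto simp: simple_lie_module_def)
qed

end

lemma (in weight_basis) inj_weights: "inj_on (\<lambda>s. \<lambda>H\<in>cartan L. wt s H) B"
proof (rule inj_onI, rule ccontr)
  fix s t assume *: "s \<in> B" "t \<in> B" "(\<lambda>H\<in>cartan L. wt s H) = (\<lambda>H\<in>cartan L. wt t H)" "s \<noteq> t"
  then obtain H where "H \<in> cartan L" "wt s H \<noteq> wt t H" using wt_distinct by blast
  with fun_cong[OF *(3), of H] show False by simp
qed

text \<open>
  Distinct states have distinct weights, so edges can be counted as pairs of states.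
\<close>

lemma weight_basis_edges:
  fixes B :: "nat set"
  assumes "weight_basis L H0 B \<rho> wt s0 ht"
  shows "card (hasse_edges L (\<lambda>H\<in>cartan L. wt s0 H)) =
    card {(s, t). s \<in> B \<and> t \<in> B \<and> (\<lambda>H\<in>cartan L. wt s H - wt t H) \<in> simple_roots L}"
proof -
  interpret weight_basis L H0 B \<rho> wt s0 ht by fact
  let ?w = "\<lambda>s. \<lambda>H\<in>cartan L. wt s H"
  have P: "weight_poset L (?w s0) = ?w ` B"
    using weight_poset_eq_weights[OF simple_module is_highest_weight_s0] is_weight_iff by auto
  let ?E = "{(s, t). s \<in> B \<and> t \<in> B \<and> (\<lambda>H\<in>cartan L. wt s H - wt t H) \<in> simple_roots L}"
  have cov: "root_covers L (?w s) (?w t) \<longleftrightarrow> (\<lambda>H\<in>cartan L. wt s H - wt t H) \<in> simple_roots L" for s t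
    by (simp add: root_covers_def cong: restrict_cong)
  have "hasse_edges L (?w s0) = map_prod ?w ?w ` ?E"
    unfolding hasse_edges_def P by (auto simp: cov image_iff)
  moreover have "inj_on (map_prod ?w ?w) ?E"
    by (rule inj_on_subset[OF map_prod_inj_on[OF inj_weights inj_weights]]) auto
  ultimately show ?thesis by (simp add: card_image)
qed


section \<open>The Clifford algebra acting on a Fock space\<close>

text \<open>
  A finite set of natural numbers is encoded as a natural number because the modules in
  \<^const>\<open>weight_poset\<close> consist of functions on \<^typ>\<open>nat\<close>.  Flipping adds the element if it is
  absent and deletes it if it is present.
\<close>

definition flip :: "nat \<Rightarrow> nat \<Rightarrow> nat" where
  "flip i s = set_encode (if i \<in> set_decode s then set_decode s - {i} else insert i (set_decode s))"

lemma set_decode_flip: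
  "set_decode (flip i s) = (if i \<in> set_decode s then set_decode s - {i} else insert i (set_decode s))"
  unfolding flip_def by (simp add: set_encode_inverse)

lemma mem_flip [simp]: "j \<in> set_decode (flip i s) \<longleftrightarrow> (j \<in> set_decode s) \<noteq> (j = i)"
  by (auto simp: set_decode_flip)

lemma state_eqI: "(\<And>j. j \<in> set_decode s \<longleftrightarrow> j \<in> set_decode t) \<Longrightarrow> s = t"
  by (metis set_decode_inverse subsetI subset_antisym)

lemma flip_flip [simp]: "flip i (flip i s) = s"
  by (rule state_eqI) auto

lemma flip_commute: "flip i (flip j s) = flip j (flip i s)"
  by (rule state_eqI) auto

text \<open>
  The Jordan-Wigner sign, which makes operators on different indices anticommute.
\<close>

definition sign_below :: "nat \<Rightarrow> nat \<Rightarrow> 'k::field" where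
  "sign_below i s = (\<Prod>j<i. if j \<in> set_decode s then - 1 else 1)"

lemma sign_below_flip:
  "sign_below i (flip j s) = (if j < i then - sign_below i s else sign_below i s :: 'k::field)"
proof (induction i)
  case (Suc i)
  then show ?case by (auto simp: sign_below_def less_Suc_eq)
qed (simp add: sign_below_def)

lemma sign_below_square [simp]: "sign_below i s * sign_below i s = (1 :: 'k::field)"
  by (induction i) (auto simp: sign_below_def algebra_simps)

lemma sign_below_nonzero [simp]: "sign_below i s \<noteq> (0 :: 'k::field)"
  by (auto simp: sign_below_def)

text \<open>
  The generators of the Clifford algebra are numbered by \<open>p < 2 n\<close>: those with \<open>p < n\<close> create the
  element \<open>p\<close>, those with \<open>n \<le> p\<close> annihilate the element \<open>p - n\<close>.  The element concerned is
  \<open>mode n p\<close>, and \<open>dual n p\<close> is the partner of \<open>p\<close> under the split form.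
\<close>

definition mode :: "nat \<Rightarrow> nat \<Rightarrow> nat" where
  "mode n p = (if p < n then p else p - n)"

definition dual :: "nat \<Rightarrow> nat \<Rightarrow> nat" where
  "dual n p = (if p < n then p + n else p - n)"

lemma dual_less [simp]: "p < 2 * n \<Longrightarrow> dual n p < 2 * n"
  and dual_dual [simp]: "p < 2 * n \<Longrightarrow> dual n (dual n p) = p"
  and dual_neq: "p < 2 * n \<Longrightarrow> dual n p \<noteq> p"
  and dual_eq_iff: "p < 2 * n \<Longrightarrow> q < 2 * n \<Longrightarrow> dual n p = dual n q \<longleftrightarrow> p = q"
  by (auto simp: dual_def split: if_splits)

lemma dual_swap: "p < 2 * n \<Longrightarrow> q < 2 * n \<Longrightarrow> p = dual n q \<longleftrightarrow> q = dual n p"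
  by (auto simp: dual_def split: if_splits)

lemma bij_dual: "bij_betw (dual n) {..<2 * n} {..<2 * n}"
  by (rule bij_betw_byWitness[of _ "dual n"]) auto

lemma sum_dual: "(\<Sum>p<2 * n. g (dual n p)) = (\<Sum>p<2 * n. g p)"
  by (rule sum.reindex_bij_betw[OF bij_dual])

definition clifford_coeff :: "nat \<Rightarrow> nat \<Rightarrow> nat \<Rightarrow> 'k::field" where
  "clifford_coeff n p s =
     (if (mode n p \<in> set_decode s) = (p < n) then sign_below (mode n p) s else 0)"

text \<open>
  In coordinates the operator reads off the state before the creation or annihilation, so the
  coefficient of a creation operator vanishes unless the element is present in the new state.
\<close>

definition clifford :: "nat \<Rightarrow> nat \<Rightarrow> (nat \<Rightarrow> 'k::field) \<Rightarrow> nat \<Rightarrow> 'k" where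
  "clifford n p f s = clifford_coeff n p s * f (flip (mode n p) s)"

text \<open>
  The defining relation of the Clifford algebra of the split form: \<open>\<gamma>\<^sub>p \<gamma>\<^sub>q + \<gamma>\<^sub>q \<gamma>\<^sub>p\<close> is the
  entry \<open>(p, q)\<close> of its Gram matrix.
\<close>

lemma clifford_relation:
  assumes "p < 2 * n" "q < 2 * n"
  shows "clifford n p (clifford n q f) s =
    (if q = dual n p then f s else 0) - clifford n q (clifford n p f) s"
proof (cases "mode n p = mode n q")
  case True
  then have "q = p \<or> q = dual n p"
    using assms by (auto simp: mode_def dual_def split: if_splits)
  then show ?thesis
  proof
    assume "q = p"
    then show ?thesis using dual_neq[OF assms(1)]
      by (auto simp: clifford_def clifford_coeff_def)
  next
    assume q: "q = dual n p"
    then have "(q < n) = (\<not> p < n)" using assms by (auto simp: dual_def)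
    then show ?thesis using q True
      by (simp add: clifford_def clifford_coeff_def sign_below_flip mult.assoc[symmetric])
  qed
next
  case False
  then have "q \<noteq> dual n p" using assms by (auto simp: mode_def dual_def split: if_splits)
  then show ?thesis using False
    by (auto simp: clifford_def clifford_coeff_def sign_below_flip
        flip_commute[of "mode n p" "mode n q"])
qed

lemma clifford_relation_fun:
  assumes "p < 2 * n" "q < 2 * n"
  shows "clifford n p (clifford n q f) =
    (\<lambda>s. (if q = dual n p then f s else 0) - clifford n q (clifford n p f) s)"
  using clifford_relation[OF assms] by blast

lemma clifford_diff_if:
  "clifford n p (\<lambda>s. (if P then f s else 0) - g s) s = (if P then clifford n p f s else 0) - clifford n p g s"
  by (simp add: clifford_def algebra_simps)

text \<open>
  Move \<open>\<gamma>\<^sub>c\<close> and then \<open>\<gamma>\<^sub>d\<close> to the left past \<open>\<gamma>\<^sub>b\<close> and \<open>\<gamma>\<^sub>a\<close>; each of the four exchanges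
  leaves one correction term.
\<close>

lemma clifford_commutator:
  assumes "a < 2 * n" "b < 2 * n" "c < 2 * n" "d < 2 * n"
  shows "clifford n a (clifford n b (clifford n c (clifford n d f))) s
       - clifford n c (clifford n d (clifford n a (clifford n b f))) s =
    (if c = dual n b then clifford n a (clifford n d f) s else 0)
    - (if c = dual n a then clifford n b (clifford n d f) s else 0)
    + (if d = dual n b then clifford n c (clifford n a f) s else 0)
    - (if d = dual n a then clifford n c (clifford n b f) s else 0)"
proof -
  let ?g = "clifford n"
  have "?g a (?g b (?g c (?g d f))) s = (if c = dual n b then ?g a (?g d f) s else 0) - ?g a (?g c (?g b (?g d f))) s"
    by (subst clifford_relation_fun[OF assms(2,3)]) (rule clifford_diff_if)
  moreover have "?g a (?g c (?g b (?g d f))) s = (if c = dual n a then ?g b (?g d f) s else 0) - ?g c (?g a (?g b (?g d f))) s"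
    by (rule clifford_relation[OF assms(1,3)])
  moreover have "?g c (?g a (?g b (?g d f))) s = (if d = dual n b then ?g c (?g a f) s else 0) - ?g c (?g a (?g d (?g b f))) s"
    by (subst clifford_relation_fun[OF assms(2,4)]) (simp add: clifford_def algebra_simps)
  moreover have "?g c (?g a (?g d (?g b f))) s = (if d = dual n a then ?g c (?g b f) s else 0) - ?g c (?g d (?g a (?g b f))) s"
    by (subst clifford_relation_fun[OF assms(1,4)]) (rule clifford_diff_if)
  ultimately show ?thesis by simp
qed

text \<open>
  The spin representation \<open>X \<mapsto> (1/2) \<Sum> X\<^sub>p\<^sub>q \<gamma>\<^sub>p \<gamma>\<^sub>q\<^sub>'\<close>, where \<open>q'\<close> is the dual of
  \<open>q\<close>.  Its argument is a coefficient function, so that it also applies to the image of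
  \<open>sl (n + 1)\<close>, without forming that image as a matrix.
\<close>

definition spin :: "nat \<Rightarrow> (nat \<Rightarrow> nat \<Rightarrow> 'k::field) \<Rightarrow> (nat \<Rightarrow> 'k) \<Rightarrow> nat \<Rightarrow> 'k" where
  "spin n x f s = (1 / 2) * (\<Sum>p<2 * n. \<Sum>q<2 * n. x p q * clifford n p (clifford n (dual n q) f) s)"

text \<open>
  The condition on the entries of a matrix that defines the orthogonal Lie algebra of the split
  form.
\<close>

definition antisymmetric_coeffs :: "nat \<Rightarrow> (nat \<Rightarrow> nat \<Rightarrow> 'k::field) \<Rightarrow> bool" where
  "antisymmetric_coeffs n x \<longleftrightarrow> (\<forall>p<2 * n. \<forall>q<2 * n. x (dual n q) (dual n p) = - x p q)"

lemma clifford2_spin: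
  "clifford n p (clifford n q (spin n y f)) s =
     (1 / 2) * (\<Sum>r<2 * n. \<Sum>t<2 * n. y r t * clifford n p (clifford n q (clifford n r (clifford n (dual n t) f))) s)"
  by (simp add: clifford_def spin_def sum_distrib_left mult_ac)

lemma spin_spin:
  "spin n x (spin n y f) s = (1 / 4) * (\<Sum>p<2 * n. \<Sum>q<2 * n. \<Sum>r<2 * n. \<Sum>t<2 * n.
     x p q * y r t * clifford n p (clifford n (dual n q) (clifford n r (clifford n (dual n t) f))) s)"
  unfolding spin_def[of n x] clifford2_spin by (simp add: sum_distrib_left mult_ac)

lemma sum_pick_outer:
  assumes "a \<in> I" "finite I"
  shows "(\<Sum>r\<in>I. \<Sum>t\<in>J. h r t * (if r = a then g r t else 0)) = (\<Sum>t\<in>J. h a t * g a t :: 'k::field)"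
proof -
  have "(\<Sum>r\<in>I. \<Sum>t\<in>J. h r t * (if r = a then g r t else 0)) = (\<Sum>r\<in>I. if r = a then \<Sum>t\<in>J. h r t * g r t else 0)"
    by (rule sum.cong) auto
  then show ?thesis using assms by simp
qed

lemma sum_pick_inner:
  assumes "a \<in> J" "finite J"
  shows "(\<Sum>r\<in>I. \<Sum>t\<in>J. h r t * (if t = a then g r t else 0)) = (\<Sum>r\<in>I. h r a * g r a :: 'k::field)"
  using assms by (simp add: if_distrib sum.delta cong: if_cong)

text \<open>
  Of the four sums \<open>T1, \<dots>, T4\<close> that arise from \<open>clifford_commutator\<close>, the antisymmetry of \<open>x\<close>
  identifies \<open>T2\<close> with \<open>- T1\<close> and \<open>T3\<close> with \<open>- T4\<close>; what remains is twice the term of \<open>x y\<close>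
  minus twice that of \<open>y x\<close>.
\<close>

lemma spin_commutator:
  fixes x y :: "nat \<Rightarrow> nat \<Rightarrow> 'k::field_char_0"
  assumes x: "antisymmetric_coeffs n x" and y: "antisymmetric_coeffs n y"
  shows "spin n x (spin n y f) s - spin n y (spin n x f) s =
    spin n (\<lambda>p q. \<Sum>r<2 * n. x p r * y r q - y p r * x r q) f s"
proof -
  define G where "G p q = clifford n p (clifford n q f) s" for p q
  let ?I = "{..<2 * n}" and ?d = "dual n"
  define T1 where "T1 = (\<Sum>p\<in>?I. \<Sum>q\<in>?I. \<Sum>t\<in>?I. x p q * y q t * G p (?d t))"
  define T2 where "T2 = (\<Sum>p\<in>?I. \<Sum>q\<in>?I. \<Sum>t\<in>?I. x p q * y (?d p) t * G (?d q) (?d t))"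
  define T3 where "T3 = (\<Sum>p\<in>?I. \<Sum>q\<in>?I. \<Sum>r\<in>?I. x p q * y r (?d q) * G r p)"
  define T4 where "T4 = (\<Sum>p\<in>?I. \<Sum>q\<in>?I. \<Sum>r\<in>?I. x p q * y r p * G r (?d q))"
  have "spin n y (spin n x f) s = (1 / 4) * (\<Sum>p\<in>?I. \<Sum>q\<in>?I. \<Sum>r\<in>?I. \<Sum>t\<in>?I.
     x p q * y r t * clifford n r (clifford n (?d t) (clifford n p (clifford n (?d q) f))) s)"
  proof -
    have "(\<Sum>r\<in>?I. \<Sum>t\<in>?I. \<Sum>p\<in>?I. \<Sum>q\<in>?I. F p q r t) = (\<Sum>p\<in>?I. \<Sum>q\<in>?I. \<Sum>r\<in>?I. \<Sum>t\<in>?I. F p q r t)"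
      for F :: "nat \<Rightarrow> nat \<Rightarrow> nat \<Rightarrow> nat \<Rightarrow> 'k"
    proof -
      have "(\<Sum>r\<in>?I. \<Sum>t\<in>?I. \<Sum>p\<in>?I. \<Sum>q\<in>?I. F p q r t) = (\<Sum>r\<in>?I. \<Sum>p\<in>?I. \<Sum>t\<in>?I. \<Sum>q\<in>?I. F p q r t)"
        by (intro sum.cong refl sum.swap)
      also have "\<dots> = (\<Sum>p\<in>?I. \<Sum>r\<in>?I. \<Sum>t\<in>?I. \<Sum>q\<in>?I. F p q r t)" by (rule sum.swap)
      also have "\<dots> = (\<Sum>p\<in>?I. \<Sum>r\<in>?I. \<Sum>q\<in>?I. \<Sum>t\<in>?I. F p q r t)"
        by (intro sum.cong refl sum.swap)
      also have "\<dots> = (\<Sum>p\<in>?I. \<Sum>q\<in>?I. \<Sum>r\<in>?I. \<Sum>t\<in>?I. F p q r t)"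
        by (intro sum.cong refl sum.swap)
      finally show ?thesis .
    qed
    note swap4 = this
    show ?thesis unfolding spin_spin by (subst swap4) (simp only: mult.commute[of "y _ _" "x _ _"])
  qed
  then have "spin n x (spin n y f) s - spin n y (spin n x f) s =
    (1 / 4) * (\<Sum>p\<in>?I. \<Sum>q\<in>?I. \<Sum>r\<in>?I. \<Sum>t\<in>?I. x p q * y r t *
      (clifford n p (clifford n (?d q) (clifford n r (clifford n (?d t) f))) s
       - clifford n r (clifford n (?d t) (clifford n p (clifford n (?d q) f))) s))"
    by (simp add: spin_spin sum_subtractf right_diff_distrib)
  also have "\<dots> = (1 / 4) * (\<Sum>p\<in>?I. \<Sum>q\<in>?I. \<Sum>r\<in>?I. \<Sum>t\<in>?I. x p q * y r t *
      ((if r = q then G p (?d t) else 0) - (if r = ?d p then G (?d q) (?d t) else 0)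
     + (if t = ?d q then G r p else 0) - (if t = p then G r (?d q) else 0)))"
  proof (intro arg_cong2[where f = times] sum.cong refl)
    fix p q r t assume *: "p \<in> ?I" "q \<in> ?I" "r \<in> ?I" "t \<in> ?I"
    then show "clifford n p (clifford n (?d q) (clifford n r (clifford n (?d t) f))) s
       - clifford n r (clifford n (?d t) (clifford n p (clifford n (?d q) f))) s =
       (if r = q then G p (?d t) else 0) - (if r = ?d p then G (?d q) (?d t) else 0)
     + (if t = ?d q then G r p else 0) - (if t = p then G r (?d q) else 0)"
      using clifford_commutator[of p n "?d q" r "?d t" f s] dual_eq_iff[of t n p]
        dual_swap[of t n q]
      by (auto simp: G_def)
  qed
  also have "\<dots> = (1 / 4) * (T1 - T2 + T3 - T4)"
  proof -
    have "(\<Sum>r\<in>?I. \<Sum>t\<in>?I. x p q * y r t *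
      ((if r = q then G p (?d t) else 0) - (if r = ?d p then G (?d q) (?d t) else 0)
     + (if t = ?d q then G r p else 0) - (if t = p then G r (?d q) else 0)))
      = (\<Sum>t\<in>?I. x p q * y q t * G p (?d t)) - (\<Sum>t\<in>?I. x p q * y (?d p) t * G (?d q) (?d t))
      + (\<Sum>r\<in>?I. x p q * y r (?d q) * G r p) - (\<Sum>r\<in>?I. x p q * y r p * G r (?d q))"
      if "p \<in> ?I" "q \<in> ?I" for p q
    proof -
      have "(\<Sum>r\<in>?I. \<Sum>t\<in>?I. x p q * y r t *
      ((if r = q then G p (?d t) else 0) - (if r = ?d p then G (?d q) (?d t) else 0)
     + (if t = ?d q then G r p else 0) - (if t = p then G r (?d q) else 0)))
      = (\<Sum>r\<in>?I. \<Sum>t\<in>?I. x p q * y r t * (if r = q then G p (?d t) else 0))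
      - (\<Sum>r\<in>?I. \<Sum>t\<in>?I. x p q * y r t * (if r = ?d p then G (?d q) (?d t) else 0))
      + (\<Sum>r\<in>?I. \<Sum>t\<in>?I. x p q * y r t * (if t = ?d q then G r p else 0))
      - (\<Sum>r\<in>?I. \<Sum>t\<in>?I. x p q * y r t * (if t = p then G r (?d q) else 0))"
        by (simp only: right_diff_distrib distrib_left sum.distrib sum_subtractf)
      then show ?thesis using that
        by (simp add: sum_pick_outer sum_pick_inner)
    qed
    then show ?thesis unfolding T1_def T2_def T3_def T4_def
      by (simp add: sum.distrib sum_subtractf)
  qed
  also have "T2 = - T1"
  proof -
    have "T2 = (\<Sum>p\<in>?I. \<Sum>q\<in>?I. \<Sum>t\<in>?I. x (?d p) q * y p t * G (?d q) (?d t))"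
      unfolding T2_def by (subst sum_dual[symmetric]) (rule sum.cong; simp)
    also have "\<dots> = (\<Sum>p\<in>?I. \<Sum>q\<in>?I. \<Sum>t\<in>?I. x (?d p) (?d q) * y p t * G q (?d t))"
      by (rule sum.cong[OF refl], subst sum_dual[symmetric]) (rule sum.cong; simp)
    also have "\<dots> = (\<Sum>p\<in>?I. \<Sum>q\<in>?I. \<Sum>t\<in>?I. - (x q p * y p t * G q (?d t)))"
      using x by (intro sum.cong refl) (simp add: antisymmetric_coeffs_def)
    also have "\<dots> = - (\<Sum>p\<in>?I. \<Sum>q\<in>?I. \<Sum>t\<in>?I. x q p * y p t * G q (?d t))"
      by (simp add: sum_negf)
    also have "\<dots> = - T1" unfolding T1_def by (subst sum.swap) simp
    finally show ?thesis .
  qed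
  also have "T3 = - T4"
  proof -
    have "T3 = (\<Sum>p\<in>?I. \<Sum>q\<in>?I. \<Sum>r\<in>?I. x (?d p) q * y r (?d q) * G r (?d p))"
      unfolding T3_def by (subst sum_dual[symmetric]) (rule sum.cong; simp)
    also have "\<dots> = (\<Sum>p\<in>?I. \<Sum>q\<in>?I. \<Sum>r\<in>?I. x (?d p) (?d q) * y r q * G r (?d p))"
      by (rule sum.cong[OF refl], subst sum_dual[symmetric]) (rule sum.cong; simp)
    also have "\<dots> = (\<Sum>p\<in>?I. \<Sum>q\<in>?I. \<Sum>r\<in>?I. - (x q p * y r q * G r (?d p)))"
      using x by (intro sum.cong refl) (simp add: antisymmetric_coeffs_def)
    also have "\<dots> = - (\<Sum>p\<in>?I. \<Sum>q\<in>?I. \<Sum>r\<in>?I. x q p * y r q * G r (?d p))"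
      by (simp add: sum_negf)
    also have "\<dots> = - T4" unfolding T4_def by (subst sum.swap) simp
    finally show ?thesis .
  qed
  also have "(1 / 4) * (T1 - - T1 + - T4 - T4) = (1 / 2) * (T1 - T4)" by simp
  also have "T1 = (\<Sum>p\<in>?I. \<Sum>t\<in>?I. (\<Sum>q\<in>?I. x p q * y q t) * G p (?d t))"
    unfolding T1_def sum_distrib_right by (intro sum.cong refl sum.swap)
  also have "T4 = (\<Sum>p\<in>?I. \<Sum>t\<in>?I. (\<Sum>q\<in>?I. y p q * x q t) * G p (?d t))"
  proof -
    have "T4 = (\<Sum>p\<in>?I. \<Sum>r\<in>?I. \<Sum>q\<in>?I. x p q * y r p * G r (?d q))"
      unfolding T4_def by (intro sum.cong refl sum.swap)
    also have "\<dots> = (\<Sum>r\<in>?I. \<Sum>p\<in>?I. \<Sum>q\<in>?I. x p q * y r p * G r (?d q))" by (rule sum.swap)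
    also have "\<dots> = (\<Sum>r\<in>?I. \<Sum>q\<in>?I. \<Sum>p\<in>?I. x p q * y r p * G r (?d q))"
      by (intro sum.cong refl sum.swap)
    also have "\<dots> = (\<Sum>r\<in>?I. \<Sum>q\<in>?I. \<Sum>p\<in>?I. y r p * x p q * G r (?d q))"
      by (simp only: mult.commute[of "y _ _" "x _ _"])
    finally show ?thesis unfolding sum_distrib_right .
  qed
  finally show ?thesis
    unfolding spin_def[of n "\<lambda>p q. \<Sum>r<2 * n. x p r * y r q - y p r * x r q"] G_def
    by (simp only: sum_subtractf left_diff_distrib)
qed

lemma spin_cong:
  "(\<And>p q. p < 2 * n \<Longrightarrow> q < 2 * n \<Longrightarrow> x p q = y p q) \<Longrightarrow> spin n x f s = spin n y f s"
  by (simp add: spin_def)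

lemma spin_add_vector: "spin n x (f + g) = spin n x f + spin n x g"
  by (rule ext) (simp add: spin_def clifford_def algebra_simps sum.distrib)

lemma spin_scale_vector: "spin n x (\<lambda>s. c * f s) = (\<lambda>s. c * spin n x f s)"
  by (rule ext) (simp add: spin_def clifford_def sum_distrib_left mult_ac)

lemma spin_add: "spin n (\<lambda>p q. x p q + y p q) f = spin n x f + spin n y f"
  by (rule ext) (simp add: spin_def algebra_simps sum.distrib)

lemma spin_scale: "spin n (\<lambda>p q. c * x p q) f = (\<lambda>s. c * spin n x f s)"
  by (rule ext) (simp add: spin_def sum_distrib_left mult_ac)

lemma clifford_dual:
  "p < 2 * n \<Longrightarrow> clifford n p (clifford n (dual n p) f) s =
     (if (mode n p \<in> set_decode s) = (p < n) then f s else 0)"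
proof -
  assume p: "p < 2 * n"
  then have "mode n (dual n p) = mode n p" "(dual n p < n) = (\<not> p < n)"
    by (auto simp: mode_def dual_def)
  then show ?thesis
    by (simp add: clifford_def clifford_coeff_def sign_below_flip mult.assoc[symmetric])
qed

lemma sum_two_halves:
  fixes n :: nat
  shows "(\<Sum>p<2 * n. g p) = (\<Sum>i<n. g i + g (i + n) :: 'k::field)"
proof -
  have "(\<Sum>p<2 * n. g p) = (\<Sum>p<n. g p) + (\<Sum>p\<in>{n..<n + n}. g p)"
    by (subst sum.union_disjoint[symmetric]) (auto intro!: sum.cong)
  also have "(\<Sum>p\<in>{n..<n + n}. g p) = (\<Sum>i<n. g (i + n))"
    using sum.shift_bounds_nat_ivl[of g 0 n n] by (simp add: atLeast0LessThan)
  finally show ?thesis by (simp add: sum.distrib)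
qed

definition spin_weight :: "nat \<Rightarrow> nat \<Rightarrow> (nat \<Rightarrow> 'k::field) \<Rightarrow> 'k" where
  "spin_weight n s h = (\<Sum>i<n. (if i \<in> set_decode s then 1 / 2 else - (1 / 2)) * h i)"

text \<open>
  The product \<open>\<gamma>\<^sub>p \<gamma>\<^sub>p\<^sub>'\<close> is the projection to the states that contain \<open>p\<close> or, for an annihilator,
  do not contain its element.  The contributions of \<open>i\<close> and \<open>i + n\<close> have opposite signs, which gives
  the weights \<open>\<plusminus> 1/2\<close> in each coordinate.
\<close>

lemma spin_diagonal:
  fixes x :: "nat \<Rightarrow> nat \<Rightarrow> 'k::field_char_0"
  assumes x: "antisymmetric_coeffs n x"
    and diag: "\<And>p q. p < 2 * n \<Longrightarrow> q < 2 * n \<Longrightarrow> p \<noteq> q \<Longrightarrow> x p q = 0"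
  shows "spin n x f s = spin_weight n s (\<lambda>i. x i i) * f s"
proof -
  have "(\<Sum>p<2 * n. \<Sum>q<2 * n. x p q * clifford n p (clifford n (dual n q) f) s) =
    (\<Sum>p<2 * n. x p p * clifford n p (clifford n (dual n p) f) s)"
  proof (rule sum.cong[OF refl])
    fix p assume p: "p \<in> {..<2 * n}"
    have "(\<Sum>q<2 * n. x p q * clifford n p (clifford n (dual n q) f) s) =
      (\<Sum>q<2 * n. if q = p then x p p * clifford n p (clifford n (dual n p) f) s else 0)"
      using p diag by (intro sum.cong) auto
    then show "(\<Sum>q<2 * n. x p q * clifford n p (clifford n (dual n q) f) s) =
        x p p * clifford n p (clifford n (dual n p) f) s" using p by simp
  qed
  also have "\<dots> = (\<Sum>i<n. (if i \<in> set_decode s then x i i else - x i i) * f s)"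
  proof (subst sum_two_halves, rule sum.cong[OF refl])
    fix i assume "i \<in> {..<n}"
    then have i: "i < n" "i < 2 * n" "i + n < 2 * n" by auto
    then have "x (i + n) (i + n) = - x i i"
      using x unfolding antisymmetric_coeffs_def by (metis dual_def)
    then show "x i i * clifford n i (clifford n (dual n i) f) s
      + x (i + n) (i + n) * clifford n (i + n) (clifford n (dual n (i + n)) f) s =
      (if i \<in> set_decode s then x i i else - x i i) * f s"
      unfolding clifford_dual[OF i(2)] clifford_dual[OF i(3)] using i by (simp add: mode_def)
  qed
  finally show ?thesis
    unfolding spin_def spin_weight_def
    by (auto simp: sum_distrib_left sum_distrib_right intro!: sum.cong)
qed

text \<open>
  The entries of the matrix unit at \<open>(p, q)\<close>, antisymmetrised with respect to the split form.
\<close>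

definition root_coeffs :: "nat \<Rightarrow> nat \<Rightarrow> nat \<Rightarrow> nat \<Rightarrow> nat \<Rightarrow> 'k::field" where
  "root_coeffs n p q a b =
     (if a = p \<and> b = q then 1 else 0) - (if a = dual n q \<and> b = dual n p then 1 else 0)"

lemma sum_pick2:
  fixes a b N :: nat
  assumes "a < N" "b < N"
  shows "(\<Sum>p<N. \<Sum>q<N. (if p = a \<and> q = b then 1 else 0) * g p q) = (g a b :: 'k::field)"
proof -
  have inner: "(\<Sum>q<N. (if p = a \<and> q = b then 1 else 0) * g p q) = (if p = a then g a b else 0)" for p
  proof (cases "p = a")
    case True
    then have "(\<Sum>q<N. (if p = a \<and> q = b then 1 else 0) * g p q) = (\<Sum>q<N. if q = b then g a b else 0)"
      by (intro sum.cong) auto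
    also have "\<dots> = g a b" using assms by (subst sum.delta) auto
    finally show ?thesis using True by simp
  qed simp
  show ?thesis unfolding inner using assms by (subst sum.delta) auto
qed

text \<open>
  The two entries of the root vector contribute equally because the two generators anticommute; this
  cancels the factor \<open>1/2\<close>.
\<close>

lemma spin_root:
  fixes f :: "nat \<Rightarrow> 'k::field_char_0"
  assumes p: "p < 2 * n" and q: "q < 2 * n" and "p \<noteq> q" "q \<noteq> dual n p"
  shows "spin n (root_coeffs n p q) f s = clifford n p (clifford n (dual n q) f) s"
proof -
  have "spin n (root_coeffs n p q) f s = (1 / 2) * (clifford n p (clifford n (dual n q) f) s
      - clifford n (dual n q) (clifford n (dual n (dual n p)) f) s)"
    unfolding spin_def root_coeffs_def left_diff_distrib sum_subtractf
    using p q by (simp only: sum_pick2 dual_less)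
  also have "clifford n (dual n q) (clifford n (dual n (dual n p)) f) s = - clifford n p (clifford n (dual n q) f) s"
    using clifford_relation[of "dual n q" n p f s] assms by simp
  finally show ?thesis by simp
qed

lemma clifford_pair_basis:
  fixes s s' n p q
  defines "s' \<equiv> flip (mode n p) (flip (mode n q) s)"
  shows "clifford n p (clifford n q (\<lambda>t. if t = s then 1 else 0)) =
    (\<lambda>u. clifford_coeff n p s' * clifford_coeff n q (flip (mode n q) s) * (if u = s' then 1 else 0 :: 'k::field))"
proof
  fix u
  have "flip (mode n q) (flip (mode n p) u) = s \<longleftrightarrow> u = s'"
    by (metis flip_flip s'_def)
  then show "clifford n p (clifford n q (\<lambda>t. if t = s then 1 else 0)) u =
     clifford_coeff n p s' * clifford_coeff n q (flip (mode n q) s) * (if u = s' then 1 else 0 :: 'k)"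
    by (auto simp: clifford_def s'_def)
qed


section \<open>Matrix entries, root vectors and gradings\<close>

lemma mult_mat_entry:
  assumes "A \<in> carrier_mat N N" "B \<in> carrier_mat N N" "i < N" "j < N"
  shows "(A * B) $$ (i, j) = (\<Sum>k<N. A $$ (i, k) * B $$ (k, j) :: 'k::comm_ring_1)"
  using assms by (auto simp: scalar_prod_def atLeast0LessThan intro!: sum.cong)

lemma lie_bracket_carrier:
  "X \<in> carrier_mat N N \<Longrightarrow> Y \<in> carrier_mat N N \<Longrightarrow> lie_bracket X Y \<in> carrier_mat N N"
  by (auto simp: lie_bracket_def)

lemma lie_bracket_entry:
  assumes "X \<in> carrier_mat N N" "Y \<in> carrier_mat N N" "i < N" "j < N"
  shows "lie_bracket X Y $$ (i, j) = (\<Sum>k<N. X $$ (i, k) * Y $$ (k, j) - Y $$ (i, k) * X $$ (k, j) :: 'k::comm_ring_1)"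
proof -
  have "lie_bracket X Y $$ (i, j) = (X * Y) $$ (i, j) - (Y * X) $$ (i, j)"
    using assms unfolding lie_bracket_def by (subst index_minus_mat) auto
  then show ?thesis using assms by (simp add: mult_mat_entry sum_subtractf del: index_mult_mat)
qed

lemma lie_bracket_diagonal_entry:
  assumes "H \<in> carrier_mat N N" "diagonal_mat H" "X \<in> carrier_mat N N" "i < N" "j < N"
  shows "lie_bracket H X $$ (i, j) = (H $$ (i, i) - H $$ (j, j)) * (X $$ (i, j) :: 'k::comm_ring_1)"
proof -
  have d: "H $$ (a, b) = 0" if "a < N" "b < N" "a \<noteq> b" for a b
    using assms that by (auto simp: diagonal_mat_def)
  have "(\<Sum>k<N. H $$ (i, k) * X $$ (k, j)) = (\<Sum>k<N. if k = i then H $$ (i, i) * X $$ (i, j) else 0)"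
    using assms d[of i] by (intro sum.cong) auto
  moreover have "(\<Sum>k<N. X $$ (i, k) * H $$ (k, j)) = (\<Sum>k<N. if k = j then X $$ (i, j) * H $$ (j, j) else 0)"
    using assms d[of _ j] by (intro sum.cong) auto
  ultimately show ?thesis using assms
    by (simp add: lie_bracket_entry sum_subtractf algebra_simps)
qed

definition in_root_cone :: "'k::field based_lie_algebra \<Rightarrow> ('k mat \<Rightarrow> 'k) \<Rightarrow> bool" where
  "in_root_cone L \<alpha> \<longleftrightarrow> (\<exists>c :: ('k mat \<Rightarrow> 'k) \<Rightarrow> nat. \<forall>H\<in>cartan L. \<alpha> H = (\<Sum>\<beta>\<in>simple_roots L. of_nat (c \<beta>) * \<beta> H))"

lemma in_root_cone_simple:
  assumes "finite (simple_roots L)" "\<beta> \<in> simple_roots L" "\<And>H. H \<in> cartan L \<Longrightarrow> \<alpha> H = \<beta> H"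
  shows "in_root_cone L \<alpha>"
  unfolding in_root_cone_def
proof (intro exI ballI)
  fix H assume "H \<in> cartan L"
  have "(\<Sum>\<gamma>\<in>simple_roots L. of_nat (of_bool (\<gamma> = \<beta>)) * \<gamma> H) = (\<Sum>\<gamma>\<in>simple_roots L. if \<gamma> = \<beta> then \<beta> H else 0)"
    by (intro sum.cong) auto
  also have "\<dots> = \<beta> H" using assms by simp
  finally show "\<alpha> H = (\<Sum>\<gamma>\<in>simple_roots L. of_nat (of_bool (\<gamma> = \<beta>)) * \<gamma> H)"
    using assms(3)[OF \<open>H \<in> cartan L\<close>] by simp
qed

lemma in_root_cone_add:
  assumes "in_root_cone L \<alpha>" "in_root_cone L \<beta>" "\<And>H. H \<in> cartan L \<Longrightarrow> \<gamma> H = \<alpha> H + \<beta> H"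
  shows "in_root_cone L \<gamma>"
proof -
  obtain c d :: "('a mat \<Rightarrow> 'a) \<Rightarrow> nat" where
    "\<forall>H\<in>cartan L. \<alpha> H = (\<Sum>\<beta>\<in>simple_roots L. of_nat (c \<beta>) * \<beta> H)"
    "\<forall>H\<in>cartan L. \<beta> H = (\<Sum>\<beta>\<in>simple_roots L. of_nat (d \<beta>) * \<beta> H)"
    using assms(1,2) unfolding in_root_cone_def by blast
  then show ?thesis unfolding in_root_cone_def
    by (intro exI[of _ "\<lambda>\<beta>. c \<beta> + d \<beta>"]) (simp add: assms(3) sum.distrib distrib_right)
qed

lemma in_root_cone_chain:
  assumes "finite (simple_roots L)" "i < j"
    and "\<And>k. i \<le> k \<Longrightarrow> k < j \<Longrightarrow> (\<lambda>H\<in>cartan L. H $$ (k, k) - H $$ (k + 1, k + 1)) \<in> simple_roots L"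
  shows "in_root_cone L (\<lambda>H. H $$ (i, i) - H $$ (j, j))"
  using assms(2,3)
proof (induction j)
  case (Suc j)
  have last: "in_root_cone L (\<lambda>H. H $$ (j, j) - H $$ (Suc j, Suc j))"
    using Suc.prems by (intro in_root_cone_simple[OF assms(1) Suc.prems(2)[of j]]) auto
  show ?case
  proof (cases "i = j")
    case False
    then have "in_root_cone L (\<lambda>H. H $$ (i, i) - H $$ (j, j))" using Suc by auto
    then show ?thesis using last by (rule in_root_cone_add) simp
  qed (use last in simp)
qed simp

text \<open>
  An eigenvector of the Cartan subalgebra whose eigenvalue functional is a nonnegative integral
  combination of simple roots lies in a positive root space.
\<close>

lemma positive_root_vector:
  assumes "H0 \<in> cartan L" "R \<in> lie L" "R \<noteq> 0\<^sub>m (dim_row R) (dim_col R)"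
    and "\<And>H. H \<in> cartan L \<Longrightarrow> lie_bracket H R = \<alpha> H \<cdot>\<^sub>m R"
    and "\<alpha> H0 \<noteq> 0" "in_root_cone L \<alpha>"
  shows "(\<lambda>H\<in>cartan L. \<alpha> H) \<in> positive_roots L" "R \<in> root_space L (\<lambda>H\<in>cartan L. \<alpha> H)"
proof -
  let ?\<alpha> = "\<lambda>H\<in>cartan L. \<alpha> H"
  show R: "R \<in> root_space L ?\<alpha>" using assms by (simp add: root_space_def)
  have "?\<alpha> \<in> roots L"
    unfolding roots_def
  proof (intro CollectI conjI)
    show "\<exists>H\<in>cartan L. ?\<alpha> H \<noteq> 0" using assms(1,5) by (intro bexI[of _ H0]) auto
    show "\<exists>X\<in>root_space L ?\<alpha>. X \<noteq> 0\<^sub>m (dim_row X) (dim_col X)"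
      using R assms(3) by blast
  qed simp
  moreover have "\<exists>c :: ('a mat \<Rightarrow> 'a) \<Rightarrow> nat. \<forall>H\<in>cartan L. ?\<alpha> H = (\<Sum>\<beta>\<in>simple_roots L. of_nat (c \<beta>) * \<beta> H)"
    using assms(6) unfolding in_root_cone_def by simp
  ultimately show "?\<alpha> \<in> positive_roots L" unfolding positive_roots_def by blast
qed

text \<open>
  The sign of the integer by which \<open>H0\<close> acts decides whether a root vector is lowering or belongs to
  a positive root.
\<close>

lemma root_vector_triangular:
  fixes L :: "'k::field_char_0 based_lie_algebra" and k :: int
  assumes "H0 \<in> cartan L" "R \<in> lie L" "R \<noteq> 0\<^sub>m (dim_row R) (dim_col R)"
    and R: "\<And>H. H \<in> cartan L \<Longrightarrow> lie_bracket H R = \<alpha> H \<cdot>\<^sub>m R"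
    and k: "\<alpha> H0 = of_int k" "k \<noteq> 0" "0 < k \<Longrightarrow> in_root_cone L \<alpha>"
  shows "R \<in> triangular_span L H0"
proof (cases "0 < k")
  case True
  have "\<alpha> H0 \<noteq> 0" using k by simp
  from triangular_span.raise[OF positive_root_vector[OF assms(1-4) this k(3)[OF True]]]
  show ?thesis by simp
next
  case False
  have "(of_int k :: 'k) = - of_nat (nat (- k))" using False by simp
  then show ?thesis using assms False
    by (intro triangular_span.lower[of _ _ "nat (- k)"]) auto
qed

definition off_diagonal_support :: "'k::zero mat \<Rightarrow> (nat \<times> nat) set" where
  "off_diagonal_support X = {(i, j). i < dim_row X \<and> j < dim_col X \<and> i \<noteq> j \<and> X $$ (i, j) \<noteq> 0}"

text \<open>
  Subtracting root vectors one by one clears the entries off the diagonal; a diagonal matrix in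
  the Lie algebra belongs to the Cartan subalgebra.
\<close>

lemma triangular_by_elimination:
  assumes cartan: "cartan L = {H \<in> lie L. diagonal_mat H}"
    and step: "\<And>X p q. X \<in> lie L \<Longrightarrow> (p, q) \<in> off_diagonal_support X \<Longrightarrow>
      \<exists>R X'. R \<in> lie L \<and> R \<in> triangular_span L H0 \<and> X' \<in> lie L \<and> X = R + X' \<and>
        off_diagonal_support X' \<subseteq> off_diagonal_support X - {(p, q)}"
  shows "lie L \<subseteq> triangular_span L H0"
proof
  fix X assume "X \<in> lie L"
  then show "X \<in> triangular_span L H0"
  proof (induction "card (off_diagonal_support X)" arbitrary: X rule: less_induct)
    case less
    show ?case
    proof (cases "off_diagonal_support X = {}")
      case True
      then have "diagonal_mat X" by (auto simp: off_diagonal_support_def diagonal_mat_def)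
      then show ?thesis using less.prems by (intro triangular_span.diagonal) (simp add: cartan)
    next
      case False
      then obtain p q where pq: "(p, q) \<in> off_diagonal_support X" by auto
      with step less.prems obtain R X' where R: "R \<in> lie L" "R \<in> triangular_span L H0" "X' \<in> lie L"
        "X = R + X'" "off_diagonal_support X' \<subseteq> off_diagonal_support X - {(p, q)}" by blast
      have "off_diagonal_support X \<subseteq> {..<dim_row X} \<times> {..<dim_col X}"
        by (auto simp: off_diagonal_support_def)
      then have "finite (off_diagonal_support X)" by (rule finite_subset) simp
      then have "card (off_diagonal_support X') < card (off_diagonal_support X)"
        using R pq by (intro psubset_card_mono) auto
      then have "X' \<in> triangular_span L H0" using less.hyps R by blast
      then show ?thesis using R by (auto intro: triangular_span.add)
    qed
  qed
qed

lemma smult_root_vector: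
  assumes "H \<in> carrier_mat N N" "diagonal_mat H" "R \<in> carrier_mat N N"
    and "\<And>i j. i < N \<Longrightarrow> j < N \<Longrightarrow> R $$ (i, j) \<noteq> 0 \<Longrightarrow> H $$ (i, i) - H $$ (j, j) = a"
  shows "lie_bracket H R = a \<cdot>\<^sub>m (R :: 'k::field mat)"
proof (rule eq_matI)
  fix i j assume "i < dim_row (a \<cdot>\<^sub>m R)" "j < dim_col (a \<cdot>\<^sub>m R)"
  then have ij: "i < N" "j < N" using assms(3) by auto
  then show "lie_bracket H R $$ (i, j) = (a \<cdot>\<^sub>m R) $$ (i, j)"
    using lie_bracket_diagonal_entry[OF assms(1-3) ij] assms(3) assms(4)[OF ij]
    by (cases "R $$ (i, j) = 0") auto
qed (use assms lie_bracket_carrier[of H N R] in auto)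


subsection \<open>Type A\<close>

lemma type_A_simps:
  "lie (type_A n) = sl (n + 1)"
  "cartan (type_A n) = {H \<in> sl (n + 1). diagonal_mat H}"
  "simple_roots (type_A n) =
     {(\<lambda>H\<in>cartan (type_A n). H $$ (i, i) - H $$ (i + 1, i + 1)) | i. i < n}"
  by (simp_all add: type_A_def Let_def)

text \<open>
  The shift by \<open>n / 2\<close> makes the trace vanish.
\<close>

definition grading_A :: "nat \<Rightarrow> 'k::field_char_0 mat" where
  "grading_A n = mat (n + 1) (n + 1) (\<lambda>(i, j). if i = j then of_nat n / 2 - of_nat i else 0)"

definition elementary :: "nat \<Rightarrow> nat \<Rightarrow> nat \<Rightarrow> 'k \<Rightarrow> 'k::field mat" where
  "elementary N p q c = mat N N (\<lambda>(i, j). if i = p \<and> j = q then c else 0)"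

lemma elementary_carrier [simp]: "elementary N p q c \<in> carrier_mat N N"
  and elementary_dim [simp]: "dim_row (elementary N p q c) = N" "dim_col (elementary N p q c) = N"
  and elementary_entry [simp]: "i < N \<Longrightarrow> j < N \<Longrightarrow>
    elementary N p q c $$ (i, j) = (if i = p \<and> j = q then c else 0)"
  by (simp_all add: elementary_def)

lemma elementary_sl: "p \<noteq> q \<Longrightarrow> elementary N p q c \<in> sl N"
  by (auto simp: sl_def intro!: sum.neutral)

lemma elementary_bracket:
  assumes "H \<in> carrier_mat N N" "diagonal_mat H"
  shows "lie_bracket H (elementary N p q c) = (H $$ (p, p) - H $$ (q, q)) \<cdot>\<^sub>m elementary N p q c"
  using assms by (intro smult_root_vector) (auto split: if_splits)

lemma grading_A_entry: "i < n + 1 \<Longrightarrow> grading_A n $$ (i, i) = of_nat n / 2 - of_nat i"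
  by (simp add: grading_A_def)

lemma grading_A_cartan: "grading_A n \<in> cartan (type_A n :: 'k::field_char_0 based_lie_algebra)"
proof -
  have "(\<Sum>i<n + 1. of_nat n / 2 - of_nat i) = (0 :: 'k)"
  proof -
    have "(\<Sum>i<m + 1. of_nat i) = (of_nat (m + 1) * of_nat m / 2 :: 'k)" for m
      by (induction m) (simp_all add: field_simps)
    then show ?thesis by (simp only: sum_subtractf) simp
  qed
  moreover have "(\<Sum>i<n + 1. (grading_A n :: 'k mat) $$ (i, i)) = (\<Sum>i<n + 1. of_nat n / 2 - of_nat i)"
    by (intro sum.cong) (auto simp: grading_A_entry)
  ultimately show ?thesis
    by (auto simp: type_A_simps sl_def diagonal_mat_def grading_A_def)
qed

lemma sl_bracket_closed: "X \<in> sl N \<Longrightarrow> Y \<in> sl N \<Longrightarrow> lie_bracket X Y \<in> sl N"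
proof -
  assume X: "X \<in> sl N" and Y: "Y \<in> sl N"
  then have c: "X \<in> carrier_mat N N" "Y \<in> carrier_mat N N" by (auto simp: sl_def)
  have "(\<Sum>i<N. lie_bracket X Y $$ (i, i)) =
      (\<Sum>i<N. \<Sum>k<N. X $$ (i, k) * Y $$ (k, i)) - (\<Sum>i<N. \<Sum>k<N. Y $$ (i, k) * X $$ (k, i))"
    using c by (simp add: lie_bracket_entry sum_subtractf)
  also have "(\<Sum>i<N. \<Sum>k<N. Y $$ (i, k) * X $$ (k, i)) = (\<Sum>i<N. \<Sum>k<N. X $$ (i, k) * Y $$ (k, i))"
    by (subst sum.swap) (simp add: mult.commute)
  finally show ?thesis using c by (simp add: sl_def lie_bracket_carrier)
qed

lemma finite_simple_A: "finite (simple_roots (type_A n))"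
  by (simp add: type_A_simps(3) setcompr_eq_image)

lemma root_cone_A:
  "p < q \<Longrightarrow> q < n + 1 \<Longrightarrow> in_root_cone (type_A n) (\<lambda>H. H $$ (p, p) - H $$ (q, q))"
  by (rule in_root_cone_chain[OF finite_simple_A]) (auto simp: type_A_simps(3))

lemma cartan_A_carrier:
  "H \<in> cartan (type_A n) \<Longrightarrow> H \<in> carrier_mat (n + 1) (n + 1)"
  "H \<in> cartan (type_A n) \<Longrightarrow> diagonal_mat H"
  by (auto simp: type_A_simps sl_def)

lemma sl_triangular: "lie (type_A n) \<subseteq> triangular_span (type_A n) (grading_A n :: 'k::field_char_0 mat)"
proof (rule triangular_by_elimination)
  fix X :: "'k mat" and p q
  let ?N = "n + 1"
  assume X: "X \<in> lie (type_A n)" and pq: "(p, q) \<in> off_diagonal_support X"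
  have Xc: "X \<in> carrier_mat ?N ?N" and tr: "(\<Sum>i<?N. X $$ (i, i)) = 0"
    using X by (auto simp: type_A_simps sl_def)
  have lt: "p < ?N" "q < ?N" "p \<noteq> q" "X $$ (p, q) \<noteq> 0"
    using pq Xc by (auto simp: off_diagonal_support_def)
  define R where "R = elementary ?N p q (X $$ (p, q))"
  define X' where "X' = mat ?N ?N (\<lambda>(i, j). if i = p \<and> j = q then 0 else X $$ (i, j))"
  have "R \<in> lie (type_A n)" unfolding R_def type_A_simps using lt by (intro elementary_sl)
  moreover have "R \<in> triangular_span (type_A n) (grading_A n)"
  proof (rule root_vector_triangular[OF grading_A_cartan \<open>R \<in> lie (type_A n)\<close>])
    show "R \<noteq> 0\<^sub>m (dim_row R) (dim_col R)"
    proof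
      assume "R = 0\<^sub>m (dim_row R) (dim_col R)"
      then have "R $$ (p, q) = 0\<^sub>m (dim_row R) (dim_col R) $$ (p, q)" by simp
      then show False using lt by (simp add: R_def)
    qed
    show "lie_bracket H R = (H $$ (p, p) - H $$ (q, q)) \<cdot>\<^sub>m R" if "H \<in> cartan (type_A n)" for H
      unfolding R_def by (rule elementary_bracket[OF cartan_A_carrier[OF that]])
    show "grading_A n $$ (p, p) - grading_A n $$ (q, q) = (of_int (int q - int p) :: 'k)"
      using lt by (simp add: grading_A_entry)
    show "int q - int p \<noteq> 0" using lt by simp
    show "0 < int q - int p \<Longrightarrow> in_root_cone (type_A n) (\<lambda>H. H $$ (p, p) - H $$ (q, q) :: 'k)"
      using lt by (intro root_cone_A) auto
  qed
  moreover have "X' \<in> lie (type_A n)"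
  proof -
    have "(\<Sum>i<?N. X' $$ (i, i)) = (\<Sum>i<?N. X $$ (i, i))"
      using lt by (intro sum.cong) (auto simp: X'_def)
    then show ?thesis using tr by (simp add: type_A_simps sl_def X'_def)
  qed
  moreover have "X = R + X'" using Xc by (intro eq_matI) (auto simp: R_def X'_def)
  moreover have "off_diagonal_support X' \<subseteq> off_diagonal_support X - {(p, q)}"
    using Xc by (auto simp: off_diagonal_support_def X'_def split: if_splits)
  ultimately show "\<exists>R X'. R \<in> lie (type_A n) \<and> R \<in> triangular_span (type_A n) (grading_A n) \<and>
      X' \<in> lie (type_A n) \<and> X = R + X' \<and> off_diagonal_support X' \<subseteq> off_diagonal_support X - {(p, q)}"
    by blast
qed (simp add: type_A_simps)

lemma graded_A: "graded_lie_algebra (type_A n) (grading_A n :: 'k::field_char_0 mat)"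
proof
  show "\<beta> (grading_A n) = (1 :: 'k)" if "\<beta> \<in> simple_roots (type_A n)" for \<beta>
    using that grading_A_cartan[where 'k = 'k and n = n] by (auto simp: type_A_simps(3) grading_A_entry)
  show "lie (type_A n) \<subseteq> triangular_span (type_A n) (grading_A n :: 'k mat)" by (rule sl_triangular)
  show "grading_A n \<in> cartan (type_A n :: 'k based_lie_algebra)" by (rule grading_A_cartan)
qed (auto simp: finite_simple_A sl_bracket_closed type_A_simps(1,2))


subsection \<open>Type D\<close>

lemma split_form_carrier [simp]: "split_form n \<in> carrier_mat (2 * n) (2 * n)"
  by (simp add: split_form_def mult_2)

lemma split_form_entry:
  "p < 2 * n \<Longrightarrow> q < 2 * n \<Longrightarrow> split_form n $$ (p, q) = (if p = dual n q then 1 else 0 :: 'k::field)"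
  by (auto simp: split_form_def dual_def)

lemma so_even_iff:
  "X \<in> so_even n \<longleftrightarrow> X \<in> carrier_mat (2 * n) (2 * n) \<and> antisymmetric_coeffs n (\<lambda>p q. X $$ (p, q) :: 'k::field)"
proof (cases "X \<in> carrier_mat (2 * n) (2 * n)")
  case True
  let ?Z = "transpose_mat X * split_form n + split_form n * X"
  have dX: "dim_row X = 2 * n" "dim_col X = 2 * n" using True by auto
  have entry: "?Z $$ (p, q) = X $$ (dual n q, p) + X $$ (dual n p, q)" if pq: "p < 2 * n" "q < 2 * n" for p q
  proof -
    have "?Z $$ (p, q) = (transpose_mat X * split_form n) $$ (p, q) + (split_form n * X) $$ (p, q)"
      using True pq by (subst index_add_mat) (auto simp: split_form_def mult_2)
    also have "(transpose_mat X * split_form n) $$ (p, q) = (\<Sum>k<2 * n. transpose_mat X $$ (p, k) * split_form n $$ (k, q))"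
      using True pq by (intro mult_mat_entry) auto
    also have "\<dots> = (\<Sum>k<2 * n. if k = dual n q then X $$ (dual n q, p) else 0)"
      using dX pq by (intro sum.cong) (auto simp: split_form_entry)
    also have "\<dots> = X $$ (dual n q, p)" using pq by simp
    also have "(split_form n * X) $$ (p, q) = (\<Sum>k<2 * n. split_form n $$ (p, k) * X $$ (k, q))"
      using True pq by (intro mult_mat_entry) auto
    also have "\<dots> = (\<Sum>k<2 * n. if k = dual n p then X $$ (dual n p, q) else 0)"
      using dX pq dual_swap[of p n] by (intro sum.cong) (auto simp: split_form_entry)
    also have "\<dots> = X $$ (dual n p, q)" using pq by simp
    finally show ?thesis .
  qed
  have dZ: "?Z \<in> carrier_mat (2 * n) (2 * n)" using True by (auto simp: split_form_def mult_2)
  have "?Z = 0\<^sub>m (2 * n) (2 * n) \<longleftrightarrow> (\<forall>p<2 * n. \<forall>q<2 * n. ?Z $$ (p, q) = 0)"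
  proof
    assume "\<forall>p<2 * n. \<forall>q<2 * n. ?Z $$ (p, q) = 0"
    then show "?Z = 0\<^sub>m (2 * n) (2 * n)" using dZ by (intro eq_matI) auto
  qed simp
  also have "\<dots> \<longleftrightarrow> (\<forall>p<2 * n. \<forall>q<2 * n. X $$ (dual n q, p) + X $$ (dual n p, q) = 0)"
    using entry by simp
  also have "\<dots> \<longleftrightarrow> antisymmetric_coeffs n (\<lambda>p q. X $$ (p, q))"
    unfolding antisymmetric_coeffs_def
  proof safe
    fix p q assume *: "\<forall>p<2 * n. \<forall>q<2 * n. X $$ (dual n q, p) + X $$ (dual n p, q) = 0" "p < 2 * n" "q < 2 * n"
    from *(1)[rule_format, of "dual n p" q] *(2,3)
    show "X $$ (dual n q, dual n p) = - X $$ (p, q)" by (simp add: add_eq_0_iff2)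
  next
    fix p q assume *: "\<forall>p<2 * n. \<forall>q<2 * n. X $$ (dual n q, dual n p) = - X $$ (p, q)" "p < 2 * n" "q < 2 * n"
    from *(1)[rule_format, of "dual n p" q] *(2,3)
    show "X $$ (dual n q, p) + X $$ (dual n p, q) = 0" by simp
  qed
  finally show ?thesis using True by (simp add: so_even_def)
qed (simp add: so_even_def)

lemma type_D_simps:
  "lie (type_D n) = so_even n"
  "cartan (type_D n) = {H \<in> so_even n. diagonal_mat H}"
  "simple_roots (type_D n) =
     {(\<lambda>H\<in>cartan (type_D n). H $$ (i, i) - H $$ (i + 1, i + 1)) | i. i < n - 1}
     \<union> {(\<lambda>H\<in>cartan (type_D n). H $$ (n - 2, n - 2) + H $$ (n - 1, n - 1))}"
  by (simp_all add: type_D_def Let_def)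

text \<open>
  The diagonal \<open>(n - 1, \<dots>, 1, 0, - (n - 1), \<dots>, - 1, 0)\<close>.  The value \<open>0\<close> for \<open>\<epsilon>\<^sub>n\<close> gives both simple roots
  that involve \<open>\<epsilon>\<^sub>n\<close> the value \<open>1\<close>.
\<close>

definition height_D :: "nat \<Rightarrow> nat \<Rightarrow> int" where
  "height_D n p = (if p < n then int n - 1 - int p else int p - 2 * int n + 1)"

definition grading_D :: "nat \<Rightarrow> 'k::field_char_0 mat" where
  "grading_D n = mat (2 * n) (2 * n) (\<lambda>(i, j). if i = j then of_int (height_D n i) else 0)"

definition root_vector_D :: "nat \<Rightarrow> nat \<Rightarrow> nat \<Rightarrow> 'k \<Rightarrow> 'k::field mat" where
  "root_vector_D n p q c = mat (2 * n) (2 * n) (\<lambda>(i, j). c * root_coeffs n p q i j)"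

lemma height_D_dual: "p < 2 * n \<Longrightarrow> height_D n (dual n p) = - height_D n p"
  by (auto simp: height_D_def dual_def)

text \<open>
  The only coincidence of heights is the zero at the two last indices of the blocks, which are
  dual to each other; there the antisymmetric matrices have a zero entry.
\<close>

lemma height_D_neq:
  assumes "p < 2 * n" "q < 2 * n" "p \<noteq> q" "q \<noteq> dual n p"
  shows "height_D n p \<noteq> height_D n q"
  using assms by (auto simp: height_D_def dual_def split: if_splits)

lemma root_coeffs_antisymmetric:
  "p < 2 * n \<Longrightarrow> q < 2 * n \<Longrightarrow> antisymmetric_coeffs n (\<lambda>i j. c * root_coeffs n p q i j :: 'k::field)"
  unfolding antisymmetric_coeffs_def
proof (intro allI impI)
  fix i j assume pq: "p < 2 * n" "q < 2 * n" and ij: "i < 2 * n" "j < 2 * n"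
  have "dual n j = p \<and> dual n i = q \<longleftrightarrow> i = dual n q \<and> j = dual n p"
    using dual_swap[OF pq(1) ij(2)] dual_swap[OF pq(2) ij(1)] by auto
  moreover have "dual n j = dual n q \<and> dual n i = dual n p \<longleftrightarrow> i = p \<and> j = q"
    using dual_eq_iff[OF ij(2) pq(2)] dual_eq_iff[OF ij(1) pq(1)] by auto
  ultimately show "c * root_coeffs n p q (dual n j) (dual n i) = - (c * root_coeffs n p q i j)"
    unfolding root_coeffs_def by (simp add: algebra_simps)
qed

lemma so_even_matI:
  "antisymmetric_coeffs n (x :: nat \<Rightarrow> nat \<Rightarrow> 'k::field) \<Longrightarrow> mat (2 * n) (2 * n) (\<lambda>(i, j). x i j) \<in> so_even n"
  by (simp add: so_even_iff antisymmetric_coeffs_def)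

lemma root_vector_D_so:
  "p < 2 * n \<Longrightarrow> q < 2 * n \<Longrightarrow> root_vector_D n p q c \<in> so_even n"
  unfolding root_vector_D_def by (intro so_even_matI root_coeffs_antisymmetric)

lemma cartan_D_carrier:
  "H \<in> cartan (type_D n) \<Longrightarrow> H \<in> carrier_mat (2 * n) (2 * n)"
  "H \<in> cartan (type_D n) \<Longrightarrow> diagonal_mat H"
  by (auto simp: type_D_simps so_even_iff)

lemma cartan_D_dual:
  assumes "H \<in> cartan (type_D n)" "p < 2 * n"
  shows "H $$ (dual n p, dual n p) = - H $$ (p, p)"
  using assms by (auto simp: type_D_simps so_even_iff antisymmetric_coeffs_def)

lemma root_vector_D_bracket:
  assumes "H \<in> cartan (type_D n)" "p < 2 * n" "q < 2 * n"
  shows "lie_bracket H (root_vector_D n p q c) = (H $$ (p, p) - H $$ (q, q)) \<cdot>\<^sub>m root_vector_D n p q c"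
proof (rule smult_root_vector[OF cartan_D_carrier[OF assms(1)]])
  fix i j assume "i < 2 * n" "j < 2 * n" "root_vector_D n p q c $$ (i, j) \<noteq> 0"
  then have "i = p \<and> j = q \<or> i = dual n q \<and> j = dual n p"
    by (auto simp: root_vector_D_def root_coeffs_def split: if_splits)
  then show "H $$ (i, i) - H $$ (j, j) = H $$ (p, p) - H $$ (q, q)"
    using cartan_D_dual[OF assms(1)] assms by auto
qed (simp add: root_vector_D_def)

lemma grading_D_entry: "i < 2 * n \<Longrightarrow> grading_D n $$ (i, i) = of_int (height_D n i)"
  by (simp add: grading_D_def)

lemma grading_D_cartan: "grading_D n \<in> cartan (type_D n :: 'k::field_char_0 based_lie_algebra)"
proof -
  have "grading_D n \<in> so_even n" unfolding grading_D_def
    by (intro so_even_matI) (auto simp: antisymmetric_coeffs_def dual_eq_iff height_D_dual)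
  then show ?thesis by (auto simp: type_D_simps diagonal_mat_def grading_D_def)
qed

lemma so_even_bracket_closed:
  assumes "X \<in> so_even n" "Y \<in> so_even n"
  shows "lie_bracket X Y \<in> so_even (n :: nat)"
proof -
  have c: "X \<in> carrier_mat (2 * n) (2 * n)" "Y \<in> carrier_mat (2 * n) (2 * n)"
    and a: "\<And>p q. p < 2 * n \<Longrightarrow> q < 2 * n \<Longrightarrow> X $$ (dual n q, dual n p) = - X $$ (p, q)"
      "\<And>p q. p < 2 * n \<Longrightarrow> q < 2 * n \<Longrightarrow> Y $$ (dual n q, dual n p) = - Y $$ (p, q)"
    using assms by (auto simp: so_even_iff antisymmetric_coeffs_def)
  have "lie_bracket X Y $$ (dual n q, dual n p) = - lie_bracket X Y $$ (p, q)"
    if pq: "p < 2 * n" "q < 2 * n" for p q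
  proof -
    have "lie_bracket X Y $$ (dual n q, dual n p) =
      (\<Sum>k<2 * n. X $$ (dual n q, dual n k) * Y $$ (dual n k, dual n p) - Y $$ (dual n q, dual n k) * X $$ (dual n k, dual n p))"
      using pq c by (simp add: lie_bracket_entry
          sum_dual[of "\<lambda>k. X $$ (dual n q, k) * Y $$ (k, dual n p) - Y $$ (dual n q, k) * X $$ (k, dual n p)"])
    also have "\<dots> = (\<Sum>k<2 * n. - (X $$ (p, k) * Y $$ (k, q) - Y $$ (p, k) * X $$ (k, q)))"
      using pq by (intro sum.cong) (auto simp: a algebra_simps)
    finally show ?thesis unfolding lie_bracket_entry[OF c pq] sum_negf .
  qed
  then show ?thesis using c by (simp add: so_even_iff antisymmetric_coeffs_def lie_bracket_carrier)
qed

lemma finite_simple_D: "finite (simple_roots (type_D n))"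
  by (simp add: type_D_simps(3) setcompr_eq_image)

lemma chain_D:
  "i < j \<Longrightarrow> j < n \<Longrightarrow> in_root_cone (type_D n) (\<lambda>H. H $$ (i, i) - H $$ (j, j))"
  by (rule in_root_cone_chain[OF finite_simple_D]) (auto simp: type_D_simps(3))

text \<open>
  For \<open>i < j\<close> the root \<open>\<epsilon>\<^sub>i + \<epsilon>\<^sub>j\<close> arises from the last simple root \<open>\<epsilon>\<^sub>n\<^sub>-\<^sub>1 + \<epsilon>\<^sub>n\<close> by adding
  \<open>\<epsilon>\<^sub>i - \<epsilon>\<^sub>n\<^sub>-\<^sub>1\<close> and \<open>\<epsilon>\<^sub>j - \<epsilon>\<^sub>n\<close>.
\<close>

lemma sum_cone_D:
  assumes "i < j" "j < n"
  shows "in_root_cone (type_D n) (\<lambda>H. H $$ (i, i) + H $$ (j, j))"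
proof -
  have base: "in_root_cone (type_D n) (\<lambda>H. H $$ (n - 2, n - 2) + H $$ (n - 1, n - 1))"
    by (rule in_root_cone_simple[OF finite_simple_D,
          of "\<lambda>H\<in>cartan (type_D n). H $$ (n - 2, n - 2) + H $$ (n - 1, n - 1)"])
      (simp_all add: type_D_simps(3))
  have one: "in_root_cone (type_D n) (\<lambda>H. H $$ (i, i) + H $$ (n - 1, n - 1))"
  proof (cases "i = n - 2")
    case False
    then have "in_root_cone (type_D n) (\<lambda>H. H $$ (i, i) - H $$ (n - 2, n - 2))"
      using assms by (intro chain_D) auto
    then show ?thesis using base by (rule in_root_cone_add) simp
  qed (use base in simp)
  show ?thesis
  proof (cases "j = n - 1")
    case False
    then have "in_root_cone (type_D n) (\<lambda>H. H $$ (j, j) - H $$ (n - 1, n - 1))"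
      using assms by (intro chain_D) auto
    then show ?thesis using one by (rule in_root_cone_add) simp
  qed (use one in simp)
qed

lemma in_root_cone_cong:
  assumes "in_root_cone L \<alpha>" "\<And>H. H \<in> cartan L \<Longrightarrow> \<beta> H = \<alpha> H"
  shows "in_root_cone L \<beta>"
  using assms unfolding in_root_cone_def by simp

lemma root_cone_D:
  assumes "p < 2 * n" "q < 2 * n" "p \<noteq> q" "q \<noteq> dual n p" "height_D n q < height_D n p"
  shows "in_root_cone (type_D n) (\<lambda>H. H $$ (p, p) - H $$ (q, q))"
proof -
  have "p < n \<Longrightarrow> \<not> q < n \<Longrightarrow> p < q - n \<or> q - n < p"
    using assms(4) by (auto simp: dual_def)
  then consider (pp) "p < n" "q < n" "p < q"
    | (mm) "n \<le> p" "n \<le> q" "dual n q < dual n p" "dual n p < n" "dual n q < n"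
    | (pm) "p < n" "n \<le> q" "p < dual n q" "dual n q < n"
    | (mp) "p < n" "n \<le> q" "dual n q < p"  "dual n q < n"
    using assms by (auto simp: height_D_def dual_def split: if_splits)
  then show ?thesis
  proof cases
    case pp
    then show ?thesis by (intro chain_D) auto
  next
    case mm
    show ?thesis
      by (rule in_root_cone_cong[OF chain_D[OF mm(3,4)]]) (simp add: cartan_D_dual assms(1,2))
  next
    case pm
    show ?thesis
      by (rule in_root_cone_cong[OF sum_cone_D[OF pm(3,4)]]) (simp add: cartan_D_dual assms(1,2))
  next
    case mp
    show ?thesis
      by (rule in_root_cone_cong[OF sum_cone_D[OF mp(3,1)]]) (simp add: cartan_D_dual assms(1,2))
  qed
qed

lemma so_even_triangular: "lie (type_D n) \<subseteq> triangular_span (type_D n) (grading_D n :: 'k::field_char_0 mat)"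
proof (rule triangular_by_elimination)
  fix X :: "'k mat" and p q
  let ?N = "2 * n"
  assume X: "X \<in> lie (type_D n)" and pq: "(p, q) \<in> off_diagonal_support X"
  have Xc: "X \<in> carrier_mat ?N ?N" and an: "antisymmetric_coeffs n (\<lambda>p q. X $$ (p, q))"
    using X by (auto simp: type_D_simps so_even_iff)
  have lt: "p < ?N" "q < ?N" "p \<noteq> q" "X $$ (p, q) \<noteq> 0"
    using pq Xc by (auto simp: off_diagonal_support_def)
  have dual: "q \<noteq> dual n p"
  proof
    assume "q = dual n p"
    then have "X $$ (p, q) = - X $$ (p, q)"
      using an lt unfolding antisymmetric_coeffs_def by (metis dual_dual)
    then show False using lt by simp
  qed
  have Xd: "X $$ (dual n q, dual n p) = - X $$ (p, q)"
    using an lt by (simp add: antisymmetric_coeffs_def)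
  define R where "R = root_vector_D n p q (X $$ (p, q))"
  define X' where "X' = mat ?N ?N (\<lambda>(i, j). X $$ (i, j) - X $$ (p, q) * root_coeffs n p q i j)"
  have "R \<in> lie (type_D n)" unfolding R_def type_D_simps using lt by (intro root_vector_D_so)
  moreover have "R \<in> triangular_span (type_D n) (grading_D n)"
  proof (rule root_vector_triangular[OF grading_D_cartan \<open>R \<in> lie (type_D n)\<close>])
    show "R \<noteq> 0\<^sub>m (dim_row R) (dim_col R)"
    proof
      assume "R = 0\<^sub>m (dim_row R) (dim_col R)"
      then have "R $$ (p, q) = 0\<^sub>m (dim_row R) (dim_col R) $$ (p, q)" by simp
      moreover have "p \<noteq> dual n q \<or> q \<noteq> dual n p" using dual by simp
      ultimately show False using lt by (auto simp: R_def root_vector_D_def root_coeffs_def)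
    qed
    show "lie_bracket H R = (H $$ (p, p) - H $$ (q, q)) \<cdot>\<^sub>m R" if "H \<in> cartan (type_D n)" for H
      unfolding R_def by (rule root_vector_D_bracket[OF that lt(1,2)])
    show "grading_D n $$ (p, p) - grading_D n $$ (q, q) = (of_int (height_D n p - height_D n q) :: 'k)"
      using lt by (simp add: grading_D_entry)
    show "height_D n p - height_D n q \<noteq> 0" using height_D_neq[OF lt(1-3) dual] by simp
    show "0 < height_D n p - height_D n q \<Longrightarrow> in_root_cone (type_D n) (\<lambda>H. H $$ (p, p) - H $$ (q, q) :: 'k)"
      using lt dual by (intro root_cone_D) auto
  qed
  moreover have "X' \<in> lie (type_D n)"
    unfolding X'_def type_D_simps
    using an root_coeffs_antisymmetric[OF lt(1,2), of "X $$ (p, q)"]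
    by (intro so_even_matI) (auto simp: antisymmetric_coeffs_def)
  moreover have "X = R + X'"
    using Xc by (intro eq_matI) (auto simp: R_def root_vector_D_def X'_def)
  moreover have "off_diagonal_support X' \<subseteq> off_diagonal_support X - {(p, q)}"
  proof -
    have "X $$ (i, j) \<noteq> 0 \<and> (i, j) \<noteq> (p, q)" if "X $$ (i, j) - X $$ (p, q) * root_coeffs n p q i j \<noteq> 0" for i j
      using that lt dual Xd by (auto simp: root_coeffs_def split: if_splits)
    note entry = this
    show ?thesis
    proof (rule subrelI)
      fix i j assume supp: "(i, j) \<in> off_diagonal_support X'"
      then have ij: "i < ?N" "j < ?N" "i \<noteq> j"
        by (simp_all add: off_diagonal_support_def X'_def)
      then have "X $$ (i, j) - X $$ (p, q) * root_coeffs n p q i j \<noteq> 0"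
        using supp by (simp add: off_diagonal_support_def X'_def)
      with entry ij Xc show "(i, j) \<in> off_diagonal_support X - {(p, q)}"
        by (simp add: off_diagonal_support_def)
    qed
  qed
  ultimately show "\<exists>R X'. R \<in> lie (type_D n) \<and> R \<in> triangular_span (type_D n) (grading_D n) \<and>
      X' \<in> lie (type_D n) \<and> X = R + X' \<and> off_diagonal_support X' \<subseteq> off_diagonal_support X - {(p, q)}"
    by blast
qed (simp add: type_D_simps)

lemma graded_D:
  assumes "2 \<le> n"
  shows "graded_lie_algebra (type_D n) (grading_D n :: 'k::field_char_0 mat)"
proof
  show "\<beta> (grading_D n) = (1 :: 'k)" if "\<beta> \<in> simple_roots (type_D n)" for \<beta>
    using that grading_D_cartan[where 'k = 'k and n = n] assms by (auto simp: type_D_simps(3) grading_D_entry height_D_def)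
  show "lie (type_D n) \<subseteq> triangular_span (type_D n) (grading_D n :: 'k mat)" by (rule so_even_triangular)
  show "grading_D n \<in> cartan (type_D n :: 'k based_lie_algebra)" by (rule grading_D_cartan)
qed (auto simp: finite_simple_D so_even_bracket_closed type_D_simps(1,2))


section \<open>Fock spaces as weight modules\<close>

text \<open>
  A linear map \<open>\<phi>\<close> into antisymmetric coefficient functions that respects brackets makes the
  functions on \<open>B\<close> a module, provided that the quadratic Clifford elements involved do not lead out
  of \<open>B\<close>.
\<close>

lemma spin_module:
  fixes L :: "'k::field_char_0 based_lie_algebra" and \<phi> :: "'k mat \<Rightarrow> nat \<Rightarrow> nat \<Rightarrow> 'k"
  assumes anti: "\<And>X. X \<in> lie L \<Longrightarrow> antisymmetric_coeffs n (\<phi> X)"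
    and add: "\<And>X Y p q. X \<in> lie L \<Longrightarrow> Y \<in> lie L \<Longrightarrow> p < 2 * n \<Longrightarrow> q < 2 * n \<Longrightarrow> \<phi> (X + Y) p q = \<phi> X p q + \<phi> Y p q"
    and scale: "\<And>X c p q. X \<in> lie L \<Longrightarrow> p < 2 * n \<Longrightarrow> q < 2 * n \<Longrightarrow> \<phi> (c \<cdot>\<^sub>m X) p q = c * \<phi> X p q"
    and bracket: "\<And>X Y p q. X \<in> lie L \<Longrightarrow> Y \<in> lie L \<Longrightarrow> p < 2 * n \<Longrightarrow> q < 2 * n \<Longrightarrow>
      \<phi> (lie_bracket X Y) p q = (\<Sum>r<2 * n. \<phi> X p r * \<phi> Y r q - \<phi> Y p r * \<phi> X r q)"
    and preserve: "\<And>X (f :: nat \<Rightarrow> 'k) s p q. X \<in> lie L \<Longrightarrow> f \<in> supported_on B \<Longrightarrow> s \<notin> B \<Longrightarrow> p < 2 * n \<Longrightarrow> q < 2 * n \<Longrightarrow>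
      \<phi> X p q \<noteq> 0 \<Longrightarrow> clifford n p (clifford n (dual n q) f) s = 0"
  shows "lie_module L (supported_on B) (\<lambda>X. spin n (\<phi> X))"
  unfolding lie_module_def subspace_fun_scale_iff
proof (intro conjI ballI allI)
  fix X and f :: "nat \<Rightarrow> 'k" assume X: "X \<in> lie L" and f: "f \<in> supported_on B"
  show "spin n (\<phi> X) f \<in> supported_on B"
    unfolding supported_on_def
  proof (intro CollectI allI impI)
    fix s assume s: "s \<notin> B"
    have zero: "\<phi> X p q * clifford n p (clifford n (dual n q) f) s = 0" if "p < 2 * n" "q < 2 * n" for p q
      using preserve[OF X f s that] by auto
    have "(\<Sum>p<2 * n. \<Sum>q<2 * n. \<phi> X p q * clifford n p (clifford n (dual n q) f) s) = 0"
      by (intro sum.neutral ballI) (rule zero; simp)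
    then show "spin n (\<phi> X) f s = 0" by (simp add: spin_def)
  qed
  fix c
  show "spin n (\<phi> X) (\<lambda>i. c * f i) = (\<lambda>i. c * spin n (\<phi> X) f i)"
    by (rule spin_scale_vector)
  show "spin n (\<phi> X) (f + g) = spin n (\<phi> X) f + spin n (\<phi> X) g" for g
    by (rule spin_add_vector)
  show "spin n (\<phi> (c \<cdot>\<^sub>m X)) f = (\<lambda>i. c * spin n (\<phi> X) f i)"
    unfolding spin_scale[symmetric] by (intro ext spin_cong scale X)
  fix Y assume Y: "Y \<in> lie L"
  show "spin n (\<phi> (X + Y)) f = spin n (\<phi> X) f + spin n (\<phi> Y) f"
    unfolding spin_add[symmetric] by (intro ext spin_cong add X Y)
  show "spin n (\<phi> (lie_bracket X Y)) f = spin n (\<phi> X) (spin n (\<phi> Y) f) - spin n (\<phi> Y) (spin n (\<phi> X) f)"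
  proof
    fix s
    have "spin n (\<phi> (lie_bracket X Y)) f s = spin n (\<lambda>p q. \<Sum>r<2 * n. \<phi> X p r * \<phi> Y r q - \<phi> Y p r * \<phi> X r q) f s"
      by (intro spin_cong bracket X Y)
    also have "\<dots> = spin n (\<phi> X) (spin n (\<phi> Y) f) s - spin n (\<phi> Y) (spin n (\<phi> X) f) s"
      by (rule spin_commutator[symmetric]) (intro anti X Y)+
    finally show "spin n (\<phi> (lie_bracket X Y)) f s =
        (spin n (\<phi> X) (spin n (\<phi> Y) f) - spin n (\<phi> Y) (spin n (\<phi> X) f)) s" by simp
  qed
qed (auto simp: supported_on_def)

lemma mode_dual [simp]: "p < 2 * n \<Longrightarrow> mode n (dual n p) = mode n p"
  and dual_less_n: "p < 2 * n \<Longrightarrow> dual n p < n \<longleftrightarrow> \<not> p < n"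
  and mode_less [simp]: "p < 2 * n \<Longrightarrow> mode n p < n"
  by (auto simp: mode_def dual_def split: if_splits)

lemma mode_neq: "p < 2 * n \<Longrightarrow> q < 2 * n \<Longrightarrow> p \<noteq> q \<Longrightarrow> q \<noteq> dual n p \<Longrightarrow> mode n p \<noteq> mode n q"
  by (auto simp: mode_def dual_def split: if_splits)

text \<open>
  A root vector carries a basis vector to a nonzero multiple of another one as soon as the element of
  \<open>b\<close> can be removed (or inserted, if \<open>n \<le> b\<close>) and that of \<open>a\<close> inserted (or removed).
\<close>

lemma spin_root_basis:
  fixes n a b s
  defines "s' \<equiv> flip (mode n a) (flip (mode n b) s)"
  assumes ab: "a < 2 * n" "b < 2 * n" "a \<noteq> b" "b \<noteq> dual n a"
    and s: "mode n a \<in> set_decode s \<longleftrightarrow> n \<le> a" "mode n b \<in> set_decode s \<longleftrightarrow> b < n"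
    and x: "\<And>p q. p < 2 * n \<Longrightarrow> q < 2 * n \<Longrightarrow> x p q = root_coeffs n a b p q"
  shows "\<exists>c. c \<noteq> 0 \<and> spin n x (basis_vec s) = fun_scale c (basis_vec s' :: nat \<Rightarrow> 'k::field_char_0)"
proof -
  let ?c = "clifford_coeff n a s' * clifford_coeff n (dual n b) (flip (mode n b) s) :: 'k"
  have "spin n x (basis_vec s) = spin n (root_coeffs n a b) (basis_vec s :: nat \<Rightarrow> 'k)"
    by (intro ext spin_cong x)
  also have "\<dots> = clifford n a (clifford n (dual n b) (basis_vec s))"
    by (rule ext, rule spin_root[OF ab])
  also have "\<dots> = fun_scale ?c (basis_vec s')"
    unfolding basis_vec_def using clifford_pair_basis[of n a "dual n b" s] ab
    by (simp add: s'_def)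
  finally have "spin n x (basis_vec s) = fun_scale ?c (basis_vec s')" .
  moreover have "?c \<noteq> 0"
    using s ab mode_neq[OF ab] by (auto simp: clifford_coeff_def s'_def dual_less_n)
  ultimately show ?thesis by blast
qed

lemma spin_root_basis_back:
  fixes n a b s
  defines "s' \<equiv> flip (mode n a) (flip (mode n b) s)"
  assumes ab: "a < 2 * n" "b < 2 * n" "a \<noteq> b" "b \<noteq> dual n a"
    and s: "mode n a \<in> set_decode s \<longleftrightarrow> n \<le> a" "mode n b \<in> set_decode s \<longleftrightarrow> b < n"
    and x: "\<And>p q. p < 2 * n \<Longrightarrow> q < 2 * n \<Longrightarrow> x p q = root_coeffs n b a p q"
  shows "\<exists>c. c \<noteq> 0 \<and> spin n x (basis_vec s') = fun_scale c (basis_vec s :: nat \<Rightarrow> 'k::field_char_0)"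
proof -
  have neq: "mode n a \<noteq> mode n b" by (rule mode_neq[OF ab])
  have "a \<noteq> dual n b" using ab dual_swap by blast
  then have "\<exists>c. c \<noteq> 0 \<and> spin n x (basis_vec s') =
      fun_scale c (basis_vec (flip (mode n b) (flip (mode n a) s')) :: nat \<Rightarrow> 'k)"
    using ab s neq by (intro spin_root_basis x) (auto simp: s'_def)
  then show ?thesis by (simp add: s'_def)
qed

text \<open>
  Distance from the highest state: inserting elements, or replacing \<open>j\<close> by \<open>j - 1\<close>, decreases it.
\<close>

definition depth :: "nat \<Rightarrow> nat \<Rightarrow> nat" where
  "depth n s = (\<Sum>i\<in>{..<n} - set_decode s. n - i)"

lemma depth_shift:
  assumes "set_decode s \<subseteq> {..<n}" "j \<in> set_decode s" "0 < j" "j - 1 \<notin> set_decode s"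
  shows "depth n (flip (j - 1) (flip j s)) < depth n s"
proof -
  let ?C = "{..<n} - set_decode s"
  have jn: "j < n" using assms by auto
  have "{..<n} - set_decode (flip (j - 1) (flip j s)) = insert j (?C - {j - 1})"
    using assms jn by (auto simp: set_decode_flip)
  then have "depth n (flip (j - 1) (flip j s)) = (n - j) + (\<Sum>i\<in>?C - {j - 1}. n - i)"
    using assms by (simp add: depth_def)
  moreover have "depth n s = (n - (j - 1)) + (\<Sum>i\<in>?C - {j - 1}. n - i)"
    unfolding depth_def using assms jn by (intro sum.remove) auto
  ultimately show ?thesis using jn assms(3) by simp
qed

lemma depth_insert_two:
  assumes "i < n" "j < n" "i \<noteq> j" "i \<notin> set_decode s" "j \<notin> set_decode s"
  shows "depth n (flip i (flip j s)) < depth n s"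
  unfolding depth_def
proof (rule sum_strict_mono2)
  show "{..<n} - set_decode (flip i (flip j s)) \<subseteq> {..<n} - set_decode s"
    using assms by (auto simp: set_decode_flip split: if_splits)
  show "i \<in> ({..<n} - set_decode s) - ({..<n} - set_decode (flip i (flip j s)))"
    using assms by (auto simp: set_decode_flip)
qed (use assms in auto)

lemma finite_no_gap:
  fixes S :: "nat set"
  assumes "finite S" "\<And>j. j \<in> S \<Longrightarrow> 0 < j \<Longrightarrow> j - 1 \<in> S"
  shows "S = {..<card S}"
proof -
  have down: "x \<in> S \<Longrightarrow> y \<le> x \<Longrightarrow> y \<in> S" for x y
  proof (induction x)
    case (Suc x)
    then show ?case using assms(2)[of "Suc x"] by (cases "y = Suc x") auto
  qed simp
  define k where "k = (LEAST k. k \<notin> S)"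
  have "\<exists>k. k \<notin> S" using assms(1) infinite_UNIV_nat by (metis UNIV_eq_I)
  then have "k \<notin> S" unfolding k_def by (rule LeastI_ex)
  moreover have "x \<in> S" if "x < k" for x using that not_less_Least unfolding k_def by blast
  ultimately have "S = {..<k}" using down by (metis lessThan_iff linorder_not_less subsetI subset_antisym)
  then show ?thesis by simp
qed

lemma card_set_decode_flip:
  "card (set_decode (flip i s)) = (if i \<in> set_decode s then card (set_decode s) - 1 else card (set_decode s) + 1)"
  by (simp add: set_decode_flip)

lemma card_flip_flip:
  assumes "i \<in> set_decode s \<longleftrightarrow> j \<notin> set_decode (flip i s)"
  shows "card (set_decode (flip j (flip i s))) = card (set_decode s)"
proof -
  have "0 < card (set_decode s)" if "i \<in> set_decode s" using that by (auto simp: card_gt_0_iff)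
  then show ?thesis using assms by (cases "i \<in> set_decode s") (simp_all only: card_set_decode_flip if_True if_False simp_thms, auto)
qed

lemma flip_subset_iff: "i < n \<Longrightarrow> set_decode (flip i s) \<subseteq> {..<n} \<longleftrightarrow> set_decode s \<subseteq> {..<n}"
  by (auto simp: set_decode_flip)

lemma finite_states: "finite {s. set_decode s \<subseteq> {..<n} \<and> P s}"
proof -
  have "set_decode ` {s. set_decode s \<subseteq> {..<n} \<and> P s} \<subseteq> Pow {..<n}" by auto
  then have "finite (set_decode ` {s. set_decode s \<subseteq> {..<n} \<and> P s})" by (rule finite_subset) simp
  moreover have "inj_on set_decode A" for A by (metis inj_onI set_decode_inverse)
  ultimately show ?thesis by (rule finite_imageD)
qed

lemma clifford_pair_apply:
  "clifford n p (clifford n q f) s =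
     clifford_coeff n p s * clifford_coeff n q (flip (mode n p) s) * f (flip (mode n q) (flip (mode n p) s))"
  by (simp add: clifford_def mult.assoc)


subsection \<open>The exterior powers in type A\<close>

text \<open>
  The embedding \<open>X \<mapsto> (X, - X\<^sup>T)\<close> of \<open>gl\<^sub>N\<close> into the orthogonal Lie algebra as block diagonal matrices.
\<close>

definition gl_coeffs :: "nat \<Rightarrow> 'k::field mat \<Rightarrow> nat \<Rightarrow> nat \<Rightarrow> 'k" where
  "gl_coeffs N X p q =
     (if p < N \<and> q < N then X $$ (p, q) else if N \<le> p \<and> N \<le> q then - X $$ (q - N, p - N) else 0)"

definition states_A :: "nat \<Rightarrow> nat \<Rightarrow> nat set" where
  "states_A n m = {s. set_decode s \<subseteq> {..<n + 1} \<and> card (set_decode s) = m}"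

definition weight_A :: "nat \<Rightarrow> nat \<Rightarrow> 'k::field mat \<Rightarrow> 'k" where
  "weight_A n s H = (\<Sum>i<n + 1. of_bool (i \<in> set_decode s) * H $$ (i, i))"

lemma gl_coeffs_antisymmetric: "antisymmetric_coeffs N (gl_coeffs N X)"
  by (auto simp: antisymmetric_coeffs_def gl_coeffs_def dual_def)

lemma gl_coeffs_bracket:
  assumes X: "X \<in> carrier_mat N N" and Y: "Y \<in> carrier_mat N N" and pq: "p < 2 * N" "q < 2 * N"
  shows "gl_coeffs N (lie_bracket X Y) p q =
    (\<Sum>r<2 * N. gl_coeffs N X p r * gl_coeffs N Y r q - gl_coeffs N Y p r * gl_coeffs N X r q)"
proof -
  consider "p < N" "q < N" | "N \<le> p" "N \<le> q" | "p < N" "N \<le> q" | "N \<le> p" "q < N" by linarith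
  then show ?thesis
  proof cases
    case 1
    then show ?thesis unfolding sum_two_halves
      by (simp add: gl_coeffs_def lie_bracket_entry[OF X Y])
  next
    case 2
    then have "q - N < N" "p - N < N" using pq by auto
    then have "gl_coeffs N (lie_bracket X Y) p q =
      - (\<Sum>k<N. X $$ (q - N, k) * Y $$ (k, p - N) - Y $$ (q - N, k) * X $$ (k, p - N))"
      using 2 by (simp add: gl_coeffs_def lie_bracket_entry[OF X Y])
    also have "\<dots> = (\<Sum>k<N. X $$ (k, p - N) * Y $$ (q - N, k) - Y $$ (k, p - N) * X $$ (q - N, k))"
      unfolding sum_negf[symmetric] by (intro sum.cong) (auto simp: algebra_simps)
    finally show ?thesis unfolding sum_two_halves using 2 by (simp add: gl_coeffs_def)
  next
    case 3
    then show ?thesis unfolding sum_two_halves by (simp add: gl_coeffs_def)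
  next
    case 4
    then show ?thesis unfolding sum_two_halves by (simp add: gl_coeffs_def)
  qed
qed

text \<open>
  A block diagonal matrix pairs each creation operator with an annihilation operator, so the size of
  a state is preserved.
\<close>

lemma spin_module_A:
  "lie_module (type_A n) (supported_on (states_A n m))
     (\<lambda>X. spin (n + 1) (gl_coeffs (n + 1) (X :: 'k::field_char_0 mat)))"
proof (rule spin_module)
  let ?N = "n + 1"
  fix X Y :: "'k mat" and c :: 'k and p q
  assume X: "X \<in> lie (type_A n)" and pq: "p < 2 * ?N" "q < 2 * ?N"
  then have Xc: "X \<in> carrier_mat ?N ?N" by (simp add: type_A_simps sl_def)
  show "gl_coeffs ?N (c \<cdot>\<^sub>m X) p q = c * gl_coeffs ?N X p q"
    using Xc pq by (auto simp: gl_coeffs_def)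
  assume "Y \<in> lie (type_A n)"
  then have Yc: "Y \<in> carrier_mat ?N ?N" by (simp add: type_A_simps sl_def)
  show "gl_coeffs ?N (X + Y) p q = gl_coeffs ?N X p q + gl_coeffs ?N Y p q"
    using Xc Yc pq by (auto simp: gl_coeffs_def)
  show "gl_coeffs ?N (lie_bracket X Y) p q =
    (\<Sum>r<2 * ?N. gl_coeffs ?N X p r * gl_coeffs ?N Y r q - gl_coeffs ?N Y p r * gl_coeffs ?N X r q)"
    by (rule gl_coeffs_bracket[OF Xc Yc pq])
next
  let ?N = "n + 1"
  fix X :: "'k mat" and f :: "nat \<Rightarrow> 'k" and s p q
  assume f: "f \<in> supported_on (states_A n m)" and s: "s \<notin> states_A n m"
    and pq: "p < 2 * ?N" "q < 2 * ?N" and nz: "gl_coeffs ?N X p q \<noteq> 0"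
  have half: "q < ?N \<longleftrightarrow> p < ?N" using nz by (auto simp: gl_coeffs_def split: if_splits)
  show "clifford ?N p (clifford ?N (dual ?N q) f) s = 0"
  proof (cases "(mode ?N p \<in> set_decode s) = (p < ?N) \<and>
      (mode ?N q \<in> set_decode (flip (mode ?N p) s)) = (\<not> q < ?N)")
    case True
    then have "card (set_decode (flip (mode ?N q) (flip (mode ?N p) s))) = card (set_decode s)"
      using half by (intro card_flip_flip) auto
    then have "flip (mode ?N q) (flip (mode ?N p) s) \<notin> states_A n m"
      using s pq unfolding states_A_def by (simp add: flip_subset_iff)
    then show ?thesis using f pq by (simp add: clifford_pair_apply supported_on_def)
  next
    case False
    then show ?thesis unfolding clifford_pair_apply
      using pq dual_less_n[of q ?N] by (auto simp: clifford_coeff_def)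
  qed
qed (rule gl_coeffs_antisymmetric)

lemma gl_coeffs_elementary:
  assumes "a < N" "b < N" "p < 2 * N" "q < 2 * N"
  shows "gl_coeffs N (elementary N a b 1) p q = root_coeffs N a b p q"
  using assms by (auto simp: gl_coeffs_def root_coeffs_def dual_def)

lemma cartan_A_difference:
  assumes "i < n + 1" "j < n + 1"
  obtains H :: "'k::field mat" where "H \<in> cartan (type_A n)"
    and "\<And>g. (\<Sum>a<n + 1. g a * H $$ (a, a)) = g i - g j"
proof -
  let ?N = "n + 1"
  define H :: "'k mat" where
    "H = mat ?N ?N (\<lambda>(a, b). if a = b then of_bool (a = i) - of_bool (a = j) else 0)"
  have entry: "H $$ (a, a) = (if a = i then 1 else 0) - (if a = j then 1 else 0)" if "a < ?N" for a
    using that by (simp add: H_def)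
  have sum: "(\<Sum>a<?N. g a * H $$ (a, a)) = g i - g j" for g :: "nat \<Rightarrow> 'k"
  proof -
    have "(\<Sum>a<?N. g a * H $$ (a, a)) = (\<Sum>a<?N. (if a = i then g a else 0) - (if a = j then g a else 0))"
      by (intro sum.cong refl) (simp add: entry)
    then show ?thesis using assms by (simp add: sum_subtractf)
  qed
  have "H \<in> cartan (type_A n)"
    using sum[of "\<lambda>_. 1"] by (simp add: type_A_simps sl_def diagonal_mat_def H_def)
  with sum show ?thesis using that by blast
qed

text \<open>
  A state other than the initial segment has an element \<open>j > 0\<close> with \<open>j - 1\<close> missing, and the root vector
  of the simple root with index \<open>j - 1\<close> replaces \<open>j\<close> by \<open>j - 1\<close>.  Since \<open>X\<close> has trace zero, the
  spin weight equals the sum of the diagonal entries over the state.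
\<close>

lemma weight_basis_A:
  assumes "m \<le> n"
  shows "weight_basis (type_A n) (grading_A n :: 'k::field_char_0 mat) (states_A n m)
    (\<lambda>X. spin (n + 1) (gl_coeffs (n + 1) X)) (weight_A n) (set_encode {..<m}) (depth (n + 1))"
proof -
  let ?N = "n + 1"
  interpret graded_lie_algebra "type_A n" "grading_A n :: 'k mat" by (rule graded_A)
  show ?thesis
  proof
    show "lie_module (type_A n) (supported_on (states_A n m)) (\<lambda>X. spin (n + 1) (gl_coeffs (n + 1) (X :: 'k mat)))"
      by (rule spin_module_A)
    show "finite (states_A n m)" unfolding states_A_def by (rule finite_states)
    show "set_encode {..<m} \<in> states_A n m" using assms by (simp add: states_A_def set_encode_inverse)
  next
    fix H :: "'k mat" and f :: "nat \<Rightarrow> 'k" and s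
    assume H: "H \<in> cartan (type_A n)"
    note Hc = cartan_A_carrier[OF H]
    have tr: "(\<Sum>i<?N. H $$ (i, i)) = 0" using H by (simp add: type_A_simps sl_def)
    have "spin ?N (gl_coeffs ?N H) f s = spin_weight ?N s (\<lambda>i. gl_coeffs ?N H i i) * f s"
      using Hc by (intro spin_diagonal gl_coeffs_antisymmetric) (auto simp: gl_coeffs_def diagonal_mat_def)
    also have "spin_weight ?N s (\<lambda>i. gl_coeffs ?N H i i) =
        (\<Sum>i<?N. of_bool (i \<in> set_decode s) * H $$ (i, i) - 1 / 2 * H $$ (i, i))"
      unfolding spin_weight_def by (intro sum.cong) (auto simp: gl_coeffs_def algebra_simps)
    also have "\<dots> = weight_A n s H"
      unfolding sum_subtractf sum_distrib_left[symmetric] tr weight_A_def by simp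
    finally show "spin ?N (gl_coeffs ?N H) f s = weight_A n s H * f s" .
  next
    fix s t assume st: "s \<in> states_A n m" "t \<in> states_A n m" "s \<noteq> t"
    have fin: "finite (set_decode s)" "finite (set_decode t)" by auto
    have neq: "set_decode s \<noteq> set_decode t" using st(3) by (metis set_decode_inverse)
    have card: "card (set_decode s) = card (set_decode t)" using st by (simp add: states_A_def)
    have "\<not> set_decode s \<subseteq> set_decode t" using card_subset_eq[OF fin(2)] card neq by metis
    then obtain i where i: "i \<in> set_decode s" "i \<notin> set_decode t" by blast
    have "\<not> set_decode t \<subseteq> set_decode s" using card_subset_eq[OF fin(1)] card neq by metis
    then obtain j where j: "j \<in> set_decode t" "j \<notin> set_decode s" by blast
    have lt: "i < ?N" "j < ?N" using i j st by (auto simp: states_A_def)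
    have ij: "i \<noteq> j" using i j by auto
    obtain H :: "'k mat" where "H \<in> cartan (type_A n)"
      and sum: "\<And>g. (\<Sum>a<?N. g a * H $$ (a, a)) = g i - g j"
      using cartan_A_difference[OF lt] by blast
    moreover have "weight_A n s H = 1" "weight_A n t H = - 1"
      unfolding weight_A_def sum using i j by auto
    then have "weight_A n s H \<noteq> weight_A n t H" by simp
    ultimately show "\<exists>H\<in>cartan (type_A n). weight_A n s H \<noteq> (weight_A n t H :: 'k)" by blast
  next
    fix s assume s: "s \<in> states_A n m" "s \<noteq> set_encode {..<m}"
    have "\<exists>j. j \<in> set_decode s \<and> 0 < j \<and> j - 1 \<notin> set_decode s"
    proof (rule ccontr)
      assume "\<nexists>j. j \<in> set_decode s \<and> 0 < j \<and> j - 1 \<notin> set_decode s"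
      then have "set_decode s = {..<card (set_decode s)}" by (intro finite_no_gap) auto
      then have "set_decode s = {..<m}" using s by (simp add: states_A_def)
      then show False using s by (metis set_decode_inverse)
    qed
    then obtain j where j: "j \<in> set_decode s" "0 < j" "j - 1 \<notin> set_decode s" by blast
    have jN: "j < ?N" "j - 1 < ?N" using j s by (auto simp: states_A_def)
    let ?s' = "flip (j - 1) (flip j s)"
    have modes: "mode ?N j = j" "mode ?N (j - 1) = j - 1" using jN by (auto simp: mode_def)
    have ab: "j - 1 < 2 * ?N" "j < 2 * ?N" "j - 1 \<noteq> j" "j \<noteq> dual ?N (j - 1)"
      using jN j by (auto simp: dual_def)
    have cond: "mode ?N (j - 1) \<in> set_decode s \<longleftrightarrow> ?N \<le> j - 1" "mode ?N j \<in> set_decode s \<longleftrightarrow> j < ?N"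
      unfolding modes using j jN by auto
    have "card (set_decode ?s') = card (set_decode s)" using j by (intro card_flip_flip) auto
    then have "?s' \<in> states_A n m" using s jN by (simp add: states_A_def flip_subset_iff)
    moreover have "depth ?N ?s' < depth ?N s" using s j by (intro depth_shift) (auto simp: states_A_def)
    moreover have "elementary ?N (j - 1) j 1 \<in> lie (type_A n)"
      "elementary ?N j (j - 1) 1 \<in> lie (type_A n :: 'k based_lie_algebra)"
      using j by (auto simp: type_A_simps intro!: elementary_sl)
    moreover have "lie_bracket (grading_A n) (elementary ?N (j - 1) j 1) = 1 \<cdot>\<^sub>m (elementary ?N (j - 1) j 1 :: 'k mat)"
      using elementary_bracket[OF cartan_A_carrier[OF grading_A_cartan], of n "j - 1" j "1 :: 'k"] jN j
      by (simp add: grading_A_entry of_nat_diff)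
    moreover have "\<exists>c. c \<noteq> 0 \<and> spin ?N (gl_coeffs ?N (elementary ?N (j - 1) j 1)) (basis_vec s) =
        fun_scale c (basis_vec ?s' :: nat \<Rightarrow> 'k)"
      using spin_root_basis[OF ab cond, unfolded modes] gl_coeffs_elementary[OF jN(2,1)] by blast
    moreover have "\<exists>c. c \<noteq> 0 \<and> spin ?N (gl_coeffs ?N (elementary ?N j (j - 1) 1)) (basis_vec ?s') =
        fun_scale c (basis_vec s :: nat \<Rightarrow> 'k)"
      using spin_root_basis_back[OF ab cond, unfolded modes] gl_coeffs_elementary[OF jN] by blast
    ultimately show "\<exists>s'\<in>states_A n m. depth ?N s' < depth ?N s \<and>
      (\<exists>X\<in>lie (type_A n). lie_bracket (grading_A n :: 'k mat) X = 1 \<cdot>\<^sub>m X \<and>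
        (\<exists>c. c \<noteq> 0 \<and> spin ?N (gl_coeffs ?N X) (basis_vec s) = fun_scale c (basis_vec s'))) \<and>
      (\<exists>Y\<in>lie (type_A n :: 'k based_lie_algebra). \<exists>c. c \<noteq> 0 \<and> spin ?N (gl_coeffs ?N Y) (basis_vec s') = fun_scale c (basis_vec s))"
      by blast
  qed
qed


subsection \<open>The half-spinor module in type D\<close>

definition states_D :: "nat \<Rightarrow> nat set" where
  "states_D n = {s. set_decode s \<subseteq> {..<n} \<and> even (n + card (set_decode s))}"

definition weight_D :: "nat \<Rightarrow> nat \<Rightarrow> 'k::field mat \<Rightarrow> 'k" where
  "weight_D n s H = spin_weight n s (\<lambda>i. H $$ (i, i))"

lemma even_card_flip: "even (card (set_decode (flip i s))) \<longleftrightarrow> odd (card (set_decode s))"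
proof (cases "i \<in> set_decode s")
  case True
  then show ?thesis by (auto simp: card_set_decode_flip)
qed (simp add: card_set_decode_flip)

lemma flip_flip_states_D:
  "i < n \<Longrightarrow> j < n \<Longrightarrow> flip i (flip j s) \<in> states_D n \<longleftrightarrow> s \<in> states_D n"
  unfolding states_D_def mem_Collect_eq even_add even_card_flip flip_subset_iff by simp

lemma spin_module_D:
  "lie_module (type_D n) (supported_on (states_D n))
     (\<lambda>X. spin n (\<lambda>p q. X $$ (p, q) :: 'k::field_char_0))"
proof (rule spin_module)
  fix X Y :: "'k mat" and c :: 'k and p q
  assume X: "X \<in> lie (type_D n)"
  then show "antisymmetric_coeffs n (\<lambda>p q. X $$ (p, q))" by (simp add: type_D_simps so_even_iff)
  assume pq: "p < 2 * n" "q < 2 * n"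
  have Xc: "X \<in> carrier_mat (2 * n) (2 * n)" using X by (simp add: type_D_simps so_even_iff)
  show "(c \<cdot>\<^sub>m X) $$ (p, q) = c * X $$ (p, q)" using Xc pq by simp
  assume "Y \<in> lie (type_D n)"
  then have Yc: "Y \<in> carrier_mat (2 * n) (2 * n)" by (simp add: type_D_simps so_even_iff)
  show "(X + Y) $$ (p, q) = X $$ (p, q) + Y $$ (p, q)" using Xc Yc pq by simp
  show "lie_bracket X Y $$ (p, q) = (\<Sum>r<2 * n. X $$ (p, r) * Y $$ (r, q) - Y $$ (p, r) * X $$ (r, q))"
    by (rule lie_bracket_entry[OF Xc Yc pq])
next
  fix f :: "nat \<Rightarrow> 'k" and s p q
  assume "f \<in> supported_on (states_D n)" "s \<notin> states_D n" "p < 2 * n" "q < 2 * n"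
  then show "clifford n p (clifford n (dual n q) f) s = 0"
    by (simp add: clifford_pair_apply supported_on_def flip_flip_states_D)
qed

lemma root_vector_D_entry:
  "p < 2 * n \<Longrightarrow> q < 2 * n \<Longrightarrow> root_vector_D n a b 1 $$ (p, q) = root_coeffs n a b p q"
  by (simp add: root_vector_D_def)

lemma cartan_D_coordinate:
  assumes "i < n"
  obtains H :: "'k::field mat" where "H \<in> cartan (type_D n)"
    and "\<And>g. (\<Sum>a<n. g a * H $$ (a, a)) = g i"
proof -
  define H :: "'k mat" where "H = root_vector_D n i i 1"
  have entry: "H $$ (a, b) = root_coeffs n i i a b" if "a < 2 * n" "b < 2 * n" for a b
    using that by (simp add: H_def root_vector_D_entry)
  have Hc: "H \<in> carrier_mat (2 * n) (2 * n)" by (simp add: H_def root_vector_D_def)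
  have "H \<in> so_even n" unfolding H_def using assms by (intro root_vector_D_so) auto
  moreover have "diagonal_mat H"
    using Hc by (auto simp: diagonal_mat_def entry root_coeffs_def)
  ultimately have "H \<in> cartan (type_D n)" by (simp add: type_D_simps)
  moreover have "(\<Sum>a<n. g a * H $$ (a, a)) = g i" for g :: "nat \<Rightarrow> 'k"
  proof -
    have "(\<Sum>a<n. g a * H $$ (a, a)) = (\<Sum>a<n. if a = i then g i else 0)"
      using assms by (intro sum.cong) (auto simp: entry root_coeffs_def dual_def)
    then show ?thesis using assms by simp
  qed
  ultimately show ?thesis using that by blast
qed

text \<open>
  If no element \<open>j\<close> of a state can be replaced by \<open>j - 1\<close>, then the state is an initial segment; by
  parity, if it is not everything it misses both \<open>n - 2\<close> and \<open>n - 1\<close>, and the last simple root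
  vector inserts these two.
\<close>

lemma weight_basis_D:
  assumes "2 \<le> n"
  shows "weight_basis (type_D n) (grading_D n :: 'k::field_char_0 mat) (states_D n)
    (\<lambda>X. spin n (\<lambda>p q. X $$ (p, q))) (weight_D n) (set_encode {..<n}) (depth n)"
proof -
  interpret graded_lie_algebra "type_D n" "grading_D n :: 'k mat" by (rule graded_D[OF assms])
  show ?thesis
  proof
    show "lie_module (type_D n) (supported_on (states_D n)) (\<lambda>X. spin n (\<lambda>p q. X $$ (p, q) :: 'k))"
      by (rule spin_module_D)
    show "finite (states_D n)" unfolding states_D_def by (rule finite_states)
    show "set_encode {..<n} \<in> states_D n" by (simp add: states_D_def set_encode_inverse)
  next
    fix H :: "'k mat" and f :: "nat \<Rightarrow> 'k" and s
    assume H: "H \<in> cartan (type_D n)"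
    then have "antisymmetric_coeffs n (\<lambda>p q. H $$ (p, q))" by (simp add: type_D_simps so_even_iff)
    then show "spin n (\<lambda>p q. H $$ (p, q)) f s = weight_D n s H * f s"
      unfolding weight_D_def using cartan_D_carrier[OF H]
      by (intro spin_diagonal) (auto simp: diagonal_mat_def)
  next
    fix s t assume st: "s \<in> states_D n" "t \<in> states_D n" "s \<noteq> t"
    then obtain i where i: "(i \<in> set_decode s) \<noteq> (i \<in> set_decode t)" by (meson state_eqI)
    then have "i < n" using st by (auto simp: states_D_def)
    obtain H :: "'k mat" where "H \<in> cartan (type_D n)"
      and sum: "\<And>g. (\<Sum>a<n. g a * H $$ (a, a)) = g i"
      using cartan_D_coordinate[OF \<open>i < n\<close>] by blast
    moreover have w: "weight_D n u H = (if i \<in> set_decode u then 1 / 2 else - (1 / 2))" for u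
      unfolding weight_D_def spin_weight_def by (rule sum)
    have "(1 / 2 :: 'k) \<noteq> - (1 / 2)" by (simp add: eq_neg_iff_add_eq_0)
    then have "weight_D n s H \<noteq> weight_D n t H" using i by (auto simp: w)
    ultimately show "\<exists>H\<in>cartan (type_D n). weight_D n s H \<noteq> (weight_D n t H :: 'k)" by blast
  next
    fix s assume s: "s \<in> states_D n" "s \<noteq> set_encode {..<n}"
    have step: "\<exists>s'\<in>states_D n. depth n s' < depth n s \<and>
      (\<exists>X\<in>lie (type_D n). lie_bracket (grading_D n :: 'k mat) X = 1 \<cdot>\<^sub>m X \<and>
        (\<exists>c. c \<noteq> 0 \<and> spin n (\<lambda>p q. X $$ (p, q)) (basis_vec s) = fun_scale c (basis_vec s'))) \<and>
      (\<exists>Y\<in>lie (type_D n :: 'k based_lie_algebra). \<exists>c. c \<noteq> 0 \<and> spin n (\<lambda>p q. Y $$ (p, q)) (basis_vec s') = fun_scale c (basis_vec s))"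
      (is ?goal) if ab: "a < 2 * n" "b < 2 * n" "a \<noteq> b" "b \<noteq> dual n a"
        and cond: "mode n a \<in> set_decode s \<longleftrightarrow> n \<le> a" "mode n b \<in> set_decode s \<longleftrightarrow> b < n"
        and height: "height_D n a = height_D n b + 1"
        and depth: "depth n (flip (mode n a) (flip (mode n b) s)) < depth n s" for a b
    proof -
      let ?s' = "flip (mode n a) (flip (mode n b) s)"
      have "?s' \<in> states_D n" using s ab by (simp add: flip_flip_states_D)
      moreover have "root_vector_D n a b 1 \<in> lie (type_D n)"
        "root_vector_D n b a 1 \<in> lie (type_D n :: 'k based_lie_algebra)"
        using ab by (auto simp: type_D_simps intro: root_vector_D_so)
      moreover have "lie_bracket (grading_D n) (root_vector_D n a b 1) = 1 \<cdot>\<^sub>m (root_vector_D n a b 1 :: 'k mat)"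
        using root_vector_D_bracket[OF grading_D_cartan ab(1,2), where c = "1 :: 'k"] ab height
        by (simp add: grading_D_entry)
      moreover have "\<exists>c. c \<noteq> 0 \<and> spin n (\<lambda>p q. root_vector_D n a b 1 $$ (p, q)) (basis_vec s) =
          fun_scale c (basis_vec ?s' :: nat \<Rightarrow> 'k)"
        by (intro spin_root_basis ab cond root_vector_D_entry)
      moreover have "\<exists>c. c \<noteq> 0 \<and> spin n (\<lambda>p q. root_vector_D n b a 1 $$ (p, q)) (basis_vec ?s') =
          fun_scale c (basis_vec s :: nat \<Rightarrow> 'k)"
        by (intro spin_root_basis_back ab cond root_vector_D_entry)
      ultimately show ?thesis using depth by blast
    qed
    show ?goal
    proof (cases "\<exists>j. j \<in> set_decode s \<and> 0 < j \<and> j - 1 \<notin> set_decode s")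
      case True
      then obtain j where j: "j \<in> set_decode s" "0 < j" "j - 1 \<notin> set_decode s" by blast
      have sub: "set_decode s \<subseteq> {..<n}" using s by (simp add: states_D_def)
      have jn: "j < n" "j - 1 < n" using j sub by auto
      have modes: "mode n j = j" "mode n (j - 1) = j - 1" using jn by (auto simp: mode_def)
      show ?thesis
      proof (rule step[of "j - 1" j])
        show "depth n (flip (mode n (j - 1)) (flip (mode n j) s)) < depth n s"
          unfolding modes by (rule depth_shift[OF sub j])
        show "mode n (j - 1) \<in> set_decode s \<longleftrightarrow> n \<le> j - 1" "mode n j \<in> set_decode s \<longleftrightarrow> j < n"
          unfolding modes using j jn by auto
        show "height_D n (j - 1) = height_D n j + 1" using j jn by (simp add: height_D_def of_nat_diff)
      qed (use j jn in \<open>auto simp: dual_def\<close>)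
    next
      case False
      then have eq: "set_decode s = {..<card (set_decode s)}" by (intro finite_no_gap) auto
      let ?c = "card (set_decode s)"
      have "?c \<noteq> n" using s eq by (metis set_decode_inverse)
      moreover have "card (set_decode s) \<le> card {..<n}"
        using s by (intro card_mono) (auto simp: states_D_def)
      ultimately have "?c < n" by simp
      moreover have "even (n + ?c)" using s by (simp add: states_D_def)
      then have "n \<noteq> Suc ?c" by auto
      ultimately have "Suc ?c < n" by simp
      then have notin: "n - 2 \<notin> set_decode s" "n - 1 \<notin> set_decode s" by (subst eq, simp)+
      have modes: "mode n (n - 2) = n - 2" "mode n (2 * n - 1) = n - 1"
        using assms by (auto simp: mode_def)
      show ?thesis
      \<comment> \<open>The index \<open>2 * n - 1\<close> is dual to \<open>n - 1\<close>, so this root vector creates both \<open>n - 2\<close> and \<open>n - 1\<close>.\<close>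
      proof (rule step[of "n - 2" "2 * n - 1"])
        show "depth n (flip (mode n (n - 2)) (flip (mode n (2 * n - 1)) s)) < depth n s"
          unfolding modes using assms notin by (intro depth_insert_two) auto
        show "mode n (n - 2) \<in> set_decode s \<longleftrightarrow> n \<le> n - 2" "mode n (2 * n - 1) \<in> set_decode s \<longleftrightarrow> 2 * n - 1 < n"
          unfolding modes using assms notin by auto
        show "height_D n (n - 2) = height_D n (2 * n - 1) + 1"
          using assms by (simp add: height_D_def of_nat_diff)
      qed (use assms in \<open>auto simp: dual_def\<close>)
    qed
  qed
qed


section \<open>The highest weight of an exterior power\<close>

lemma tensor_index_nth: "xs \<in> tensor_indices N m \<Longrightarrow> a < m \<Longrightarrow> xs ! a < N"
proof -
  assume "xs \<in> tensor_indices N m" "a < m"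
  then have "set xs \<subseteq> {..<N}" "xs ! a \<in> set xs" by (simp_all add: tensor_indices_def)
  then show ?thesis by blast
qed

lemma tensor_action_diagonal:
  assumes "diagonal_mat H" "H \<in> carrier_mat N N" "xs \<in> tensor_indices N m"
  shows "tensor_action N m H f xs = (\<Sum>a<m. H $$ (xs ! a, xs ! a)) * f xs"
proof -
  have "(\<Sum>k<N. H $$ (xs ! a, k) * f (xs[a := k])) = H $$ (xs ! a, xs ! a) * f xs" if a: "a < m" for a
  proof -
    have xa: "xs ! a < N" using tensor_index_nth[OF assms(3) a] .
    have "(\<Sum>k<N. H $$ (xs ! a, k) * f (xs[a := k])) = (\<Sum>k<N. if k = xs ! a then H $$ (xs ! a, xs ! a) * f xs else 0)"
      using assms(1,2) xa by (intro sum.cong) (auto simp: diagonal_mat_def)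
    then show ?thesis using xa by simp
  qed
  then show ?thesis using assms(3) by (simp add: tensor_action_def sum_distrib_right)
qed

lemma sum_nth_initial:
  assumes "set xs = {..<m}" "distinct xs" "length xs = m"
  shows "(\<Sum>a<m. g (xs ! a)) = (\<Sum>i<m. g i :: 'k::comm_monoid_add)"
proof (rule sum.reindex_bij_betw)
  show "bij_betw ((!) xs) {..<m} {..<m}" using assms by (intro bij_betw_nth) auto
qed

definition standard_weight :: "nat \<Rightarrow> nat \<Rightarrow> 'k::field mat \<Rightarrow> 'k" where
  "standard_weight n m = (\<lambda>H\<in>cartan (type_A n). \<Sum>i<m. H $$ (i, i))"

lemma alternating_distinct:
  assumes "f \<in> exterior_power N m" "f xs \<noteq> (0 :: 'k::field)"
  shows "xs \<in> tensor_indices N m" "length xs = m" "distinct xs"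
proof -
  show xs: "xs \<in> tensor_indices N m" using assms by (auto simp: exterior_power_def)
  then show len: "length xs = m" by (simp add: tensor_indices_def)
  show "distinct xs"
    unfolding distinct_conv_nth
  proof (intro allI impI notI)
    fix a b assume "a < length xs" "b < length xs" "a \<noteq> b" "xs ! a = xs ! b"
    with assms xs len show False unfolding exterior_power_def by blast
  qed
qed

text \<open>
  Let \<open>f\<close> be a highest weight vector and \<open>f xs \<noteq> 0\<close>.  If \<open>j > 0\<close> occurs in \<open>xs\<close> but \<open>j - 1\<close> does not, then
  the matrix unit at \<open>(j - 1, j)\<close> does not kill \<open>f\<close>: its value at \<open>xs\<close> with \<open>j\<close> replaced by
  \<open>j - 1\<close> is \<open>f xs\<close>.  Hence \<open>xs\<close> is a rearrangement of \<open>0, \<dots>, m - 1\<close>, which determines the weight.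
\<close>

lemma highest_weight_unique:
  fixes \<Lambda> :: "'k::field_char_0 mat \<Rightarrow> 'k"
  assumes "is_highest_weight (type_A n) (exterior_power (n + 1) m) (tensor_action (n + 1) m) \<Lambda>"
  shows "\<Lambda> = standard_weight n m"
proof -
  let ?N = "n + 1"
  obtain f :: "nat list \<Rightarrow> 'k" where \<Lambda>: "\<Lambda> \<in> extensional (cartan (type_A n))"
    and fw: "f \<in> weight_space (type_A n) (exterior_power ?N m) (tensor_action ?N m) \<Lambda>"
    and f0: "f \<noteq> 0"
    and raise: "\<forall>\<alpha>\<in>positive_roots (type_A n). \<forall>X\<in>root_space (type_A n) \<alpha>. tensor_action ?N m X f = 0"
    using assms unfolding is_highest_weight_def by blast
  have f: "f \<in> exterior_power ?N m"
    and weight: "\<And>H. H \<in> cartan (type_A n) \<Longrightarrow> tensor_action ?N m H f = fun_scale (\<Lambda> H) f"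
    using fw by (auto simp: weight_space_def)
  obtain xs where xs: "f xs \<noteq> 0" using f0 by (auto simp: fun_eq_iff)
  note xsd = alternating_distinct[OF f xs]
  have no_gap: "j - 1 \<in> set xs" if j: "j \<in> set xs" "0 < j" for j
  proof (rule ccontr)
    assume gap: "j - 1 \<notin> set xs"
    obtain a where a: "a < m" "xs ! a = j" using j xsd by (metis in_set_conv_nth)
    have jN: "j < ?N" "j - 1 < ?N" using j xsd(1) by (auto simp: tensor_indices_def)
    let ?E = "elementary ?N (j - 1) j 1 :: 'k mat" and ?ys = "xs[a := j - 1]"
    have E: "?E \<in> lie (type_A n)" using j unfolding type_A_simps by (intro elementary_sl) auto
    have ne: "?E \<noteq> 0\<^sub>m (dim_row ?E) (dim_col ?E)"
    proof
      assume "?E = 0\<^sub>m (dim_row ?E) (dim_col ?E)"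
      then have "?E $$ (j - 1, j) = 0\<^sub>m (dim_row ?E) (dim_col ?E) $$ (j - 1, j)" by simp
      then show False using jN by simp
    qed
    have br: "lie_bracket H ?E = (H $$ (j - 1, j - 1) - H $$ (j, j)) \<cdot>\<^sub>m ?E" if "H \<in> cartan (type_A n)" for H
      by (rule elementary_bracket[OF cartan_A_carrier[OF that]])
    have nz: "grading_A n $$ (j - 1, j - 1) - grading_A n $$ (j, j) \<noteq> (0 :: 'k)"
      using jN j by (simp add: grading_A_entry of_nat_diff)
    have cone: "in_root_cone (type_A n) (\<lambda>H. H $$ (j - 1, j - 1) - H $$ (j, j) :: 'k)"
      using j jN by (intro root_cone_A) auto
    have "tensor_action ?N m ?E f = 0"
      using raise positive_root_vector[OF grading_A_cartan E ne br nz cone] by blast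
    then have zero: "tensor_action ?N m ?E f ?ys = 0" by simp
    have ys: "?ys \<in> tensor_indices ?N m"
      using xsd(1) jN set_update_subset_insert[of xs a "j - 1"] by (auto simp: tensor_indices_def)
    have yb: "?ys ! b = j - 1 \<longleftrightarrow> b = a" if "b < m" for b
    proof (cases "b = a")
      case False
      then have "?ys ! b = xs ! b" by simp
      moreover have "xs ! b \<in> set xs" using that xsd(2) by simp
      ultimately show ?thesis using gap False by metis
    qed (use a xsd(2) in simp)
    have "(\<Sum>k<?N. ?E $$ (?ys ! b, k) * f (?ys[b := k])) = (if b = a then f xs else 0)" if b: "b < m" for b
    proof -
      have "?ys ! b < ?N" by (rule tensor_index_nth[OF ys b])
      then have "(\<Sum>k<?N. ?E $$ (?ys ! b, k) * f (?ys[b := k])) = (\<Sum>k<?N. if k = j then (if b = a then f (?ys[b := j]) else 0) else 0)"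
        using yb[OF b] by (intro sum.cong) auto
      also have "\<dots> = (if b = a then f (?ys[b := j]) else 0)" using jN by simp
      also have "\<dots> = (if b = a then f xs else 0)" using a by (auto simp: list_update_id)
      finally show ?thesis .
    qed
    then have "tensor_action ?N m ?E f ?ys = (\<Sum>b<m. if b = a then f xs else 0)"
      using ys by (simp add: tensor_action_def)
    then show False using zero xs a by simp
  qed
  have "set xs = {..<card (set xs)}" using no_gap by (intro finite_no_gap) auto
  then have set: "set xs = {..<m}" using xsd by (simp add: distinct_card)
  show ?thesis
  proof
    fix H
    show "\<Lambda> H = standard_weight n m H"
    proof (cases "H \<in> cartan (type_A n)")
      case True
      have "\<Lambda> H * f xs = tensor_action ?N m H f xs" using weight[OF True] by simp
      also have "\<dots> = (\<Sum>a<m. H $$ (xs ! a, xs ! a)) * f xs"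
        by (rule tensor_action_diagonal[OF cartan_A_carrier(2,1)[OF True] xsd(1)])
      also have "(\<Sum>a<m. H $$ (xs ! a, xs ! a)) = (\<Sum>i<m. H $$ (i, i))"
        by (rule sum_nth_initial[OF set xsd(3,2)])
      finally show ?thesis using xs True by (simp add: standard_weight_def)
    next
      case False
      then show ?thesis using \<Lambda> by (simp add: standard_weight_def extensional_def)
    qed
  qed
qed

text \<open>
  The wedge product of the first \<open>m\<close> standard basis vectors: the determinant is the sign of \<open>xs\<close> as
  a permutation of \<open>0, \<dots>, m - 1\<close>, and \<open>0\<close> if \<open>xs\<close> is not one.
\<close>

definition top_form :: "nat \<Rightarrow> nat \<Rightarrow> nat list \<Rightarrow> 'k::field" where
  "top_form N m xs = (if xs \<in> tensor_indices N m
     then det (mat m m (\<lambda>(a, b). if xs ! a = b then 1 else 0)) else 0)"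

lemma top_form_alternating: "top_form N m \<in> (exterior_power N m :: (nat list \<Rightarrow> 'k::field) set)"
  unfolding exterior_power_def
proof (intro CollectI conjI allI ballI impI)
  fix xs assume "xs \<notin> tensor_indices N m"
  then show "top_form N m xs = (0 :: 'k)" by (simp add: top_form_def)
next
  fix xs a b assume xs: "xs \<in> tensor_indices N m" and ab: "a < m" "b < m" "a \<noteq> b"
  let ?M = "\<lambda>xs. mat m m (\<lambda>(a, b). if xs ! a = b then 1 else 0) :: 'k mat"
  let ?ys = "xs[a := xs ! b, b := xs ! a]"
  have len: "length xs = m" using xs by (simp add: tensor_indices_def)
  have ys: "?ys \<in> tensor_indices N m"
    using xs ab by (simp add: tensor_indices_def)
  have "?M ?ys = swaprows a b (?M xs)"
    using ab len by (intro eq_matI) (auto simp: nth_list_update)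
  then have "det (?M ?ys) = - det (?M xs)"
    using ab by (simp add: det_swaprows[of _ m])
  then show "top_form N m ?ys = - (top_form N m xs :: 'k)"
    using xs ys by (simp add: top_form_def)
  assume "xs ! a = xs ! b"
  then have "det (?M xs) = 0"
    using ab by (intro det_identical_rows[of _ m a b]) (auto intro!: eq_vecI)
  then show "top_form N m xs = (0 :: 'k)" by (simp add: top_form_def)
qed

lemma top_form_nonzero:
  assumes "top_form N m xs \<noteq> (0 :: 'k::field)"
  shows "set xs = {..<m}"
proof -
  note xs = alternating_distinct[OF top_form_alternating assms]
  let ?M = "mat m m (\<lambda>(a, b). if xs ! a = b then 1 else 0) :: 'k mat"
  have "{..<m} \<subseteq> set xs"
  proof
    fix b assume b: "b \<in> {..<m}"
    show "b \<in> set xs"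
    proof (rule ccontr)
      assume "b \<notin> set xs"
      then have nb: "xs ! a \<noteq> b" if "a < m" for a using that xs(2) nth_mem by metis
      have "det ?M = (\<Sum>i<m. ?M $$ (i, b) * cofactor ?M i b)"
        using b by (intro laplace_expansion_column[of _ m]) auto
      also have "\<dots> = 0" using b nb by (intro sum.neutral) auto
      finally show False using assms xs(1) by (simp add: top_form_def)
    qed
  qed
  then show ?thesis using xs by (intro card_subset_eq[symmetric]) (auto simp: distinct_card)
qed

text \<open>
  The grading element acts on a positive root space by a positive integer, and on the entry
  \<open>(p, q)\<close> by \<open>q - p\<close>.
\<close>

lemma positive_root_strictly_upper:
  fixes X :: "'k::field_char_0 mat"
  assumes "\<alpha> \<in> positive_roots (type_A n)" "X \<in> root_space (type_A n) \<alpha>"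
    and "p < n + 1" "q < n + 1" "X $$ (p, q) \<noteq> 0"
  shows "p < q"
proof -
  interpret graded_lie_algebra "type_A n" "grading_A n :: 'k mat" by (rule graded_A)
  obtain k where k: "0 < k" "\<alpha> (grading_A n) = of_nat k" using positive_root_H0 assms(1) by blast
  have X: "X \<in> carrier_mat (n + 1) (n + 1)" and br: "lie_bracket (grading_A n) X = of_nat k \<cdot>\<^sub>m X"
    using assms(2) k H0 by (auto simp: root_space_def type_A_simps(1) sl_def)
  have "lie_bracket (grading_A n) X $$ (p, q) = of_nat k * X $$ (p, q)"
    unfolding br using X assms(3,4) by simp
  then have "(grading_A n $$ (p, p) - grading_A n $$ (q, q)) * X $$ (p, q) = of_nat k * X $$ (p, q)"
    unfolding lie_bracket_diagonal_entry[OF cartan_A_carrier[OF H0] X assms(3,4)] .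
  then have "grading_A n $$ (p, p) - grading_A n $$ (q, q) = (of_nat k :: 'k)"
    using mult_right_cancel[OF assms(5)] by metis
  then have "(of_nat q :: 'k) = of_nat (p + k)" using assms(3,4) by (simp add: grading_A_entry algebra_simps)
  then have "q = p + k" by (simp only: of_nat_eq_iff)
  then show ?thesis using k by simp
qed

text \<open>
  If \<open>xs\<close> has distinct entries, replacing an entry \<open>p\<close> by a larger \<open>k\<close> never gives a rearrangement of
  \<open>0, \<dots>, m - 1\<close>: it would contain \<open>k\<close> and hence also the smaller \<open>p\<close>, which has just been lost.  If \<open>xs\<close> has a repeated
  entry, only the terms at its two positions survive, and they cancel by antisymmetry.
\<close>

lemma top_form_highest:
  fixes X :: "'k::field mat"
  assumes upper: "\<And>p q. p < N \<Longrightarrow> q < N \<Longrightarrow> X $$ (p, q) \<noteq> 0 \<Longrightarrow> p < q"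
  shows "tensor_action N m X (top_form N m) = 0"
proof
  fix xs
  let ?f = "top_form N m :: nat list \<Rightarrow> 'k"
  show "tensor_action N m X ?f xs = 0 xs"
  proof (cases "xs \<in> tensor_indices N m")
    case xs: True
    then have len: "length xs = m" by (simp add: tensor_indices_def)
    note xsN = tensor_index_nth[OF xs]
    have "(\<Sum>a<m. \<Sum>k<N. X $$ (xs ! a, k) * ?f (xs[a := k])) = 0"
    proof (cases "distinct xs")
      case True
      have "X $$ (xs ! a, k) * ?f (xs[a := k]) = 0" if a: "a < m" and k: "k < N" for a k
      proof (rule ccontr)
        assume "X $$ (xs ! a, k) * ?f (xs[a := k]) \<noteq> 0"
        then have nz: "X $$ (xs ! a, k) \<noteq> 0" "?f (xs[a := k]) \<noteq> 0" by auto
        have lt: "xs ! a < k" using upper xsN a k nz by blast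
        have set: "set (xs[a := k]) = {..<m}" by (rule top_form_nonzero[OF nz(2)])
        have "k \<in> set (xs[a := k])" using a len by (simp add: set_update_memI)
        then have "xs ! a \<in> set (xs[a := k])" using lt unfolding set by simp
        then obtain b where b: "b < m" "xs[a := k] ! b = xs ! a" using len by (metis in_set_conv_nth length_list_update)
        show False
        proof (cases "b = a")
          case True
          then show False using b lt a len by simp
        next
          case False
          then have "xs ! b = xs ! a" using b by simp
          then show False using False \<open>distinct xs\<close> a b len by (simp add: nth_eq_iff_index_eq)
        qed
      qed
      then show ?thesis by (intro sum.neutral ballI) auto
    next
      case False
      then obtain a b where ab: "a < m" "b < m" "a \<noteq> b" "xs ! a = xs ! b"
        unfolding distinct_conv_nth len by auto
      have other: "?f (xs[c := k]) = 0" if "c \<noteq> a" "c \<noteq> b" for c k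
      proof (rule ccontr)
        assume "?f (xs[c := k]) \<noteq> 0"
        from alternating_distinct(3)[OF top_form_alternating this]
        have "distinct (xs[c := k])" .
        moreover have "xs[c := k] ! a = xs[c := k] ! b" using ab that by simp
        ultimately show False using ab len by (simp add: nth_eq_iff_index_eq)
      qed
      have swap: "?f (xs[b := k]) = - ?f (xs[a := k])" if k: "k < N" for k
      proof -
        let ?ys = "xs[a := k]"
        have "?ys \<in> tensor_indices N m"
          using xs k set_update_subset_insert[of xs a k] by (auto simp: tensor_indices_def)
        then have "?f (?ys[a := ?ys ! b, b := ?ys ! a]) = - ?f ?ys"
          using top_form_alternating[of N m] ab unfolding exterior_power_def by blast
        moreover have "?ys[a := ?ys ! b, b := ?ys ! a] = xs[b := k]"
          using ab len by (simp add: list_update_id flip: ab(4))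
        ultimately show ?thesis by simp
      qed
      have "(\<Sum>c<m. \<Sum>k<N. X $$ (xs ! c, k) * ?f (xs[c := k])) =
          (\<Sum>c\<in>{a, b}. \<Sum>k<N. X $$ (xs ! c, k) * ?f (xs[c := k]))"
        using ab other by (intro sum.mono_neutral_right) auto
      also have "\<dots> = (\<Sum>k<N. X $$ (xs ! a, k) * ?f (xs[a := k])) + (\<Sum>k<N. X $$ (xs ! a, k) * - ?f (xs[a := k]))"
        using ab swap by simp
      also have "\<dots> = 0" by (simp add: sum_negf)
      finally show ?thesis .
    qed
    then show ?thesis using xs by (simp add: tensor_action_def)
  qed (simp add: tensor_action_def)
qed

lemma standard_weight_highest:
  assumes "m \<le> n"
  shows "is_highest_weight (type_A n) (exterior_power (n + 1) m) (tensor_action (n + 1) m)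
    (standard_weight n m :: 'k::field_char_0 mat \<Rightarrow> 'k)"
proof -
  let ?N = "n + 1" and ?f = "top_form (n + 1) m :: nat list \<Rightarrow> 'k"
  have "tensor_action ?N m H ?f = fun_scale (standard_weight n m H) ?f" if H: "H \<in> cartan (type_A n)" for H
  proof
    fix xs
    show "tensor_action ?N m H ?f xs = standard_weight n m H * ?f xs"
    proof (cases "xs \<in> tensor_indices ?N m")
      case True
      have "tensor_action ?N m H ?f xs = (\<Sum>a<m. H $$ (xs ! a, xs ! a)) * ?f xs"
        by (rule tensor_action_diagonal[OF cartan_A_carrier(2,1)[OF H] True])
      also have "\<dots> = standard_weight n m H * ?f xs"
      proof (cases "?f xs = 0")
        case False
        note xs = alternating_distinct[OF top_form_alternating False]
        show ?thesis using sum_nth_initial[OF top_form_nonzero[OF False] xs(3,2), of "\<lambda>i. H $$ (i, i)"] H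
          by (simp add: standard_weight_def)
      qed simp
      finally show ?thesis .
    qed (simp add: tensor_action_def top_form_def)
  qed
  then have "?f \<in> weight_space (type_A n) (exterior_power ?N m) (tensor_action ?N m) (standard_weight n m)"
    using top_form_alternating by (simp add: weight_space_def)
  moreover have "?f \<noteq> 0"
  proof
    assume "?f = 0"
    then have "?f [0..<m] = 0" by simp
    moreover have "mat m m (\<lambda>(a, b). if [0..<m] ! a = b then 1 else 0) = (1\<^sub>m m :: 'k mat)"
      by (intro eq_matI) auto
    moreover have "[0..<m] \<in> tensor_indices ?N m" using assms by (auto simp: tensor_indices_def)
    ultimately show False by (simp add: top_form_def)
  qed
  moreover have "tensor_action ?N m X ?f = 0"
    if "\<alpha> \<in> positive_roots (type_A n)" "X \<in> root_space (type_A n) \<alpha>" for \<alpha> X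
    using positive_root_strictly_upper[OF that] by (rule top_form_highest)
  moreover have "standard_weight n m \<in> extensional (cartan (type_A n))"
    by (simp add: standard_weight_def)
  ultimately show ?thesis unfolding is_highest_weight_def by blast
qed

lemma fund_weight_A_eq:
  assumes "m \<le> n"
  shows "fund_weight_A n m = (standard_weight n m :: 'k::field_char_0 mat \<Rightarrow> 'k)"
  unfolding fund_weight_A_def
  using standard_weight_highest[OF assms] highest_weight_unique by (rule the_equality)


section \<open>Counting the edges\<close>

text \<open>
  Deleting a fixed element \<open>a\<close> is a bijection to all subsets of \<open>A - {a}\<close>, since parity decides
  whether \<open>a\<close> was present.
\<close>

lemma even_shifted_subsets_card:
  assumes "finite A" "A \<noteq> {}"
  shows "card {T. T \<subseteq> A \<and> even (k + card T)} = 2 ^ (card A - 1)"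
proof -
  obtain a where a: "a \<in> A" using assms by blast
  let ?g = "\<lambda>U. if even (k + card U) then U else insert a U"
  have "bij_betw (\<lambda>T. T - {a}) {T. T \<subseteq> A \<and> even (k + card T)} (Pow (A - {a}))"
  proof (rule bij_betw_byWitness[of _ ?g])
    show "\<forall>T\<in>{T. T \<subseteq> A \<and> even (k + card T)}. ?g (T - {a}) = T"
    proof
      fix T assume T: "T \<in> {T. T \<subseteq> A \<and> even (k + card T)}"
      then have "finite T" using assms finite_subset by blast
      show "?g (T - {a}) = T"
      proof (cases "a \<in> T")
        case True
        have "card T = Suc (card (T - {a}))" by (rule card.remove[OF \<open>finite T\<close> True])
        then show ?thesis using T True by (simp add: insert_absorb)
      qed (use T in simp)
    qed
    show "\<forall>U\<in>Pow (A - {a}). ?g U - {a} = U" by auto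
    show "(\<lambda>T. T - {a}) ` {T. T \<subseteq> A \<and> even (k + card T)} \<subseteq> Pow (A - {a})" by auto
    show "?g ` Pow (A - {a}) \<subseteq> {T. T \<subseteq> A \<and> even (k + card T)}"
    proof
      fix T assume "T \<in> ?g ` Pow (A - {a})"
      then obtain U where U: "U \<subseteq> A - {a}" "T = ?g U" by blast
      have "finite U" using U(1) assms finite_subset by blast
      moreover have "a \<notin> U" using U by blast
      ultimately show "T \<in> {T. T \<subseteq> A \<and> even (k + card T)}" using U a by auto
    qed
  qed
  then have "card {T. T \<subseteq> A \<and> even (k + card T)} = card (Pow (A - {a}))" by (rule bij_betw_same_card)
  then show ?thesis using assms a by (simp add: card_Pow)
qed

text \<open>
  States that contain \<open>B\<close> and avoid \<open>C\<close> are determined by their part in \<open>A - B - C\<close>.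
\<close>

lemma card_constrained_states:
  assumes "finite A" "B \<subseteq> A" "C \<subseteq> A" "B \<inter> C = {}"
  shows "card {s. set_decode s \<subseteq> A \<and> P (card (set_decode s)) \<and> B \<subseteq> set_decode s \<and> C \<inter> set_decode s = {}} =
    card {T. T \<subseteq> A - B - C \<and> P (card T + card B)}"
    (is "card ?X = card ?Y")
proof (rule bij_betw_same_card[of "\<lambda>s. set_decode s - B"], rule bij_betw_byWitness[of _ "\<lambda>T. set_encode (T \<union> B)"])
  have fin: "finite (T \<union> B)" if "T \<subseteq> A" for T
    using assms that finite_subset by (metis finite_Un)
  have card: "card (T \<union> B) = card T + card B" if "T \<subseteq> A - B" for T
    using assms that by (intro card_Un_disjoint) (auto intro: finite_subset)
  show "\<forall>s\<in>?X.
      set_encode (set_decode s - B \<union> B) = s"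
  proof
    fix s assume s: "s \<in> ?X"
    then have "set_decode s - B \<union> B = set_decode s" by blast
    then show "set_encode (set_decode s - B \<union> B) = s" by simp
  qed
  show "\<forall>T\<in>?Y. set_decode (set_encode (T \<union> B)) - B = T"
  proof
    fix T assume T: "T \<in> ?Y"
    then have "set_decode (set_encode (T \<union> B)) = T \<union> B" by (intro set_encode_inverse fin) blast
    then show "set_decode (set_encode (T \<union> B)) - B = T" using T by blast
  qed
  show "(\<lambda>s. set_decode s - B) ` ?X
      \<subseteq> ?Y"
  proof (rule image_subsetI)
    fix s assume s: "s \<in> ?X"
    have "card (set_decode s - B \<union> B) = card (set_decode s - B) + card B" using s by (intro card) blast
    moreover have "set_decode s - B \<union> B = set_decode s" using s by blast
    ultimately show "set_decode s - B \<in> ?Y" using s by auto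
  qed
  show "(\<lambda>T. set_encode (T \<union> B)) ` ?Y
      \<subseteq> ?X"
  proof (rule image_subsetI)
    fix T assume T: "T \<in> ?Y"
    then have "set_decode (set_encode (T \<union> B)) = T \<union> B" by (intro set_encode_inverse fin) blast
    moreover have "card (T \<union> B) = card T + card B" using T by (intro card) blast
    ultimately show "set_encode (T \<union> B) \<in> ?X"
      using T assms by auto
  qed
qed

definition shift_pairs :: "nat set \<Rightarrow> nat \<Rightarrow> (nat \<times> nat) set" where
  "shift_pairs S i = {(s, t). s \<in> S \<and> i \<in> set_decode s \<and> i + 1 \<notin> set_decode s \<and> t = flip (i + 1) (flip i s)}"

lemma card_graph: "card {(s, t). Q s \<and> t = h s} = card {s. Q s}"
proof -
  have "{(s, t). Q s \<and> t = h s} = (\<lambda>s. (s, h s)) ` {s. Q s}" by auto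
  then show ?thesis by (simp add: card_image inj_on_def)
qed

lemma card_shift_pairs: "card (shift_pairs S i) = card {s. s \<in> S \<and> i \<in> set_decode s \<and> i + 1 \<notin> set_decode s}"
  unfolding shift_pairs_def
  using card_graph[of "\<lambda>s. s \<in> S \<and> i \<in> set_decode s \<and> i + 1 \<notin> set_decode s" "\<lambda>s. flip (i + 1) (flip i s)"]
  by (simp add: conj_assoc)

lemma finite_shift_pairs: "finite S \<Longrightarrow> finite (shift_pairs S i)"
proof -
  assume "finite S"
  then have "finite ((\<lambda>s. (s, flip (i + 1) (flip i s))) ` S)" by simp
  then show ?thesis by (rule rev_finite_subset) (auto simp: shift_pairs_def)
qed

lemma shift_pairs_disjoint: "i \<noteq> j \<Longrightarrow> shift_pairs S i \<inter> shift_pairs S j = {}"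
proof -
  have moved: "set_decode s - set_decode t = {i}" if "(s, t) \<in> shift_pairs S i" for s t i
    using that by (auto simp: shift_pairs_def)
  assume "i \<noteq> j"
  have "(s, t) \<notin> shift_pairs S i \<inter> shift_pairs S j" for s t
    using moved[of s t i] moved[of s t j] \<open>i \<noteq> j\<close> by auto
  then show ?thesis by auto
qed

lemma shift_iff:
  assumes "set_decode s \<subseteq> {..<N}" "set_decode t \<subseteq> {..<N}" "i + 1 < N"
  shows "(\<forall>a<N. of_bool (a \<in> set_decode s) - of_bool (a \<in> set_decode t) = (of_bool (a = i) - of_bool (a = i + 1) :: int))
    \<longleftrightarrow> i \<in> set_decode s \<and> i + 1 \<notin> set_decode s \<and> t = flip (i + 1) (flip i s)" (is "?L \<longleftrightarrow> ?R")
proof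
  assume L: ?L
  have "i \<in> set_decode s \<and> i \<notin> set_decode t"
    using L[rule_format, of i] assms by (cases "i \<in> set_decode s"; cases "i \<in> set_decode t") auto
  moreover have "i + 1 \<notin> set_decode s \<and> i + 1 \<in> set_decode t"
    using L[rule_format, of "i + 1"] assms by (cases "i + 1 \<in> set_decode s"; cases "i + 1 \<in> set_decode t") auto
  moreover have "a \<in> set_decode s \<longleftrightarrow> a \<in> set_decode t" if "a \<noteq> i" "a \<noteq> i + 1" for a
  proof (cases "a < N")
    case True
    then show ?thesis using L[rule_format, of a] that
      by (cases "a \<in> set_decode s"; cases "a \<in> set_decode t") auto
  next
    case False
    then show ?thesis using assms by auto
  qed
  ultimately have "t = flip (i + 1) (flip i s)" by (intro state_eqI) auto
  then show ?R using \<open>i \<in> set_decode s \<and> _\<close> \<open>i + 1 \<notin> set_decode s \<and> _\<close> by blast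
qed auto

lemma remove_two_iff:
  assumes "set_decode s \<subseteq> {..<N}" "set_decode t \<subseteq> {..<N}" "i < N" "j < N" "i \<noteq> j"
  shows "(\<forall>a<N. of_bool (a \<in> set_decode s) - of_bool (a \<in> set_decode t) = (of_bool (a = i) + of_bool (a = j) :: int))
    \<longleftrightarrow> i \<in> set_decode s \<and> j \<in> set_decode s \<and> t = flip j (flip i s)" (is "?L \<longleftrightarrow> ?R")
proof
  assume L: ?L
  have "i \<in> set_decode s \<and> i \<notin> set_decode t"
    using L[rule_format, of i] assms by (cases "i \<in> set_decode s"; cases "i \<in> set_decode t") auto
  moreover have "j \<in> set_decode s \<and> j \<notin> set_decode t"
    using L[rule_format, of j] assms by (cases "j \<in> set_decode s"; cases "j \<in> set_decode t") auto
  moreover have "a \<in> set_decode s \<longleftrightarrow> a \<in> set_decode t" if "a \<noteq> i" "a \<noteq> j" for a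
  proof (cases "a < N")
    case True
    then show ?thesis using L[rule_format, of a] that
      by (cases "a \<in> set_decode s"; cases "a \<in> set_decode t") auto
  next
    case False
    then show ?thesis using assms by auto
  qed
  ultimately have "t = flip j (flip i s)" using assms(5) by (intro state_eqI) auto
  then show ?R using \<open>i \<in> set_decode s \<and> _\<close> \<open>j \<in> set_decode s \<and> _\<close> by blast
qed (use assms in auto)

lemma restrict_eq_iff: "(\<lambda>x\<in>A. f x) = (\<lambda>x\<in>A. g x) \<longleftrightarrow> (\<forall>x\<in>A. f x = g x)"
  by (metis restrict_apply' restrict_ext)

lemma sum_indicator_entry:
  fixes i N :: nat
  assumes "i < N"
  shows "(\<Sum>a<N. of_bool (a = i) * g a) = (g i :: 'k::comm_ring_1)"
proof -
  have "(\<Sum>a<N. of_bool (a = i) * g a) = (\<Sum>a<N. if a = i then g a else 0)"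
    by (intro sum.cong) auto
  also have "\<dots> = g i" using assms by simp
  finally show ?thesis .
qed

lemma sum_of_bool_mem:
  assumes "finite A"
  shows "(\<Sum>a\<in>A. of_bool (a \<in> S)) = int (card (A \<inter> S))"
proof -
  have "(\<Sum>a\<in>A. of_bool (a \<in> S)) = (\<Sum>a\<in>A. if a \<in> S then 1 else (0 :: int))"
    by (intro sum.cong) auto
  also have "\<dots> = (\<Sum>a\<in>A \<inter> S. 1)" using assms by (simp only: sum.inter_restrict)
  finally show ?thesis by simp
qed


subsection \<open>Type A\<close>

text \<open>
  On traceless diagonal matrices a combination of coordinates vanishes if and only if its coefficients
  are constant.  The constant is zero here because both states have \<open>m\<close> elements, so that the
  coefficients sum to zero; the weights then agree coordinate by coordinate.
\<close>

lemma weight_A_difference_iff: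
  assumes s: "s \<in> states_A n m" and t: "t \<in> states_A n m" and i: "i < n"
  shows "(\<forall>H\<in>cartan (type_A n). weight_A n s H - weight_A n t H = (H $$ (i, i) - H $$ (i + 1, i + 1) :: 'k::field_char_0))
    \<longleftrightarrow> i \<in> set_decode s \<and> i + 1 \<notin> set_decode s \<and> t = flip (i + 1) (flip i s)"
proof -
  let ?N = "n + 1"
  define g :: "nat \<Rightarrow> int" where
    "g a = of_bool (a \<in> set_decode s) - of_bool (a \<in> set_decode t) - (of_bool (a = i) - of_bool (a = i + 1))" for a
  have sub: "set_decode s \<subseteq> {..<?N}" "set_decode t \<subseteq> {..<?N}" using s t by (auto simp: states_A_def)
  have expand: "weight_A n s H - weight_A n t H - (H $$ (i, i) - H $$ (i + 1, i + 1)) =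
      (\<Sum>a<?N. of_int (g a) * H $$ (a, a))" for H :: "'k mat"
  proof -
    have "(\<Sum>a<?N. of_int (g a) * H $$ (a, a)) = (\<Sum>a<?N. of_bool (a \<in> set_decode s) * H $$ (a, a))
      - (\<Sum>a<?N. of_bool (a \<in> set_decode t) * H $$ (a, a))
      - ((\<Sum>a<?N. of_bool (a = i) * H $$ (a, a)) - (\<Sum>a<?N. of_bool (a = i + 1) * H $$ (a, a)))"
      unfolding sum_subtractf[symmetric] by (intro sum.cong refl) (simp add: g_def algebra_simps)
    moreover have "(\<Sum>a<?N. of_bool (a = i) * H $$ (a, a)) = H $$ (i, i)"
      using i by (intro sum_indicator_entry) simp
    moreover have "(\<Sum>a<?N. of_bool (a = i + 1) * H $$ (a, a)) = H $$ (i + 1, i + 1)"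
      using i by (intro sum_indicator_entry) simp
    ultimately show ?thesis by (simp only: weight_A_def)
  qed
  have card: "(\<Sum>a<?N. of_bool (a \<in> set_decode u)) = (int m)" if "u \<in> states_A n m" for u
  proof -
    have "(\<Sum>a<?N. of_bool (a \<in> set_decode u)) = int (card ({..<?N} \<inter> set_decode u))"
      by (intro sum_of_bool_mem) simp
    also have "{..<?N} \<inter> set_decode u = set_decode u" using that by (auto simp: states_A_def)
    finally show ?thesis using that by (simp add: states_A_def)
  qed
  have total: "(\<Sum>a<?N. g a) = 0"
  proof -
    have "(\<Sum>a<?N. of_bool (a = i)) = (1 :: int)" "(\<Sum>a<?N. of_bool (a = i + 1)) = (1 :: int)"
      using sum_indicator_entry[of i ?N "\<lambda>_. 1 :: int"] sum_indicator_entry[of "i + 1" ?N "\<lambda>_. 1 :: int"] i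
      by simp_all
    then show ?thesis unfolding g_def sum_subtractf card[OF s] card[OF t] by simp
  qed
  have "(\<forall>H\<in>cartan (type_A n). weight_A n s H - weight_A n t H = (H $$ (i, i) - H $$ (i + 1, i + 1) :: 'k)) \<longleftrightarrow>
      (\<forall>H\<in>cartan (type_A n). (\<Sum>a<?N. of_int (g a) * H $$ (a, a)) = (0 :: 'k))"
    unfolding expand[symmetric] by simp
  also have "\<dots> \<longleftrightarrow> (\<forall>a<?N. g a = 0)"
  proof
    assume zero: "\<forall>H\<in>cartan (type_A n). (\<Sum>a<?N. of_int (g a) * H $$ (a, a)) = (0 :: 'k)"
    have const: "g a = g 0" if "a < ?N" for a
    proof -
      obtain H :: "'k mat" where H: "H \<in> cartan (type_A n)"
        "\<And>h. (\<Sum>a<?N. h a * H $$ (a, a)) = h a - h 0"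
        using cartan_A_difference[of a n 0] \<open>a < ?N\<close> by auto
      then have "(of_int (g a) :: 'k) - of_int (g 0) = 0"
        using zero H(2)[of "\<lambda>a. of_int (g a)"] by simp
      then show ?thesis by simp
    qed
    have "(\<Sum>a<?N. g a) = (\<Sum>a<?N. g 0)" by (intro sum.cong refl const) simp
    then have zero: "g 0 = 0" using total by simp
    show "\<forall>a<?N. g a = 0" unfolding zero[symmetric] by (intro allI impI const)
  qed simp
  also have "\<dots> \<longleftrightarrow> i \<in> set_decode s \<and> i + 1 \<notin> set_decode s \<and> t = flip (i + 1) (flip i s)"
    using shift_iff[OF sub, of i] i by (simp add: g_def)
  finally show ?thesis .
qed

text \<open>
  For each \<open>i < n\<close> the edges for the \<open>i\<close>-th simple root start at the states that contain \<open>i\<close> and not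
  \<open>i + 1\<close>; the other \<open>m - 1\<close> elements are arbitrary among the remaining \<open>n - 1\<close>.
\<close>

lemma edges_A:
  assumes "1 \<le> m" "m \<le> n"
  shows "card (hasse_edges (type_A n :: 'k::field_char_0 based_lie_algebra) (fund_weight_A n m)) = n * ((n - 1) choose (m - 1))"
proof -
  let ?L = "type_A n :: 'k based_lie_algebra" and ?S = "states_A n m"
  have decode: "set_decode (set_encode {..<m}) = {..<m}" by (simp add: set_encode_inverse)
  have "weight_A n (set_encode {..<m}) H = (\<Sum>i<m. H $$ (i, i))" for H :: "'k mat"
  proof -
    have "weight_A n (set_encode {..<m}) H = (\<Sum>i<n + 1. if i \<in> {..<m} then H $$ (i, i) else 0)"
      unfolding weight_A_def decode by (intro sum.cong) auto
    also have "\<dots> = (\<Sum>i\<in>{..<n + 1} \<inter> {..<m}. H $$ (i, i))" by (simp only: sum.inter_restrict finite_lessThan)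
    also have "{..<n + 1} \<inter> {..<m} = {..<m}" using assms by auto
    finally show ?thesis .
  qed
  then have fund: "fund_weight_A n m = (\<lambda>H\<in>cartan ?L. weight_A n (set_encode {..<m}) H)"
    unfolding fund_weight_A_eq[OF assms(2)] standard_weight_def by simp
  have "{(s, t). s \<in> ?S \<and> t \<in> ?S \<and> (\<lambda>H\<in>cartan ?L. weight_A n s H - weight_A n t H) \<in> simple_roots ?L} =
      (\<Union>i<n. shift_pairs ?S i)" (is "?E = ?U")
  proof (unfold set_eq_iff split_paired_All, intro allI)
    fix s t
    have "t \<in> ?S" if "s \<in> ?S" "i < n" "i \<in> set_decode s" "i + 1 \<notin> set_decode s" "t = flip (i + 1) (flip i s)" for i
    proof -
      have "card (set_decode t) = card (set_decode s)" unfolding that(5) using that by (intro card_flip_flip) auto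
      moreover have "set_decode t \<subseteq> {..<n + 1}" using that by (auto simp: states_A_def)
      ultimately show ?thesis using that(1) by (simp add: states_A_def)
    qed
    moreover have "(\<lambda>H\<in>cartan ?L. weight_A n s H - weight_A n t H) \<in> simple_roots ?L \<longleftrightarrow>
      (\<exists>i<n. i \<in> set_decode s \<and> i + 1 \<notin> set_decode s \<and> t = flip (i + 1) (flip i s))"
      if st: "s \<in> ?S" "t \<in> ?S"
      unfolding type_A_simps(3) mem_Collect_eq restrict_eq_iff
      using weight_A_difference_iff[OF st, where 'k = 'k] by blast
    ultimately show "(s, t) \<in> ?E \<longleftrightarrow> (s, t) \<in> ?U"
      unfolding shift_pairs_def by blast
  qed
  then have "card (hasse_edges ?L (fund_weight_A n m)) = card (\<Union>i<n. shift_pairs ?S i)"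
    unfolding fund weight_basis_edges[OF weight_basis_A[OF assms(2)]] by simp
  also have "\<dots> = (\<Sum>i<n. card (shift_pairs ?S i))"
    using finite_shift_pairs[of ?S] shift_pairs_disjoint
    by (intro card_UN_disjoint) (auto simp: states_A_def finite_states)
  also have "\<dots> = (\<Sum>i<n. (n - 1) choose (m - 1))"
  proof (rule sum.cong[OF refl])
    fix i assume "i \<in> {..<n}"
    then have i: "i < n" by simp
    let ?A = "{..<n + 1} - {i} - {i + 1}"
    have "card (shift_pairs ?S i) = card {s. set_decode s \<subseteq> {..<n + 1} \<and> card (set_decode s) = m \<and> {i} \<subseteq> set_decode s \<and> {i + 1} \<inter> set_decode s = {}}"
      unfolding card_shift_pairs by (rule arg_cong[where f = card]) (auto simp: states_A_def)
    also have "\<dots> = card {T. T \<subseteq> ?A \<and> card T + card {i} = m}"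
      using i by (intro card_constrained_states) auto
    also have "\<dots> = card {T. T \<subseteq> ?A \<and> card T = m - 1}"
      using assms by (intro arg_cong[where f = card]) auto
    also have "\<dots> = card ?A choose (m - 1)" by (rule n_subsets) simp
    also have "card ?A = n - 1" using i by (simp add: card_Diff_singleton)
    finally show "card (shift_pairs ?S i) = (n - 1) choose (m - 1)" .
  qed
  finally show ?thesis by simp
qed


subsection \<open>Type D\<close>

lemma weight_D_difference_iff:
  fixes r :: "nat \<Rightarrow> int"
  shows "(\<forall>H\<in>cartan (type_D n). weight_D n s H - weight_D n t H = (\<Sum>a<n. of_int (r a) * H $$ (a, a) :: 'k::field_char_0))
    \<longleftrightarrow> (\<forall>a<n. of_bool (a \<in> set_decode s) - of_bool (a \<in> set_decode t) = r a)"
proof -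
  define g :: "nat \<Rightarrow> int" where "g a = of_bool (a \<in> set_decode s) - of_bool (a \<in> set_decode t)" for a
  have expand: "weight_D n s H - weight_D n t H = (\<Sum>a<n. of_int (g a) * H $$ (a, a))" for H :: "'k mat"
    unfolding weight_D_def spin_weight_def sum_subtractf[symmetric]
    by (intro sum.cong refl) (simp add: g_def algebra_simps)
  show ?thesis unfolding expand g_def[symmetric]
  proof
    assume *: "\<forall>H\<in>cartan (type_D n). (\<Sum>a<n. of_int (g a) * H $$ (a, a)) = (\<Sum>a<n. of_int (r a) * H $$ (a, a) :: 'k)"
    show "\<forall>a<n. g a = r a"
    proof (intro allI impI)
      fix a assume "a < n"
      then obtain H :: "'k mat" where H: "H \<in> cartan (type_D n)" "\<And>h. (\<Sum>a<n. h a * H $$ (a, a)) = h a"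
        using cartan_D_coordinate[of a n] by blast
      have "(of_int (g a) :: 'k) = of_int (r a)"
        using *[rule_format, OF H(1)] unfolding H(2) .
      then show "g a = r a" by simp
    qed
  qed simp
qed

lemma simple_root_D_expand:
  fixes H :: "'k::field_char_0 mat"
  assumes "i < n" "j < n"
  shows "H $$ (i, i) - H $$ (j, j) = (\<Sum>a<n. of_int (of_bool (a = i) - of_bool (a = j)) * H $$ (a, a))"
    and "H $$ (i, i) + H $$ (j, j) = (\<Sum>a<n. of_int (of_bool (a = i) + of_bool (a = j)) * H $$ (a, a))"
proof -
  have *: "of_int (of_bool (a = i) - of_bool (a = j)) * H $$ (a, a) = of_bool (a = i) * H $$ (a, a) - of_bool (a = j) * H $$ (a, a)"
    "of_int (of_bool (a = i) + of_bool (a = j)) * H $$ (a, a) = of_bool (a = i) * H $$ (a, a) + of_bool (a = j) * H $$ (a, a)" for a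
    by (simp_all add: algebra_simps)
  show "H $$ (i, i) - H $$ (j, j) = (\<Sum>a<n. of_int (of_bool (a = i) - of_bool (a = j)) * H $$ (a, a))"
    "H $$ (i, i) + H $$ (j, j) = (\<Sum>a<n. of_int (of_bool (a = i) + of_bool (a = j)) * H $$ (a, a))"
    unfolding * sum_subtractf sum.distrib using assms by (simp_all add: sum_indicator_entry)
qed

text \<open>
  Each of the \<open>n\<close> simple roots prescribes two indices of the upper state, both present or one present
  and one absent; half of the \<open>2\<^sup>n\<^sup>-\<^sup>2\<close> choices for the others have the right parity.
\<close>

lemma edges_D:
  assumes "4 \<le> n"
  shows "card (hasse_edges (type_D n :: 'k::field_char_0 based_lie_algebra) (half_spin_weight n)) = n * 2 ^ (n - 3)"
proof -
  let ?L = "type_D n :: 'k based_lie_algebra" and ?S = "states_D n"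
  have n2: "2 \<le> n" using assms by simp
  have top: "weight_D n (set_encode {..<n}) H = (1 / 2) * (\<Sum>i<n. H $$ (i, i))" for H :: "'k mat"
    unfolding weight_D_def spin_weight_def sum_distrib_left
    by (intro sum.cong) (auto simp: set_encode_inverse)
  have fund: "half_spin_weight n = (\<lambda>H\<in>cartan ?L. weight_D n (set_encode {..<n}) H)"
    unfolding half_spin_weight_def top ..
  define last where "last = {(s, t). s \<in> ?S \<and> n - 2 \<in> set_decode s \<and> n - 1 \<in> set_decode s \<and> t = flip (n - 1) (flip (n - 2) s)}"
  have sub: "set_decode s \<subseteq> {..<n}" if "s \<in> ?S" for s using that by (simp add: states_D_def)
  have shift: "(\<lambda>H\<in>cartan ?L. weight_D n s H - weight_D n t H) = (\<lambda>H\<in>cartan ?L. H $$ (i, i) - H $$ (i + 1, i + 1))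
      \<longleftrightarrow> i \<in> set_decode s \<and> i + 1 \<notin> set_decode s \<and> t = flip (i + 1) (flip i s)"
    if "s \<in> ?S" "t \<in> ?S" "i < n - 1" for s t i
  proof -
    have "i < n" "i + 1 < n" using that(3) by auto
    then show ?thesis
      unfolding restrict_eq_iff simple_root_D_expand(1)[OF \<open>i < n\<close> \<open>i + 1 < n\<close>] weight_D_difference_iff
      by (intro shift_iff sub that)
  qed
  have two: "(\<lambda>H\<in>cartan ?L. weight_D n s H - weight_D n t H) = (\<lambda>H\<in>cartan ?L. H $$ (n - 2, n - 2) + H $$ (n - 1, n - 1))
      \<longleftrightarrow> n - 2 \<in> set_decode s \<and> n - 1 \<in> set_decode s \<and> t = flip (n - 1) (flip (n - 2) s)"
    if "s \<in> ?S" "t \<in> ?S" for s t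
  proof -
    have "n - 2 < n" "n - 1 < n" "n - 2 \<noteq> n - 1" using assms by auto
    then show ?thesis
      unfolding restrict_eq_iff simple_root_D_expand(2)[OF \<open>n - 2 < n\<close> \<open>n - 1 < n\<close>] weight_D_difference_iff
      by (intro remove_two_iff sub that)
  qed
  have closed: "flip j (flip i s) \<in> ?S" if "s \<in> ?S" "i < n" "j < n" for i j s
    using that by (simp add: flip_flip_states_D)
  have "{(s, t). s \<in> ?S \<and> t \<in> ?S \<and> (\<lambda>H\<in>cartan ?L. weight_D n s H - weight_D n t H) \<in> simple_roots ?L} =
      (\<Union>i<n - 1. shift_pairs ?S i) \<union> last" (is "?E = ?U")
  proof (unfold set_eq_iff split_paired_All, intro allI)
    fix s t
    have "(\<lambda>H\<in>cartan ?L. weight_D n s H - weight_D n t H) \<in> simple_roots ?L \<longleftrightarrow>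
      (\<exists>i<n - 1. i \<in> set_decode s \<and> i + 1 \<notin> set_decode s \<and> t = flip (i + 1) (flip i s)) \<or>
      n - 2 \<in> set_decode s \<and> n - 1 \<in> set_decode s \<and> t = flip (n - 1) (flip (n - 2) s)"
      if st: "s \<in> ?S" "t \<in> ?S"
      unfolding type_D_simps(3) Un_iff mem_Collect_eq singleton_iff two[OF st]
      using shift[OF st] by blast
    moreover have "t \<in> ?S" if "s \<in> ?S" "i < n - 1" "t = flip (i + 1) (flip i s)" for i
      unfolding that(3) using that(1,2) by (intro closed) auto
    moreover have "t \<in> ?S" if "s \<in> ?S" "t = flip (n - 1) (flip (n - 2) s)"
      unfolding that(2) using that(1) assms by (intro closed) auto
    ultimately show "(s, t) \<in> ?E \<longleftrightarrow> (s, t) \<in> ?U"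
      unfolding last_def shift_pairs_def by blast
  qed
  then have "card (hasse_edges ?L (half_spin_weight n)) = card ((\<Union>i<n - 1. shift_pairs ?S i) \<union> last)"
    unfolding fund weight_basis_edges[OF weight_basis_D[OF n2]] by simp
  also have "\<dots> = card (\<Union>i<n - 1. shift_pairs ?S i) + card last"
  proof (rule card_Un_disjoint)
    have fin: "finite ?S" unfolding states_D_def by (rule finite_states)
    then show "finite (\<Union>i<n - 1. shift_pairs ?S i)" using finite_shift_pairs by auto
    have "finite ((\<lambda>s. (s, flip (n - 1) (flip (n - 2) s))) ` ?S)" using fin by simp
    then show "finite last" by (rule rev_finite_subset) (auto simp: last_def)
    have "set_decode t \<subseteq> set_decode s" if "(s, t) \<in> last" for s t
      using that assms by (auto simp: last_def)
    moreover have "\<not> set_decode t \<subseteq> set_decode s" if "(s, t) \<in> shift_pairs ?S i" for s t i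
    proof -
      have "i + 1 \<in> set_decode t" "i + 1 \<notin> set_decode s" using that by (auto simp: shift_pairs_def)
      then show ?thesis by blast
    qed
    ultimately show "(\<Union>i<n - 1. shift_pairs ?S i) \<inter> last = {}" by fast
  qed
  also have "card (\<Union>i<n - 1. shift_pairs ?S i) = (\<Sum>i<n - 1. card (shift_pairs ?S i))"
    using finite_shift_pairs[of ?S] shift_pairs_disjoint
    by (intro card_UN_disjoint) (auto simp: states_D_def finite_states)
  also have "\<dots> = (\<Sum>i<n - 1. 2 ^ (n - 3))"
  proof (rule sum.cong[OF refl])
    fix i assume "i \<in> {..<n - 1}"
    then have i: "i < n" "i + 1 < n" by auto
    let ?A = "{..<n} - {i} - {i + 1}"
    have cA: "card ?A = n - 2" using i by (simp add: card_Diff_singleton)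
    have "card (shift_pairs ?S i) = card {s. set_decode s \<subseteq> {..<n} \<and> even (n + card (set_decode s)) \<and> {i} \<subseteq> set_decode s \<and> {i + 1} \<inter> set_decode s = {}}"
      unfolding card_shift_pairs by (rule arg_cong[where f = card]) (auto simp: states_D_def)
    also have "\<dots> = card {T. T \<subseteq> ?A \<and> even (n + (card T + card {i}))}"
      using i by (intro card_constrained_states) auto
    also have "\<dots> = card {T. T \<subseteq> ?A \<and> even ((n + 1) + card T)}"
      by (simp add: ac_simps)
    also have "\<dots> = 2 ^ (card ?A - 1)"
    proof (rule even_shifted_subsets_card)
      have "0 < card ?A" using cA assms by simp
      then show "?A \<noteq> {}" by (metis card.empty less_irrefl)
    qed simp
    finally show "card (shift_pairs ?S i) = 2 ^ (n - 3)" using cA by simp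
  qed
  also have "card last = 2 ^ (n - 3)"
  proof -
    let ?A = "{..<n} - {n - 2, n - 1} - {}"
    have cA: "card ?A = n - 2" using assms by (simp add: card_Diff_subset)
    have "card last = card {s. s \<in> ?S \<and> n - 2 \<in> set_decode s \<and> n - 1 \<in> set_decode s}"
      unfolding last_def
      using card_graph[of "\<lambda>s. s \<in> ?S \<and> n - 2 \<in> set_decode s \<and> n - 1 \<in> set_decode s" "\<lambda>s. flip (n - 1) (flip (n - 2) s)"]
      by (simp add: conj_assoc)
    also have "\<dots> = card {s. set_decode s \<subseteq> {..<n} \<and> even (n + card (set_decode s)) \<and> {n - 2, n - 1} \<subseteq> set_decode s \<and> {} \<inter> set_decode s = {}}"
      by (rule arg_cong[where f = card]) (auto simp: states_D_def)
    also have "\<dots> = card {T. T \<subseteq> ?A \<and> even (n + (card T + card {n - 2, n - 1}))}"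
      using assms by (intro card_constrained_states) auto
    also have "\<dots> = card {T. T \<subseteq> ?A \<and> even (n + card T)}"
      using assms by (simp add: ac_simps)
    also have "\<dots> = 2 ^ (card ?A - 1)"
    proof (rule even_shifted_subsets_card)
      have "0 < card ?A" using cA assms by simp
      then show "?A \<noteq> {}" by (metis card.empty less_irrefl)
    qed simp
    finally show ?thesis using cA by simp
  qed
  also have "(\<Sum>i<n - 1. 2 ^ (n - 3)) + 2 ^ (n - 3) = n * 2 ^ (n - 3)"
    using assms by (cases n) auto
  finally show ?thesis .
qed

theorem theorem2p2:
  shows "(\<forall>n m. 1 \<le> m \<and> m \<le> n \<longrightarrow>
            card (hasse_edges (type_A n :: 'k :: {alg_closed_field, field_char_0} based_lie_algebra)
                    (fund_weight_A n m)) = m * (n choose m) \<and>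
            m * (n choose m) = n * ((n - 1) choose (m - 1))) \<and>
         (\<forall>n\<ge>4.
            card (hasse_edges (type_D n :: 'k based_lie_algebra)
                    (half_spin_weight n)) = n * 2 ^ (n - 3))"
proof (intro conjI allI impI)
  fix n m :: nat
  assume nm: "1 \<le> m \<and> m \<le> n"
  then show absorb: "m * (n choose m) = n * ((n - 1) choose (m - 1))"
    by (intro times_binomial_minus1_eq) simp
  show "card (hasse_edges (type_A n :: 'k based_lie_algebra) (fund_weight_A n m)) = m * (n choose m)"
    unfolding absorb using nm by (intro edges_A) auto
next
  fix n :: nat
  assume "4 \<le> n"
  then show "card (hasse_edges (type_D n :: 'k based_lie_algebra) (half_spin_weight n)) = n * 2 ^ (n - 3)"
    by (rule edges_D)
qed

end
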